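(* Let $\ell\geqslant 1$ be an integer and $s>0$. In each of the following cases for $A$, $A'\subset A$, $s$ and $d$, there exists a positive constant $C$ (independent of $N$) such that for every $N\geqslant 2$, every optimal $N$-point $s$-energy configuration $\omega^*_N=\{x^*_1, \ldots, x^*_N\}\subset A$, every $x^*_j \in A'$ and every $x^*_k\in A$ with $k\neq j$, $$|x^*_j-x^*_k|>C N^{-1/d}:$$ (i) $A\subset \mathbb{R}^{\ell+1}$ is a compact $\ell$-regular $C^\infty$-smooth manifold without boundary, $s\in [\ell-1, \ell)$, $A'=A$ and $d=\ell$; (ii) $A\subset \mathbb{R}^\ell$ is compact, $s\in (\ell-2, \ell)$, $A'=\{x\in A: \mathrm{dist}(x, \partial A)\geqslant \varepsilon\}$ with $\varepsilon>0$, and $d=\ell$; (iii) $A=\mathbb{B}^{\ell}$, $s\in (\ell-2, \ell)$, $A'=\{x\in \mathbb{R}^{\ell}: |x|\leqslant 1-\varepsilon\}$ with $\varepsilon\in(0,1)$, and $d=\ell$; (iv) $A=\mathbb{B}^\ell$, $s\in (\ell-2, \ell)$, $A'=\partial \mathbb{B}^\ell$, and $d=(s+\ell)/2$.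
   Context: $\mathbb{B}^\ell:=\{x\in\mathbb{R}^\ell: |x|\leqslant 1\}$, and $\partial$ denotes the topological boundary in $\mathbb{R}^\ell$. An optimal $N$-point $s$-energy configuration is an $N$-point configuration $\omega_N^*=\{x_1^*,\dots,x_N^*\}\subset A$ minimizing $E_s(\omega_N):=\sum_{i\neq j}|x_i-x_j|^{-s}$ over all $N$-point configurations $\omega_N=\{x_1,\dots,x_N\}\subset A$. A compact set $A$ is $\ell$-regular if for some finite Borel measure $\lambda$ supported on $A$ there is a positive constant $C_0$ such that $C_0^{-1}r^\ell\leqslant \lambda(B(x,r))\leqslant C_0r^\ell$ for all $x\in A$ and $0<r<\mathrm{diam}(A)$, where $B(x,r)$ is the open ball. In (i), the manifold is an $\ell$-dimensional embedded $C^\infty$ submanifold of $\mathbb{R}^{\ell+1}$. *)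

theory Defs
  imports "HOL-Analysis.Analysis"
begin

(* Ordered configurations are indexed by {1..N}. Coinciding points are allowed, but contribute
   infinite energy; the explicit case is needed because 0 powr (-s) = 0 for reals. *)

definition riesz_kernel :: "real \<Rightarrow> 'a::real_normed_vector \<Rightarrow> 'a \<Rightarrow> ennreal" where
  "riesz_kernel s x y = (if x = y then \<infinity> else ennreal (norm (x - y) powr (- s)))"

definition riesz_energy :: "real \<Rightarrow> nat \<Rightarrow> (nat \<Rightarrow> 'a::real_normed_vector) \<Rightarrow> ennreal" where
  "riesz_energy s N x = (\<Sum>i\<in>{1..N}. \<Sum>j\<in>{1..N} - {i}. riesz_kernel s (x i) (x j))"

definition optimal_configuration ::
    "real \<Rightarrow> 'a::real_normed_vector set \<Rightarrow> nat \<Rightarrow> (nat \<Rightarrow> 'a) \<Rightarrow> bool" where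
  "optimal_configuration s A N x \<longleftrightarrow>
     x ` {1..N} \<subseteq> A \<and>
     (\<forall>y. y ` {1..N} \<subseteq> A \<longrightarrow> riesz_energy s N x \<le> riesz_energy s N y)"

definition optimal_configurations_separated ::
    "real \<Rightarrow> 'a::real_normed_vector set \<Rightarrow> 'a set \<Rightarrow> real \<Rightarrow> bool" where
  "optimal_configurations_separated s A A' d \<longleftrightarrow>
     (\<exists>C>0. \<forall>N\<ge>2. \<forall>x. optimal_configuration s A N x \<longrightarrow>
        (\<forall>j\<in>{1..N}. \<forall>k\<in>{1..N}. x j \<in> A' \<longrightarrow> k \<noteq> j \<longrightarrow>
           norm (x j - x k) > C * real N powr (- 1 / d)))"

(* The measure is supported on A in the sense that the complement is null; for closed A this
   is the same as the topological support being contained in A. *)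

definition ahlfors_regular :: "nat \<Rightarrow> 'a::euclidean_space set \<Rightarrow> bool" where
  "ahlfors_regular l A \<longleftrightarrow>
     (\<exists>\<nu>::'a measure. finite_measure \<nu> \<and> sets \<nu> = sets borel \<and> emeasure \<nu> (- A) = 0 \<and>
        (\<exists>C0>0. \<forall>x\<in>A. \<forall>r. 0 < r \<and> r < diameter A \<longrightarrow>
           r ^ l / C0 \<le> measure \<nu> (ball x r) \<and> measure \<nu> (ball x r) \<le> C0 * r ^ l))"

(* On open sets, Ck_on k is the usual class of k times continuously differentiable maps:
   all iterated directional derivatives up to order k exist and are continuous. *)

fun Ck_on :: "nat \<Rightarrow> ('a::euclidean_space \<Rightarrow> 'b::euclidean_space) \<Rightarrow> 'a set \<Rightarrow> bool" where
  "Ck_on 0 f U \<longleftrightarrow> continuous_on U f"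
| "Ck_on (Suc k) f U \<longleftrightarrow>
     (\<forall>x\<in>U. f differentiable at x) \<and>
     (\<forall>v. Ck_on k (\<lambda>x. frechet_derivative f (at x) v) U)"

definition Cinfinity_on :: "('a::euclidean_space \<Rightarrow> 'b::euclidean_space) \<Rightarrow> 'a set \<Rightarrow> bool" where
  "Cinfinity_on f U \<longleftrightarrow> (\<forall>k. Ck_on k f U)"

(* Slice charts: near each point a diffeomorphism of ambient open sets flattens M onto a
   piece of an l-dimensional linear subspace. In particular M has no boundary. *)

definition smooth_submanifold :: "nat \<Rightarrow> 'a::euclidean_space set \<Rightarrow> bool" where
  "smooth_submanifold l M \<longleftrightarrow>
     (\<forall>p\<in>M. \<exists>U V \<phi> \<psi> W. open U \<and> p \<in> U \<and> open (V::'a set) \<and> homeomorphism U V \<phi> \<psi> \<and>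
        Cinfinity_on \<phi> U \<and> Cinfinity_on \<psi> V \<and>
        subspace W \<and> dim W = l \<and> \<phi> ` (U \<inter> M) = V \<inter> W)"

end

theory Submission
  imports Defs
begin

text \<open>Let \<open>x\<close> be optimal. The point \<open>p = x j\<close> minimises over \<open>A\<close> the potential \<open>F\<close> of the other points; let \<open>M = F p\<close>. Suppose
  that \<open>\<sigma>\<close> is a measure on \<open>A\<close> of mass at least \<open>1 - K t^e\<close> whose potential at \<open>z \<in> A\<close> is at most both \<open>(1 + K t^e) |z - p|^(-s)\<close>
  and \<open>t^(-s)\<close>. Integrating \<open>F \<ge> M\<close> against \<open>\<sigma>\<close> gives \<open>|p - x k|^(-s) \<le> t^(-s) + 2 K t^e M\<close>, and also \<open>M = O(N)\<close>, by fixing \<open>t\<close>.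
  With \<open>e = d - s\<close> and \<open>t = N^(-1/d)\<close> this is the separation estimate.

  In the interior of \<open>A\<close>, and on a smooth manifold, \<open>e = l - s\<close> and \<open>\<sigma>\<close> is the measure with density proportional to
  \<open>t^(l - s) (t^2 + |y|^2)^(- (l - s/2))\<close>, lifted from the tangent space at \<open>p\<close> to \<open>A\<close> as a graph. In the flat case its potential is
  exactly \<open>(t^2 + |z|^2)^(-s/2)\<close>. Since \<open>l - s < 2\<close>, truncation and curvature cost only a factor \<open>1 + O(t^(l - s))\<close>.

  On the boundary of the ball, \<open>\<sigma>\<close> is the balayage of the unit mass at \<open>(1 + t) p\<close>, obtained from the equilibrium density
  \<open>(1 - |y|^2)^(- (l - s)/2)\<close> by a Kelvin transform. Its mass is \<open>1 - O(t^((l - s)/2))\<close>, whence \<open>e = (l - s)/2\<close> and \<open>d = (s + l)/2\<close>.\<close>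

section \<open>Change of variables and polar coordinates\<close>

text \<open>The measure \<open>\<sigma>\<close> imitates a unit point mass at \<open>p\<close> whose
  potential is capped at t^(-s). The cap is spent on the single point \<open>x k\<close>. The other
  points need the sharp factor 1 + K t^e: their potentials add up to M - |p - x k|^(-s), which may
  be of order N, so any fixed factor above 1 would drown the one term of interest. What is left is
  an error of order t^e N, and equating it with t^(-s) gives N = t^(-(e + s)), that is d = e + s.

  The condition l - s < 2 enters on graphs because curvature costs a relative error of order |y|^2,
  which has to be integrable near 0 against the limiting density |y|^(-(2 l - s)). For the ball it
  says that the exponent (l - s)/2 of the equilibrium density is below 1.

  The ball contains no full neighbourhood of a boundary point \<open>p\<close>, nor a graph through
  it over the whole tangent space, so the pole is moved outside and swept back. The mass lost is the
  relative drop of the equilibrium potential between the sphere and (1 + t) p, and this drop is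
  governed by the behaviour of the density at the boundary.\<close>

lemma nn_integral_indicator_mono:
  assumes "\<And>x. x \<in> A \<Longrightarrow> f x \<le> (g x :: ennreal)"
  shows "(\<integral>\<^sup>+x. f x * indicator A x \<partial>M) \<le> (\<integral>\<^sup>+x. g x * indicator A x \<partial>M)"
  using assms by (intro nn_integral_mono) (simp add: indicator_def)

lemma nn_integral_eq_of_absolutely_integrable:
  fixes f :: "real \<Rightarrow> real"
  assumes S: "S \<in> sets borel" and nn: "\<And>x. x \<in> S \<Longrightarrow> 0 \<le> f x"
    and int: "f absolutely_integrable_on S"
  shows "(\<integral>\<^sup>+x. ennreal (f x) * indicator S x \<partial>lborel) = ennreal (integral S f)"
proof -
  have "(\<integral>\<^sup>+x. ennreal (f x) * indicator S x \<partial>lborel) = (\<integral>\<^sup>+x. ennreal (indicator S x * f x) \<partial>lebesgue)"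
    unfolding nn_integral_completion by (intro nn_integral_cong) (auto simp: indicator_def)
  also have "\<dots> = ennreal (\<integral>x. indicator S x * f x \<partial>lebesgue)"
    using int nn by (intro nn_integral_eq_integral) (auto simp: set_integrable_def indicator_def)
  also have "(\<integral>x. indicator S x * f x \<partial>lebesgue) = integral S f"
    using set_lebesgue_integral_eq_integral(2)[OF int] by (simp add: set_lebesgue_integral_def)
  finally show ?thesis .
qed

lemma nn_integral_finite_imp_absolutely_integrable:
  fixes f :: "real \<Rightarrow> real"
  assumes S: "S \<in> sets borel" and nn: "\<And>x. x \<in> S \<Longrightarrow> 0 \<le> f x"
    and meas: "(\<lambda>x. f x * indicator S x) \<in> borel_measurable borel"
    and fin: "(\<integral>\<^sup>+x. ennreal (f x) * indicator S x \<partial>lborel) < \<infinity>"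
  shows "f absolutely_integrable_on S"
proof -
  have "integrable lborel (\<lambda>x. f x * indicator S x)"
  proof (rule integrableI_nonneg)
    show "(\<lambda>x. f x * indicator S x) \<in> borel_measurable lborel" using meas by simp
    show "AE x in lborel. 0 \<le> f x * indicator S x" using nn by (auto simp: indicator_def)
    have "(\<integral>\<^sup>+x. ennreal (f x * indicator S x) \<partial>lborel) = (\<integral>\<^sup>+x. ennreal (f x) * indicator S x \<partial>lborel)"
      by (intro nn_integral_cong) (auto simp: indicator_def)
    then show "(\<integral>\<^sup>+x. ennreal (f x * indicator S x) \<partial>lborel) < \<infinity>" using fin by simp
  qed
  then have "integrable lebesgue (\<lambda>x. f x * indicator S x)"
    by (rule integrable_completion[THEN iffD2, rotated]) (use meas in simp)
  then show ?thesis by (simp add: set_integrable_def mult.commute)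
qed

text \<open>For nonnegative measurable integrands absolute integrability amounts to a finite
  integral. Integrability transfers in both directions, so the two sides are either finite and equal
  or both infinite.\<close>

lemma nn_integral_change_of_variables_real:
  fixes f g g' :: "real \<Rightarrow> real"
  assumes S: "S \<in> sets borel" and gS: "g ` S = T" and T: "T \<in> sets borel"
    and der: "\<And>x. x \<in> S \<Longrightarrow> (g has_field_derivative g' x) (at x)"
    and inj: "inj_on g S"
    and nn: "\<And>x. x \<in> T \<Longrightarrow> 0 \<le> f x"
    and f: "f \<in> borel_measurable borel"
    and fg: "(\<lambda>x. \<bar>g' x\<bar> * f (g x) * indicator S x) \<in> borel_measurable borel"
  shows "(\<integral>\<^sup>+x. ennreal (f x) * indicator T x \<partial>lborel)
       = (\<integral>\<^sup>+x. ennreal (\<bar>g' x\<bar> * f (g x)) * indicator S x \<partial>lborel)" (is "?A = ?B")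
proof -
  have ch: "(\<lambda>x. \<bar>g' x\<bar> * f(g x)) absolutely_integrable_on S \<and>
           integral S (\<lambda>x. \<bar>g' x\<bar> * f (g x)) = b
     \<longleftrightarrow> f absolutely_integrable_on T \<and> integral T f = b" for b
    unfolding gS[symmetric]
  proof (rule has_absolute_integral_change_of_variables_1'[OF _ _ inj])
    show "S \<in> sets lebesgue" using S by simp
    show "(g has_field_derivative g' x) (at x within S)" if "x \<in> S" for x
      using der[OF that] by (rule has_field_derivative_at_within)
  qed
  have nn2: "\<And>x. x \<in> S \<Longrightarrow> 0 \<le> \<bar>g' x\<bar> * f (g x)" using nn gS by auto
  show ?thesis
  proof (cases "f absolutely_integrable_on T")
    case True
    then have "(\<lambda>x. \<bar>g' x\<bar> * f(g x)) absolutely_integrable_on S"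
        "integral S (\<lambda>x. \<bar>g' x\<bar> * f (g x)) = integral T f"
      using ch[of "integral T f"] by auto
    then show ?thesis
      using nn_integral_eq_of_absolutely_integrable[OF S nn2] nn_integral_eq_of_absolutely_integrable[OF T nn True]
      by simp
  next
    case False
    then have "\<not> (\<lambda>x. \<bar>g' x\<bar> * f(g x)) absolutely_integrable_on S" using ch by blast
    then have "\<not> ?B < \<infinity>"
      using nn_integral_finite_imp_absolutely_integrable[OF S nn2 fg] by blast
    moreover have "(\<lambda>x. f x * indicator T x) \<in> borel_measurable borel"
      using f T by simp
    then have "\<not> ?A < \<infinity>"
      using nn_integral_finite_imp_absolutely_integrable[OF T, of f] nn False by blast
    ultimately show ?thesis by (simp add: not_less top_unique)
  qed
qed

section \<open>Scaling, translation and one-dimensional model integrals\<close>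

lemma nn_integral_lborel_scale:
  fixes f :: "'a::euclidean_space \<Rightarrow> ennreal"
  assumes f: "f \<in> borel_measurable borel" and c: "c > 0"
  shows "(\<integral>\<^sup>+x. f x \<partial>lborel) = ennreal (c ^ DIM('a)) * (\<integral>\<^sup>+x. f (t + c *\<^sub>R x) \<partial>lborel)"
proof -
  have "(\<integral>\<^sup>+x. f x \<partial>lborel) = (\<integral>\<^sup>+x. f x \<partial>density (distr lborel borel (\<lambda>x. t + c *\<^sub>R x)) (\<lambda>_. \<bar>c\<bar>^DIM('a)))"
    using lborel_affine[of c t] c by simp
  also have "\<dots> = ennreal (c ^ DIM('a)) * (\<integral>\<^sup>+x. f (t + c *\<^sub>R x) \<partial>lborel)"
    using c f by (subst nn_integral_density; simp add: nn_integral_cmult nn_integral_distr)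
  finally show ?thesis .
qed

lemma nn_integral_lborel_translate:
  fixes f :: "'a::euclidean_space \<Rightarrow> ennreal"
  assumes f: "f \<in> borel_measurable borel"
  shows "(\<integral>\<^sup>+x. f (t + x) \<partial>lborel) = (\<integral>\<^sup>+x. f x \<partial>lborel)"
  using nn_integral_lborel_scale[OF f, of 1 t] by simp

lemma nn_integral_lborel_uminus:
  fixes f :: "'a::euclidean_space \<Rightarrow> ennreal"
  assumes f: "f \<in> borel_measurable borel"
  shows "(\<integral>\<^sup>+x. f (- x) \<partial>lborel) = (\<integral>\<^sup>+x. f x \<partial>lborel)"
proof -
  have "(\<integral>\<^sup>+x. f x \<partial>lborel) = (\<integral>\<^sup>+x. f x \<partial>density (distr lborel borel (\<lambda>x. 0 + (-1) *\<^sub>R x)) (\<lambda>_. 1))"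
    using lborel_affine[of "-1" "0::'a"] by simp
  also have "\<dots> = (\<integral>\<^sup>+x. f (-x) \<partial>lborel)"
    using f by (subst nn_integral_density; simp add: nn_integral_cmult nn_integral_distr)
  finally show ?thesis by simp
qed

text \<open>Represents X^(-c) as a mixture of exponentials. With X a squared distance, both the
  bubble and the Riesz kernel become mixtures of Gaussians. The proof rescales the Gamma integral by
  X.\<close>

lemma nn_integral_Gamma:
  assumes c: "c > 0" and X: "X > 0"
  shows "(\<integral>\<^sup>+u. ennreal (u powr (c - 1) * exp (- u * X)) * indicator {0<..} u \<partial>lborel)
        = ennreal (Gamma c * X powr (- c))"
proof -
  have "(\<integral>\<^sup>+u. ennreal (u powr (c - 1) * exp (- u)) * indicator {0<..} u \<partial>lborel) = ennreal (Gamma c)"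
  proof -
    have "ennreal (Gamma c) = (\<integral>\<^sup>+u. ennreal (indicator {0..} u * (u powr (c - 1) / exp u)) \<partial>lborel)"
      using nn_integral_has_integral_lebesgue[OF _ Gamma_integral_real[OF c]] by simp
    also have "\<dots> = (\<integral>\<^sup>+u. ennreal (u powr (c - 1) * exp (- u)) * indicator {0<..} u \<partial>lborel)"
      by (intro nn_integral_cong) (auto simp: indicator_def exp_minus field_simps)
    finally show ?thesis ..
  qed
  also have "(\<integral>\<^sup>+u. ennreal (u powr (c - 1) * exp (- u)) * indicator {0<..} u \<partial>lborel)
     = ennreal X * (\<integral>\<^sup>+u. ennreal ((X * u) powr (c - 1) * exp (- (X * u))) * indicator {0<..} (X * u) \<partial>lborel)"
    using nn_integral_lborel_scale[of "\<lambda>u::real. ennreal (u powr (c - 1) * exp (- u)) * indicator {0<..} u" X 0] X by simp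
  also have "\<dots> = ennreal X * (\<integral>\<^sup>+u. ennreal (X powr (c - 1)) * (ennreal (u powr (c - 1) * exp (- u * X)) * indicator {0<..} u) \<partial>lborel)"
  proof -
    have "(X * u) powr (c - 1) * exp (- (X * u)) = X powr (c - 1) * (u powr (c - 1) * exp (- u * X))" if "u > 0" for u
      using X that by (simp add: powr_mult mult_ac)
    then have "ennreal ((X * u) powr (c - 1) * exp (- (X * u))) * indicator {0<..} (X * u)
        = ennreal (X powr (c - 1)) * (ennreal (u powr (c - 1) * exp (- u * X)) * indicator {0<..} u)" for u
      using X by (cases "u > 0") (simp_all add: zero_less_mult_iff ennreal_mult)
    then show ?thesis by simp
  qed
  also have "\<dots> = ennreal (X powr c) * (\<integral>\<^sup>+u. (ennreal (u powr (c - 1) * exp (- u * X)) * indicator {0<..} u) \<partial>lborel)"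
    using X by (subst nn_integral_cmult) (auto simp: mult.assoc[symmetric] powr_diff simp flip: ennreal_mult)
  finally have "ennreal (Gamma c) * ennreal (X powr - c) = ennreal (X powr -c) * (ennreal (X powr c) * (\<integral>\<^sup>+u. (ennreal (u powr (c - 1) * exp (- u * X)) * indicator {0<..} u) \<partial>lborel))"
    by (simp add: mult.commute)
  also have "\<dots> = (\<integral>\<^sup>+u. (ennreal (u powr (c - 1) * exp (- u * X)) * indicator {0<..} u) \<partial>lborel)"
    using X by (simp add: mult.assoc[symmetric] powr_minus flip: ennreal_mult)
  finally show ?thesis using X c by (simp add: ennreal_mult)
qed

lemma nn_integral_powr_from_0:
  assumes p: "p > (0::real)" and c: "c \<ge> 0"
  shows "(\<integral>\<^sup>+t. ennreal (t powr (p - 1)) * indicator {0<..c} t \<partial>lborel) = ennreal (c powr p / p)"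
proof -
  have "((\<lambda>t. t powr (p - 1)) has_integral (c powr p / p)) {0..c}"
    using has_integral_powr_from_0[of "p - 1" c] p c by simp
  then have "(\<integral>\<^sup>+t. ennreal (indicator {0..c} t * t powr (p - 1)) \<partial>lborel) = ennreal (c powr p / p)"
    by (intro nn_integral_has_integral_lebesgue) auto
  also have "(\<integral>\<^sup>+t. ennreal (indicator {0..c} t * t powr (p - 1)) \<partial>lborel)
     = (\<integral>\<^sup>+t. ennreal (t powr (p - 1)) * indicator {0<..c} t \<partial>lborel)"
    by (intro nn_integral_cong) (auto simp: indicator_def)
  finally show ?thesis .
qed

lemma nn_integral_powr_to_inf:
  assumes p: "p > (0::real)" and c: "c > 0"
  shows "(\<integral>\<^sup>+t. ennreal (t powr (- p - 1)) * indicator {c..} t \<partial>lborel) = ennreal (c powr (- p) / p)"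
proof -
  have "((\<lambda>t. t powr (- p - 1)) has_integral (c powr (- p) / p)) {c..}"
    using has_integral_powr_to_inf[of "- p - 1" c] p c by simp
  then have "(\<integral>\<^sup>+t. ennreal (indicator {c..} t * t powr (- p - 1)) \<partial>lborel) = ennreal (c powr (- p) / p)"
    by (intro nn_integral_has_integral_lebesgue) auto
  also have "(\<integral>\<^sup>+t. ennreal (indicator {c..} t * t powr (- p - 1)) \<partial>lborel)
     = (\<integral>\<^sup>+t. ennreal (t powr (- p - 1)) * indicator {c..} t \<partial>lborel)"
    by (intro nn_integral_cong) (auto simp: indicator_def)
  finally show ?thesis .
qed

section \<open>Polar coordinates and integrals of radial functions\<close>

definition shell :: "'a::euclidean_space set" where
  "shell = {u. 1 \<le> norm u \<and> norm u \<le> 2}"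

lemma shell_measurable [measurable]: "shell \<in> sets borel"
  unfolding shell_def by measurable

lemma emeasure_shell_finite: "emeasure lborel (shell :: 'a::euclidean_space set) < \<infinity>"
proof -
  have "emeasure lborel (shell :: 'a set) \<le> emeasure lborel (cball 0 2 :: 'a set)"
    by (intro emeasure_mono) (auto simp: shell_def)
  also have "\<dots> < \<infinity>" using emeasure_lborel_cball_finite by auto
  finally show ?thesis .
qed

text \<open>The \<open>t\<close> with y / t in the shell form the interval [|y| / 2, |y|], whose
  measure under dt / t does not depend on \<open>y\<close>.\<close>

lemma nn_integral_dilations_through_shell:
  fixes y :: "'a::euclidean_space"
  assumes "y \<noteq> 0"
  shows "(\<integral>\<^sup>+t. ennreal (1 / t) * indicator shell (y /\<^sub>R t) * indicator {0<..} t \<partial>lborel) = ennreal (ln 2)"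
proof -
  define r where "r = norm y"
  have r: "r > 0" using assms by (simp add: r_def)
  have "(\<integral>\<^sup>+t. ennreal (1 / t) * indicator shell (y /\<^sub>R t) * indicator {0<..} t \<partial>lborel)
      = (\<integral>\<^sup>+t. ennreal (1 / t) * indicator {r / 2 .. r} t \<partial>lborel)"
  proof (intro nn_integral_cong)
    fix t :: real
    have "t \<notin> {r / 2 .. r}" if "\<not> t > 0"
    proof -
      have "t < r / 2" using that r by linarith
      then show ?thesis by simp
    qed
    then show "ennreal (1 / t) * indicator shell (y /\<^sub>R t) * indicator {0<..} t
        = ennreal (1 / t) * indicator {r / 2 .. r} t"
      by (cases "t > 0") (auto simp: indicator_def shell_def field_simps r_def)
  qed
  also have "\<dots> = ennreal (ln r - ln (r / 2))"
    using r by (intro nn_integral_FTC_Icc) (auto intro!: derivative_eq_intros simp: field_simps)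
  also have "ln r - ln (r / 2) = ln 2" using r by (simp add: ln_div)
  finally show ?thesis .
qed

text \<open>A shell of directions stands in for the unit sphere, so that no surface measure is needed; \<open>ln 2\<close> is its logarithmic thickness.\<close>

lemma nn_integral_polar:
  fixes f :: "'a::euclidean_space \<Rightarrow> ennreal"
  assumes f[measurable]: "f \<in> borel_measurable borel"
  shows "ennreal (ln 2) * (\<integral>\<^sup>+y. f y \<partial>lborel) =
    (\<integral>\<^sup>+u. (\<integral>\<^sup>+t. f (t *\<^sub>R u) * ennreal (t ^ (DIM('a) - 1)) * indicator {0<..} t \<partial>lborel) * indicator shell u \<partial>lborel)"
proof -
  let ?d = "DIM('a)"
  \<comment> \<open>At fixed \<open>t\<close> the substitution y = t u replaces the weight t^(d-1)
    by 1 / t. After the integrals are interchanged, every y \<noteq> 0 is counted with total weight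
    ln 2.\<close>
  have inner: "(\<integral>\<^sup>+u. f (t *\<^sub>R u) * ennreal (t ^ (?d - 1)) * indicator {0<..} t * indicator shell u \<partial>lborel)
     = (\<integral>\<^sup>+y. f y * (ennreal (1 / t) * indicator shell (y /\<^sub>R t) * indicator {0<..} t) \<partial>lborel)" for t :: real
  proof (cases "t > 0")
    case True
    have e: "ennreal (1 / t) * ennreal (t ^ ?d) = ennreal (t ^ (?d - 1))"
      using True power_minus_mult[OF DIM_positive[where 'a='a], of t] by (simp add: field_simps flip: ennreal_mult)
    have "(\<integral>\<^sup>+y. f y * (ennreal (1 / t) * indicator shell (y /\<^sub>R t) * indicator {0<..} t) \<partial>lborel)
       = (\<integral>\<^sup>+y. ennreal (1 / t) * (f y * indicator shell (y /\<^sub>R t)) \<partial>lborel)"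
      using True by (intro nn_integral_cong) (simp add: mult_ac)
    also have "\<dots> = ennreal (1 / t) * (\<integral>\<^sup>+y. f y * indicator shell (y /\<^sub>R t) \<partial>lborel)"
      by (rule nn_integral_cmult) measurable
    also have "(\<integral>\<^sup>+y. f y * indicator shell (y /\<^sub>R t) \<partial>lborel)
        = ennreal (t ^ ?d) * (\<integral>\<^sup>+u. f (t *\<^sub>R u) * indicator shell u \<partial>lborel)"
      using nn_integral_lborel_scale[of "\<lambda>y. f y * indicator shell (y /\<^sub>R t)" t 0] True by simp
    also have "ennreal (1 / t) * (ennreal (t ^ ?d) * (\<integral>\<^sup>+u. f (t *\<^sub>R u) * indicator shell u \<partial>lborel))
        = ennreal (t ^ (?d - 1)) * (\<integral>\<^sup>+u. f (t *\<^sub>R u) * indicator shell u \<partial>lborel)"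
      by (simp add: e flip: mult.assoc)
    also have "\<dots> = (\<integral>\<^sup>+u. ennreal (t ^ (?d - 1)) * (f (t *\<^sub>R u) * indicator shell u) \<partial>lborel)"
      by (rule nn_integral_cmult[symmetric]) measurable
    also have "\<dots> = (\<integral>\<^sup>+u. f (t *\<^sub>R u) * ennreal (t ^ (?d - 1)) * indicator {0<..} t * indicator shell u \<partial>lborel)"
      using True by (intro nn_integral_cong) (simp add: mult_ac)
    finally show ?thesis ..
  qed simp
  have "(\<integral>\<^sup>+u. (\<integral>\<^sup>+t. f (t *\<^sub>R u) * ennreal (t ^ (?d - 1)) * indicator {0<..} t \<partial>lborel) * indicator shell u \<partial>lborel)
     = (\<integral>\<^sup>+u. (\<integral>\<^sup>+t. f (t *\<^sub>R u) * ennreal (t ^ (?d - 1)) * indicator {0<..} t * indicator shell u \<partial>lborel) \<partial>lborel)"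
    by (intro nn_integral_cong nn_integral_multc[symmetric]) measurable
  also have "\<dots> = (\<integral>\<^sup>+t. (\<integral>\<^sup>+u. f (t *\<^sub>R u) * ennreal (t ^ (?d - 1)) * indicator {0<..} t * indicator shell u \<partial>lborel) \<partial>lborel)"
    by (rule lborel_pair.Fubini') measurable
  also have "\<dots> = (\<integral>\<^sup>+t. (\<integral>\<^sup>+y. f y * (ennreal (1 / t) * indicator shell (y /\<^sub>R t) * indicator {0<..} t) \<partial>lborel) \<partial>lborel)"
    by (simp only: inner)
  also have "\<dots> = (\<integral>\<^sup>+y. (\<integral>\<^sup>+t. f y * (ennreal (1 / t) * indicator shell (y /\<^sub>R t) * indicator {0<..} t) \<partial>lborel) \<partial>lborel)"
    by (rule lborel_pair.Fubini') measurable
  also have "\<dots> = (\<integral>\<^sup>+y. f y * (\<integral>\<^sup>+t. (ennreal (1 / t) * indicator shell (y /\<^sub>R t) * indicator {0<..} t) \<partial>lborel) \<partial>lborel)"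
    by (intro nn_integral_cong nn_integral_cmult) measurable
  also have "\<dots> = (\<integral>\<^sup>+y. f y * ennreal (ln 2) \<partial>lborel)"
  proof (rule nn_integral_cong_AE)
    have "AE y in lborel. y \<noteq> (0::'a)" by (rule AE_lborel_singleton)
    then show "AE y in lborel. f y * (\<integral>\<^sup>+t. (ennreal (1 / t) * indicator shell (y /\<^sub>R t) * indicator {0<..} t) \<partial>lborel)
         = f y * ennreal (ln 2)"
      by eventually_elim (subst nn_integral_dilations_through_shell; simp)
  qed
  also have "\<dots> = ennreal (ln 2) * (\<integral>\<^sup>+y. f y \<partial>lborel)"
    by (subst nn_integral_multc) (auto simp: mult.commute)
  finally show ?thesis ..
qed

lemma nn_integral_norm_powr_scale:
  fixes q c :: real
  assumes c: "c > 0" and P: "Measurable.pred borel P"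
  shows "(\<integral>\<^sup>+(y::'a::euclidean_space). ennreal (norm y powr (- q)) * indicator {y. P (norm y / c)} y \<partial>lborel)
    = ennreal (c powr (DIM('a) - q)) * (\<integral>\<^sup>+(y::'a). ennreal (norm y powr (- q)) * indicator {y. P (norm y)} y \<partial>lborel)"
proof -
  let ?h = "\<lambda>y::'a. ennreal (norm y powr (- q)) * indicator {y. P (norm y / c)} y"
  have m[measurable]: "{y::'a. P (norm y)} \<in> sets borel" "{y::'a. P (norm y / c)} \<in> sets borel"
    using P by measurable
  have "(\<integral>\<^sup>+y. ?h y \<partial>lborel) = ennreal (c ^ DIM('a)) * (\<integral>\<^sup>+y. ?h (0 + c *\<^sub>R y) \<partial>lborel)"
    by (rule nn_integral_lborel_scale) (use c in measurable)
  also have "(\<integral>\<^sup>+y. ?h (0 + c *\<^sub>R y) \<partial>lborel)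
     = (\<integral>\<^sup>+y. ennreal (c powr (- q)) * (ennreal (norm y powr (- q)) * indicator {y::'a. P (norm y)} y) \<partial>lborel)"
    using c by (intro nn_integral_cong) (auto simp: indicator_def powr_mult ennreal_mult)
  also have "\<dots> = ennreal (c powr (- q)) * (\<integral>\<^sup>+(y::'a). ennreal (norm y powr (- q)) * indicator {y. P (norm y)} y \<partial>lborel)"
    by (rule nn_integral_cmult) measurable
  finally show ?thesis
    using c by (simp add: powr_diff powr_minus powr_realpow divide_inverse ennreal_mult mult.assoc)
qed

text \<open>On the ray through \<open>u\<close> the substitution r = t |u| produces the factor
  |u|^(-d), which is at most 1 on the shell and is dropped. The inequality suffices to show that
  integrals are finite.\<close>

lemma nn_integral_radial_le:
  fixes F :: "real \<Rightarrow> ennreal"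
  assumes F[measurable]: "F \<in> borel_measurable borel"
  shows "ennreal (ln 2) * (\<integral>\<^sup>+(y::'a::euclidean_space). F (norm y) \<partial>lborel)
    \<le> emeasure lborel (shell :: 'a set) * (\<integral>\<^sup>+t. F t * ennreal (t ^ (DIM('a) - 1)) * indicator {0<..} t \<partial>lborel)"
proof -
  let ?w = "\<lambda>t. ennreal (t ^ (DIM('a) - 1)) * indicator {0<..} (t::real)"
  let ?I = "\<integral>\<^sup>+t. F t * ?w t \<partial>lborel"
  have ray: "(\<integral>\<^sup>+t. F (norm (t *\<^sub>R u)) * ennreal (t ^ (DIM('a) - 1)) * indicator {0<..} t \<partial>lborel) \<le> ?I"
    if "u \<in> shell" for u :: 'a
  proof -
    let ?n = "norm u"
    have n: "?n \<ge> 1" using that by (simp add: shell_def)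
    then have n0: "?n > 0" by linarith
    have "F (norm (t *\<^sub>R u)) * ennreal (t ^ (DIM('a) - 1)) * indicator {0<..} t \<le> F (0 + ?n *\<^sub>R t) * ?w (0 + ?n *\<^sub>R t)" for t
    proof (cases "t > 0")
      case True
      have "1 * t \<le> ?n * t" using n True by (intro mult_right_mono) auto
      then have "t ^ (DIM('a) - 1) \<le> (?n * t) ^ (DIM('a) - 1)" using True by (intro power_mono) auto
      then show ?thesis using True n0 by (auto simp: zero_less_mult_iff mult.commute intro!: mult_left_mono ennreal_leI)
    qed simp
    then have "(\<integral>\<^sup>+t. F (norm (t *\<^sub>R u)) * ennreal (t ^ (DIM('a) - 1)) * indicator {0<..} t \<partial>lborel)
        \<le> (\<integral>\<^sup>+t. F (0 + ?n *\<^sub>R t) * ?w (0 + ?n *\<^sub>R t) \<partial>lborel)"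
      by (intro nn_integral_mono)
    also have "\<dots> \<le> ennreal (?n ^ DIM(real)) * (\<integral>\<^sup>+t. F (0 + ?n *\<^sub>R t) * ?w (0 + ?n *\<^sub>R t) \<partial>lborel)"
    proof -
      have "1 \<le> ennreal (?n ^ DIM(real))" using n by simp
      from mult_right_mono[OF this, of "\<integral>\<^sup>+t. F (0 + ?n *\<^sub>R t) * ?w (0 + ?n *\<^sub>R t) \<partial>lborel"] show ?thesis by simp
    qed
    also have "\<dots> = ?I" using n0 by (intro nn_integral_lborel_scale[symmetric]) auto
    finally show ?thesis .
  qed
  have "ennreal (ln 2) * (\<integral>\<^sup>+(y::'a). F (norm y) \<partial>lborel)
      = (\<integral>\<^sup>+(u::'a). (\<integral>\<^sup>+t. F (norm (t *\<^sub>R u)) * ennreal (t ^ (DIM('a) - 1)) * indicator {0<..} t \<partial>lborel) * indicator shell u \<partial>lborel)"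
    by (rule nn_integral_polar) measurable
  also have "\<dots> \<le> (\<integral>\<^sup>+(u::'a). ?I * indicator shell u \<partial>lborel)"
    by (intro nn_integral_indicator_mono ray)
  also have "\<dots> = emeasure lborel (shell :: 'a set) * ?I"
    by (subst nn_integral_cmult_indicator) (auto simp: mult.commute)
  finally show ?thesis by (simp add: mult.assoc)
qed

lemma nn_integral_norm_powr_finite:
  fixes q c :: real
  assumes P[measurable]: "Measurable.pred borel P"
    and le: "(\<integral>\<^sup>+t. ennreal (t powr (real DIM('a::euclidean_space) - q - 1)) * indicator {t. P t} t * indicator {0<..} t \<partial>lborel) \<le> ennreal c"
  shows "(\<integral>\<^sup>+(y::'a). ennreal (norm y powr (- q)) * indicator {y. P (norm y)} y \<partial>lborel) < \<infinity>" (is "?I < _")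
proof -
  let ?F = "\<lambda>t. ennreal (t powr (- q)) * indicator {t. P t} t"
  have w: "?F t * ennreal (t ^ (DIM('a) - 1)) * indicator {0<..} t
     = ennreal (t powr (real DIM('a) - q - 1)) * indicator {t. P t} t * indicator {0<..} t" for t :: real
  proof (cases "t > 0")
    case True
    have "real DIM('a) - q - 1 = - q + real (DIM('a) - 1)" by (simp add: of_nat_diff Suc_leI)
    then have "t powr (real DIM('a) - q - 1) = t powr (- q) * t ^ (DIM('a) - 1)"
      by (simp only: powr_add powr_realpow[OF True])
    then show ?thesis using True by (simp add: ennreal_mult mult_ac)
  qed simp
  have "ennreal (ln 2) * (\<integral>\<^sup>+(y::'a). ?F (norm y) \<partial>lborel)
      \<le> emeasure lborel (shell :: 'a set) * (\<integral>\<^sup>+t. ?F t * ennreal (t ^ (DIM('a) - 1)) * indicator {0<..} t \<partial>lborel)"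
    by (rule nn_integral_radial_le) measurable
  also have "\<dots> \<le> emeasure lborel (shell :: 'a set) * ennreal c"
    unfolding w by (intro mult_left_mono le) simp
  also have "\<dots> < \<infinity>" using emeasure_shell_finite[where 'a='a] by (simp add: ennreal_mult_less_top)
  finally show ?thesis by (auto simp: ennreal_mult_less_top indicator_def)
qed

lemma nn_integral_norm_powr_near_0:
  fixes q :: real
  assumes q: "q < DIM('a::euclidean_space)"
  shows "(\<integral>\<^sup>+(y::'a). ennreal (norm y powr (- q)) * indicator {y. norm y < 1} y \<partial>lborel) < \<infinity>"
proof (rule nn_integral_norm_powr_finite)
  have "(\<integral>\<^sup>+t. ennreal (t powr (real DIM('a) - q - 1)) * indicator {t. t < 1} t * indicator {0<..} t \<partial>lborel)
     \<le> (\<integral>\<^sup>+t. ennreal (t powr ((real DIM('a) - q) - 1)) * indicator {0<..1} t \<partial>lborel)"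
    by (intro nn_integral_mono) (simp add: indicator_def)
  also have "\<dots> = ennreal (1 powr (real DIM('a) - q) / (real DIM('a) - q))"
    using q by (intro nn_integral_powr_from_0) auto
  finally show "(\<integral>\<^sup>+t. ennreal (t powr (real DIM('a) - q - 1)) * indicator {t. t < 1} t * indicator {0<..} t \<partial>lborel)
     \<le> ennreal (1 powr (real DIM('a) - q) / (real DIM('a) - q))" .
qed measurable

lemma nn_integral_norm_powr_near_infinity:
  fixes q :: real
  assumes q: "q > DIM('a::euclidean_space)"
  shows "(\<integral>\<^sup>+(y::'a). ennreal (norm y powr (- q)) * indicator {y. norm y \<ge> 1} y \<partial>lborel) < \<infinity>"
proof (rule nn_integral_norm_powr_finite)
  have "(\<integral>\<^sup>+t. ennreal (t powr (real DIM('a) - q - 1)) * indicator {t. t \<ge> 1} t * indicator {0<..} t \<partial>lborel)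
     = (\<integral>\<^sup>+t. ennreal (t powr (- (q - real DIM('a)) - 1)) * indicator {1..} t \<partial>lborel)"
    by (intro nn_integral_cong) (simp add: indicator_def)
  also have "\<dots> = ennreal (1 powr (- (q - real DIM('a))) / (q - real DIM('a)))"
    using q by (intro nn_integral_powr_to_inf) auto
  finally show "(\<integral>\<^sup>+t. ennreal (t powr (real DIM('a) - q - 1)) * indicator {t. t \<ge> 1} t * indicator {0<..} t \<partial>lborel)
     \<le> ennreal (1 powr (- (q - real DIM('a))) / (q - real DIM('a)))" by simp
qed measurable

section \<open>A planar density with explicit Riesz potential\<close>

text \<open>The constant \<pi>^(d/2), kept symbolic: it enters the mass and the potential of the
  bubble as the same factor.\<close>

definition gauss :: "'a::euclidean_space itself \<Rightarrow> ennreal" where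
  "gauss _ = (\<integral>\<^sup>+(y::'a). ennreal (exp (- (norm y)\<^sup>2)) \<partial>lborel)"

text \<open>Completing the square moves the centre to the weighted mean \<open>m\<close> of 0 and
  \<open>z\<close>, and a dilation by (a + b)^(-1/2) normalises the width. The case b = 0 yields the
  mass of a single Gaussian.\<close>

lemma nn_integral_gaussian:
  fixes z :: "'a::euclidean_space"
  assumes a: "a > 0" and b: "b \<ge> 0"
  shows "(\<integral>\<^sup>+y. ennreal (exp (- a * (norm y)\<^sup>2 - b * (norm (y - z))\<^sup>2)) \<partial>lborel)
    = gauss TYPE('a) * ennreal ((a + b) powr (- real DIM('a) / 2) * exp (- (a * b / (a + b)) * (norm z)\<^sup>2))"
proof -
  define c where "c = a + b"
  have c: "c > 0" using a b by (simp add: c_def)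
  define m where "m = (b / c) *\<^sub>R z"
  let ?E = "ennreal (exp (- (a * b / c) * (norm z)\<^sup>2))"
  let ?r = "c powr (- 1 / 2)"
  have r: "?r > 0" "?r\<^sup>2 = 1 / c" "?r ^ DIM('a) = c powr (- real DIM('a) / 2)"
    using c by (simp_all add: powr_power powr_minus_divide power_divide)
  have sq: "- a * (norm (m + ?r *\<^sub>R y))\<^sup>2 - b * (norm (m + ?r *\<^sub>R y - z))\<^sup>2
      = - (norm y)\<^sup>2 - (a * b / c) * (norm z)\<^sup>2" for y :: 'a
  proof -
    define v where "v = m + ?r *\<^sub>R y"
    have cm: "c *\<^sub>R m = b *\<^sub>R z" using c by (simp add: m_def)
    have "a * (norm v)\<^sup>2 + b * (norm (v - z))\<^sup>2 = c * (v \<bullet> v) - 2 * (v \<bullet> (b *\<^sub>R z)) + b * (z \<bullet> z)"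
      unfolding power2_norm_eq_inner c_def by (simp add: inner_commute algebra_simps)
    also have "\<dots> = c * ((v - m) \<bullet> (v - m)) - m \<bullet> (c *\<^sub>R m) + b * (z \<bullet> z)"
      unfolding cm[symmetric] by (simp add: inner_commute algebra_simps)
    also have "m \<bullet> (c *\<^sub>R m) = b * b / c * (z \<bullet> z)"
      unfolding cm by (simp add: m_def)
    also have "(v - m) \<bullet> (v - m) = ?r\<^sup>2 * (y \<bullet> y)"
      by (simp add: v_def power2_eq_square)
    also have "c * (?r\<^sup>2 * (y \<bullet> y)) = y \<bullet> y" using c r by simp
    also have "y \<bullet> y - b * b / c * (z \<bullet> z) + b * (z \<bullet> z) = y \<bullet> y + (a * b / c) * (z \<bullet> z)"
      using c by (simp add: c_def field_simps)
    finally show ?thesis unfolding v_def power2_norm_eq_inner by simp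
  qed
  have "(\<integral>\<^sup>+y. ennreal (exp (- a * (norm y)\<^sup>2 - b * (norm (y - z))\<^sup>2)) \<partial>lborel)
      = ennreal (?r ^ DIM('a)) * (\<integral>\<^sup>+(y::'a). ennreal (exp (- (norm y)\<^sup>2 - (a * b / c) * (norm z)\<^sup>2)) \<partial>lborel)"
    by (subst nn_integral_lborel_scale[where c="?r" and t=m]) (use r in \<open>auto simp only: sq\<close>, measurable)
  also have "(\<integral>\<^sup>+(y::'a). ennreal (exp (- (norm y)\<^sup>2 - (a * b / c) * (norm z)\<^sup>2)) \<partial>lborel)
      = (\<integral>\<^sup>+(y::'a). ennreal (exp (- (norm y)\<^sup>2)) * ?E \<partial>lborel)"
    by (intro nn_integral_cong) (simp add: exp_diff exp_minus divide_inverse flip: ennreal_mult)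
  also have "\<dots> = gauss TYPE('a) * ?E"
    unfolding gauss_def by (rule nn_integral_multc) measurable
  finally show ?thesis unfolding r(3)
    by (simp add: ennreal_mult mult_ac c_def)
qed

text \<open>The image under stereographic projection of the uniform measure on a sphere, reweighted by the conformal
  factor of the Riesz kernel; hence its explicit potential.\<close>

definition bubble :: "real \<Rightarrow> real \<Rightarrow> 'a::euclidean_space \<Rightarrow> real" where
  "bubble s t y = (t\<^sup>2 + (norm y)\<^sup>2) powr (- (DIM('a) - s / 2))"

definition bubble_mass :: "'a::euclidean_space itself \<Rightarrow> real \<Rightarrow> real \<Rightarrow> ennreal" where
  "bubble_mass _ s t = (\<integral>\<^sup>+(y::'a). ennreal (bubble s t y) \<partial>lborel)"

lemma bubble_measurable [measurable]: "bubble s t \<in> borel_measurable borel"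
  unfolding bubble_def by measurable

lemma bubble_nonneg [simp]: "bubble s t y \<ge> 0"
  by (simp add: bubble_def)

text \<open>As a mixture of centred Gaussians the bubble can be integrated against the kernel,
  another such mixture, one pair of Gaussians at a time.\<close>

lemma bubble_mixture:
  fixes y :: "'a::euclidean_space" and s t :: real
  assumes s: "0 < s" "s < DIM('a)" and t: "t > 0"
  defines "q \<equiv> DIM('a) - s / 2"
  shows "ennreal (Gamma q) * ennreal (bubble s t y)
     = (\<integral>\<^sup>+a. ennreal (a powr (q - 1) * exp (- a * (t\<^sup>2 + (norm y)\<^sup>2))) * indicator {0<..} a \<partial>lborel)"
proof -
  have "t\<^sup>2 + (norm y)\<^sup>2 > 0" using t by (intro add_pos_nonneg) auto
  moreover have q: "q > 0" using s by (simp add: q_def)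
  ultimately show ?thesis
    using nn_integral_Gamma[of q "t\<^sup>2 + (norm y)\<^sup>2"]
    by (simp add: bubble_def ennreal_mult Gamma_real_nonneg flip: q_def)
qed

text \<open>Each Gaussian of the mixture has mass proportional to a^(-d/2). This lowers the exponent
  from q to q - d/2 = (d - s)/2, and the remaining integral over \<open>a\<close> is again a Gamma
  integral.\<close>

lemma bubble_mass_eq:
  fixes s t :: real
  assumes s: "0 < s" "s < DIM('a::euclidean_space)" and t: "t > 0"
  defines "q \<equiv> DIM('a) - s / 2"
  shows "ennreal (Gamma q) * bubble_mass TYPE('a) s t
     = gauss TYPE('a) * ennreal (Gamma ((DIM('a) - s) / 2) * t powr (- (DIM('a) - s)))"
proof -
  have q: "q - real DIM('a) / 2 = (DIM('a) - s) / 2" by (simp add: q_def field_simps)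
  have "ennreal (Gamma q) * bubble_mass TYPE('a) s t = (\<integral>\<^sup>+(y::'a). ennreal (Gamma q) * ennreal (bubble s t y) \<partial>lborel)"
    unfolding bubble_mass_def by (subst nn_integral_cmult) auto
  also have "\<dots> = (\<integral>\<^sup>+(y::'a). (\<integral>\<^sup>+a. ennreal (a powr (q - 1) * exp (- a * (t\<^sup>2 + (norm y)\<^sup>2))) * indicator {0<..} a \<partial>lborel) \<partial>lborel)"
    by (simp only: bubble_mixture[OF s t, folded q_def])
  also have "\<dots> = (\<integral>\<^sup>+a. (\<integral>\<^sup>+(y::'a). ennreal (a powr (q - 1) * exp (- a * (t\<^sup>2 + (norm y)\<^sup>2))) * indicator {0<..} a \<partial>lborel) \<partial>lborel)"
    by (rule lborel_pair.Fubini') measurable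
  also have "\<dots> = (\<integral>\<^sup>+a. gauss TYPE('a) * (ennreal (a powr ((DIM('a) - s) / 2 - 1) * exp (- a * t\<^sup>2)) * indicator {0<..} a) \<partial>lborel)"
  proof (rule nn_integral_cong)
    fix a :: real
    show "(\<integral>\<^sup>+(y::'a). ennreal (a powr (q - 1) * exp (- a * (t\<^sup>2 + (norm y)\<^sup>2))) * indicator {0<..} a \<partial>lborel)
       = gauss TYPE('a) * (ennreal (a powr ((DIM('a) - s) / 2 - 1) * exp (- a * t\<^sup>2)) * indicator {0<..} a)"
    proof (cases "a > 0")
      case True
      have "(\<integral>\<^sup>+(y::'a). ennreal (a powr (q - 1) * exp (- a * (t\<^sup>2 + (norm y)\<^sup>2))) * indicator {0<..} a \<partial>lborel)
          = (\<integral>\<^sup>+(y::'a). ennreal (a powr (q - 1) * exp (- a * t\<^sup>2)) * ennreal (exp (- a * (norm y)\<^sup>2 - 0 * (norm (y - 0))\<^sup>2)) \<partial>lborel)"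
        using True by (intro nn_integral_cong) (simp add: exp_add[symmetric] algebra_simps flip: ennreal_mult)
      also have "\<dots> = ennreal (a powr (q - 1) * exp (- a * t\<^sup>2)) * (gauss TYPE('a) * ennreal ((a + 0) powr (- real DIM('a) / 2) * exp (- (a * 0 / (a + 0)) * (norm (0::'a))\<^sup>2)))"
        using True by (subst nn_integral_cmult, measurable, subst nn_integral_gaussian) auto
      also have "\<dots> = gauss TYPE('a) * ennreal ((a powr (q - 1) * a powr (- real DIM('a) / 2)) * exp (- a * t\<^sup>2))"
        by (simp add: ennreal_mult mult_ac)
      also have "a powr (q - 1) * a powr (- real DIM('a) / 2) = a powr ((DIM('a) - s) / 2 - 1)"
        unfolding powr_add[symmetric] q[symmetric] by (simp add: algebra_simps)
      finally show ?thesis using True by simp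
    qed simp
  qed
  also have "\<dots> = gauss TYPE('a) * ennreal (Gamma ((DIM('a) - s) / 2) * (t\<^sup>2) powr (- ((DIM('a) - s) / 2)))"
    using s t by (subst nn_integral_cmult, measurable, subst nn_integral_Gamma) auto
  also have "(t\<^sup>2) powr (- ((DIM('a) - s) / 2)) = t powr (- (DIM('a) - s))"
  proof -
    have "t\<^sup>2 = t powr 2" using t by simp
    then have "(t\<^sup>2) powr (- ((DIM('a) - s) / 2)) = t powr (2 * (- ((DIM('a) - s) / 2)))" by (simp only: powr_powr)
    also have "2 * (- ((DIM('a) - s) / 2)) = - (DIM('a) - s)" by (simp add: field_simps)
    finally show ?thesis .
  qed
  finally show ?thesis .
qed



text \<open>The substitution turns a product of two Gaussian mixtures into a single one, with the mixing densities
  of the kernel and of a Gamma distribution.\<close>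

lemma nn_integral_mixture_substitution_le:
  fixes s a n T Z :: real
  assumes a: "a > 0" and T: "T \<ge> 0" and Z: "Z \<ge> 0" and s: "0 < s" "s < n"
  shows "(\<integral>\<^sup>+b. ennreal (a powr (n - s / 2 - 1) * b powr (s / 2 - 1) * exp (- b * T) * (a + b) powr (- n / 2)
           * exp (- (a * b / (a + b)) * Z)) * indicator {0<..} b \<partial>lborel)
    \<le> (\<integral>\<^sup>+v. ennreal (v powr (s / 2 - 1) * (a - v) powr ((n - s) / 2 - 1) * exp (- v * (Z + T))) * indicator {0<..<a} v \<partial>lborel)"
    (is "(\<integral>\<^sup>+b. ennreal (?f b) * _ \<partial>lborel) \<le> (\<integral>\<^sup>+v. ennreal (?h v) * _ \<partial>lborel)")
proof -
  \<comment> \<open>Inverse of v = a b / (a + b), the coefficient of Z in the Gaussian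
    exponent.\<close>
  define g :: "real \<Rightarrow> real" where "g v = a * v / (a - v)" for v
  define g' :: "real \<Rightarrow> real" where "g' v = a\<^sup>2 / (a - v)\<^sup>2" for v
  have img: "g ` {0<..<a} = {0<..}"
  proof (intro equalityI subsetI)
    fix b :: real assume b: "b \<in> {0<..}"
    have "a * b / (a + b) \<in> {0<..<a}" using a b by (auto simp: field_simps intro: add_pos_pos)
    moreover have "b = g (a * b / (a + b))"
    proof -
      have "a - a * b / (a + b) = a\<^sup>2 / (a + b)" using a b by (simp add: field_simps power2_eq_square)
      then show ?thesis unfolding g_def using a b by (simp add: power2_eq_square)
    qed
    ultimately show "b \<in> g ` {0<..<a}" by blast
  qed (use a in \<open>auto simp: g_def\<close>)
  have "(\<integral>\<^sup>+b. ennreal (?f b) * indicator {0<..} b \<partial>lborel)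
      = (\<integral>\<^sup>+v. ennreal (\<bar>g' v\<bar> * ?f (g v)) * indicator {0<..<a} v \<partial>lborel)"
  proof (rule nn_integral_change_of_variables_real[OF _ img])
    show "(g has_real_derivative g' v) (at v)" if "v \<in> {0<..<a}" for v
      unfolding g_def g'_def using that by (auto intro!: derivative_eq_intros simp: power2_eq_square divide_simps) (simp add: algebra_simps)
    show "inj_on g {0<..<a}" using a by (auto simp: inj_on_def g_def field_simps)
    show "(\<lambda>v. \<bar>g' v\<bar> * ?f (g v) * indicat_real {0<..<a} v) \<in> borel_measurable borel"
      unfolding g_def g'_def by measurable
  qed auto
  also have "\<dots> \<le> (\<integral>\<^sup>+v. ennreal (?h v) * indicator {0<..<a} v \<partial>lborel)"
  proof (intro nn_integral_indicator_mono ennreal_leI)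
    fix v assume v: "v \<in> {0<..<a}"
    define w where "w = a - v"
    have w: "w > 0" "v > 0" using v by (auto simp: w_def)
    have gv: "g v = a * v / w" by (simp add: g_def w_def)
    have ag: "a + g v = a\<^sup>2 / w" using w unfolding gv by (simp add: w_def field_simps power2_eq_square)
    have "a * g v / (a + g v) = (a * (a * v / w)) / (a\<^sup>2 / w)" unfolding ag by (simp only: gv)
    then have e1: "a * g v / (a + g v) = v" using w a by (simp add: power2_eq_square)
    \<comment> \<open>The height term carries b = g v instead of v. As b \<ge> v, replacing it by v
      can only enlarge the integrand.\<close>
    have gge: "g v \<ge> v" using w v a unfolding gv by (simp add: w_def field_simps)
    have aa: "a\<^sup>2 = a powr 2" using a by simp
    have ww: "w\<^sup>2 = w powr 2" using w by simp
    have "\<bar>g' v\<bar> * (a powr (n - s / 2 - 1) * g v powr (s / 2 - 1) * (a + g v) powr (- n / 2))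
        = (a\<^sup>2 / w\<^sup>2) * (a powr (n - s / 2 - 1) * (a * v / w) powr (s / 2 - 1) * (a\<^sup>2 / w) powr (- n / 2))"
      unfolding ag by (simp add: gv g'_def w_def)
    also have "\<dots> = v powr (s / 2 - 1) * ((a powr 2 * a powr (n - s / 2 - 1) * a powr (s / 2 - 1) * a powr (2 * (- n / 2)))
         * (w powr (- 2) * w powr (- (s / 2 - 1)) * w powr (- (- n / 2))))"
      unfolding aa ww using a w by (simp add: powr_mult powr_divide powr_powr powr_minus field_simps del: powr_numeral)
    also have "a powr 2 * a powr (n - s / 2 - 1) * a powr (s / 2 - 1) * a powr (2 * (- n / 2)) = 1"
      using a by (simp add: powr_add[symmetric] del: powr_numeral)
    also have "w powr (- 2) * w powr (- (s / 2 - 1)) * w powr (- (- n / 2)) = w powr ((n - s) / 2 - 1)"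
      unfolding powr_add[symmetric] by (simp add: field_simps)
    finally have e2: "\<bar>g' v\<bar> * (a powr (n - s / 2 - 1) * g v powr (s / 2 - 1) * (a + g v) powr (- n / 2))
        = v powr (s / 2 - 1) * w powr ((n - s) / 2 - 1)" by simp
    have "\<bar>g' v\<bar> * ?f (g v) = (v powr (s / 2 - 1) * w powr ((n - s) / 2 - 1)) * (exp (- g v * T) * exp (- v * Z))"
      unfolding e1 e2[symmetric] by (simp add: mult_ac)
    also have "\<dots> \<le> (v powr (s / 2 - 1) * w powr ((n - s) / 2 - 1)) * (exp (- v * T) * exp (- v * Z))"
      using mult_right_mono[OF gge T] by (intro mult_left_mono mult_right_mono) auto
    also have "\<dots> = ?h v" by (simp add: w_def exp_add[symmetric] algebra_simps)
    finally show "\<bar>g' v\<bar> * ?f (g v) \<le> ?h v" .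
  qed
  finally show ?thesis .
qed

text \<open>The shift a = v + c separates the two mixing variables, leaving a product of two Gamma
  integrals.\<close>

lemma nn_integral_mixture_eq:
  fixes s t n Y :: real
  assumes s: "0 < s" "s < n" and t: "t > 0" and Y: "Y \<ge> 0"
  shows "(\<integral>\<^sup>+a. (\<integral>\<^sup>+v. ennreal (exp (- a * t\<^sup>2)) * (ennreal (v powr (s / 2 - 1) * (a - v) powr ((n - s) / 2 - 1) * exp (- v * Y)) * indicator {0<..<a} v) \<partial>lborel) \<partial>lborel)
    = ennreal (Gamma ((n - s) / 2) * (t\<^sup>2) powr (- ((n - s) / 2)) * (Gamma (s / 2) * (t\<^sup>2 + Y) powr (- s / 2)))"
proof -
  have "(\<integral>\<^sup>+a. (\<integral>\<^sup>+v. ennreal (exp (- a * t\<^sup>2)) * (ennreal (v powr (s / 2 - 1) * (a - v) powr ((n - s) / 2 - 1) * exp (- v * Y)) * indicator {0<..<a} v) \<partial>lborel) \<partial>lborel)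
      = (\<integral>\<^sup>+v. (\<integral>\<^sup>+a. ennreal (exp (- a * t\<^sup>2)) * (ennreal (v powr (s / 2 - 1) * (a - v) powr ((n - s) / 2 - 1) * exp (- v * Y)) * indicator {0<..<a} v) \<partial>lborel) \<partial>lborel)"
    (is "_ = (\<integral>\<^sup>+v. ?J v \<partial>lborel)")
    unfolding indicator_def greaterThanLessThan_iff by (rule lborel_pair.Fubini') measurable
  also have "\<dots> = (\<integral>\<^sup>+v. ennreal (Gamma ((n - s) / 2) * (t\<^sup>2) powr (- ((n - s) / 2))) * (ennreal (v powr (s / 2 - 1) * exp (- v * (t\<^sup>2 + Y))) * indicator {0<..} v) \<partial>lborel)"
  proof (rule nn_integral_cong)
    fix v :: real
    show "?J v = ennreal (Gamma ((n - s) / 2) * (t\<^sup>2) powr (- ((n - s) / 2))) * (ennreal (v powr (s / 2 - 1) * exp (- v * (t\<^sup>2 + Y))) * indicator {0<..} v)"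
    proof (cases "v > 0")
      case True
      have "?J v = (\<integral>\<^sup>+c. ennreal (exp (- (v + c) * t\<^sup>2)) * (ennreal (v powr (s / 2 - 1) * (v + c - v) powr ((n - s) / 2 - 1) * exp (- v * Y)) * indicator {0<..<v + c} v) \<partial>lborel)"
        unfolding indicator_def greaterThanLessThan_iff by (rule nn_integral_lborel_translate[symmetric]) measurable
      also have "\<dots> = (\<integral>\<^sup>+c. ennreal (v powr (s / 2 - 1) * exp (- v * (t\<^sup>2 + Y))) * (ennreal (c powr ((n - s) / 2 - 1) * exp (- c * t\<^sup>2)) * indicator {0<..} c) \<partial>lborel)"
      proof (rule nn_integral_cong)
        fix c :: real
        have "exp (- (v + c) * t\<^sup>2) * (v powr (s / 2 - 1) * c powr ((n - s) / 2 - 1) * exp (- v * Y))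
          = v powr (s / 2 - 1) * exp (- v * (t\<^sup>2 + Y)) * (c powr ((n - s) / 2 - 1) * exp (- c * t\<^sup>2))"
        proof -
          have "exp (- (v + c) * t\<^sup>2) * exp (- v * Y) = exp (- v * (t\<^sup>2 + Y)) * exp (- c * t\<^sup>2)"
            by (simp add: exp_add[symmetric] algebra_simps)
          moreover have "E * (p * q * F) = p * G * (q * H)" if "E * F = G * H" for E F G H p q :: real
            using that by algebra
          ultimately show ?thesis by blast
        qed
        then show "ennreal (exp (- (v + c) * t\<^sup>2)) * (ennreal (v powr (s / 2 - 1) * (v + c - v) powr ((n - s) / 2 - 1) * exp (- v * Y)) * indicator {0<..<v + c} v)
           = ennreal (v powr (s / 2 - 1) * exp (- v * (t\<^sup>2 + Y))) * (ennreal (c powr ((n - s) / 2 - 1) * exp (- c * t\<^sup>2)) * indicator {0<..} c)"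
          using True by (cases "c > 0") (simp_all add: ennreal_mult[symmetric] del: mult_minus_left minus_add_distrib)
      qed
      also have "\<dots> = ennreal (v powr (s / 2 - 1) * exp (- v * (t\<^sup>2 + Y))) * ennreal (Gamma ((n - s) / 2) * (t\<^sup>2) powr (- ((n - s) / 2)))"
        using s t by (subst nn_integral_cmult, measurable, subst nn_integral_Gamma) auto
      finally show ?thesis using True by (simp add: mult_ac)
    qed (simp add: indicator_def)
  qed
  also have "\<dots> = ennreal (Gamma ((n - s) / 2) * (t\<^sup>2) powr (- ((n - s) / 2))) * ennreal (Gamma (s / 2) * (t\<^sup>2 + Y) powr (- (s / 2)))"
    using s t Y by (subst nn_integral_cmult, measurable, subst nn_integral_Gamma) (auto intro: add_pos_nonneg)
  finally show ?thesis using s by (subst ennreal_mult) (auto simp: Gamma_real_nonneg)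
qed


text \<open>\<open>T\<close> is the squared height of the evaluation point over the plane of integration; \<open>T = 0\<close> gives equality.\<close>

lemma bubble_potential_le:
  fixes z :: "'a::euclidean_space" and s t T :: real
  assumes s: "0 < s" "s < DIM('a)" and t: "t > 0" and T: "T \<ge> 0"
  shows "(\<integral>\<^sup>+y. ennreal (bubble s t y * ((norm (y - z))\<^sup>2 + T) powr (- s / 2)) \<partial>lborel)
     \<le> bubble_mass TYPE('a) s t * ennreal ((t\<^sup>2 + (norm z)\<^sup>2 + T) powr (- s / 2))"
proof -
  define n where "n = real DIM('a)"
  define Z where "Z = (norm z)\<^sup>2"
  define X where "X y = (norm (y - z))\<^sup>2 + T" for y
  have X: "X y \<ge> 0" for y using T by (simp add: X_def)
  have s': "0 < s" "s < n" using s by (auto simp: n_def)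
  let ?q = "n - s / 2"
  let ?A = "\<lambda>a y. ennreal (a powr (?q - 1) * exp (- a * (t\<^sup>2 + (norm (y::'a))\<^sup>2))) * indicator {0<..} a"
  let ?B = "\<lambda>b y. ennreal (b powr (s / 2 - 1) * exp (- b * X y)) * indicator {0<..} b"
  let ?K = "\<lambda>a b. ennreal (exp (- a * t\<^sup>2)) * ennreal (a powr (n - s / 2 - 1) * b powr (s / 2 - 1) * exp (- b * T) * (a + b) powr (- n / 2)
           * exp (- (a * b / (a + b)) * Z))"
  have Xm[measurable]: "X \<in> borel_measurable borel" unfolding X_def by measurable
  \<comment> \<open>Only an inequality: where X y = 0, the convention 0 powr r = 0 makes the left
    side vanish, while the mixture on the right diverges.\<close>
  have pt: "ennreal (Gamma ?q) * ennreal (Gamma (s / 2)) * ennreal (bubble s t y * X y powr (- s / 2))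
      \<le> (\<integral>\<^sup>+a. (\<integral>\<^sup>+b. ?A a y * ?B b y \<partial>lborel) \<partial>lborel)" for y
  proof (cases "X y = 0")
    case False
    then have "X y > 0" using X[of y] by linarith
    have "(\<integral>\<^sup>+a. (\<integral>\<^sup>+b. ?A a y * ?B b y \<partial>lborel) \<partial>lborel) = (\<integral>\<^sup>+a. ?A a y \<partial>lborel) * (\<integral>\<^sup>+b. ?B b y \<partial>lborel)"
      by (subst nn_integral_cmult, measurable, subst nn_integral_multc, measurable)
    also have "(\<integral>\<^sup>+a. ?A a y \<partial>lborel) = ennreal (Gamma ?q) * ennreal (bubble s t y)"
      using bubble_mixture[OF s t, of y] by (simp add: n_def)
    also have "(\<integral>\<^sup>+b. ?B b y \<partial>lborel) = ennreal (Gamma (s / 2)) * ennreal (X y powr (- s / 2))"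
      using nn_integral_Gamma[of "s / 2" "X y"] s \<open>X y > 0\<close> by (simp add: ennreal_mult Gamma_real_nonneg)
    finally show ?thesis by (simp add: ennreal_mult mult_ac)
  qed simp
  have inner: "(\<integral>\<^sup>+y. ?A a y * ?B b y \<partial>lborel) = gauss TYPE('a) * (?K a b * indicator {0<..} a * indicator {0<..} b)" for a b :: real
  proof (cases "a > 0 \<and> b > 0")
    case True
    have "(\<integral>\<^sup>+y. ?A a y * ?B b y \<partial>lborel) = (\<integral>\<^sup>+y. ennreal (a powr (?q - 1) * exp (- a * t\<^sup>2) * b powr (s / 2 - 1) * exp (- b * T))
        * ennreal (exp (- a * (norm y)\<^sup>2 - b * (norm (y - z))\<^sup>2)) \<partial>lborel)"
    proof (rule nn_integral_cong)
      fix y :: 'a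
      have "exp (- a * (t\<^sup>2 + (norm y)\<^sup>2)) * exp (- b * X y) = exp (- a * t\<^sup>2) * exp (- b * T) * exp (- a * (norm y)\<^sup>2 - b * (norm (y - z))\<^sup>2)"
        unfolding X_def exp_add[symmetric] by (simp add: algebra_simps)
      then have "(a powr (?q - 1) * exp (- a * (t\<^sup>2 + (norm y)\<^sup>2))) * (b powr (s / 2 - 1) * exp (- b * X y))
         = (a powr (?q - 1) * exp (- a * t\<^sup>2) * b powr (s / 2 - 1) * exp (- b * T)) * exp (- a * (norm y)\<^sup>2 - b * (norm (y - z))\<^sup>2)"
        by algebra
      then show "?A a y * ?B b y = ennreal (a powr (?q - 1) * exp (- a * t\<^sup>2) * b powr (s / 2 - 1) * exp (- b * T))
        * ennreal (exp (- a * (norm y)\<^sup>2 - b * (norm (y - z))\<^sup>2))"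
        using True by (simp add: ennreal_mult[symmetric])
    qed
    also have "\<dots> = ennreal (a powr (?q - 1) * exp (- a * t\<^sup>2) * b powr (s / 2 - 1) * exp (- b * T)) *
        (gauss TYPE('a) * ennreal ((a + b) powr (- n / 2) * exp (- (a * b / (a + b)) * Z)))"
      using True by (subst nn_integral_cmult, measurable, subst nn_integral_gaussian) (auto simp: n_def Z_def)
    finally show ?thesis using True by (simp add: ennreal_mult mult_ac)
  qed auto
  have "ennreal (Gamma ?q) * ennreal (Gamma (s / 2)) * (\<integral>\<^sup>+y. ennreal (bubble s t y * X y powr (- s / 2)) \<partial>lborel)
     = (\<integral>\<^sup>+y. ennreal (Gamma ?q) * ennreal (Gamma (s / 2)) * ennreal (bubble s t y * X y powr (- s / 2)) \<partial>lborel)"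
    by (rule nn_integral_cmult[symmetric]) measurable
  also have "\<dots> \<le> (\<integral>\<^sup>+y. (\<integral>\<^sup>+a. (\<integral>\<^sup>+b. ?A a y * ?B b y \<partial>lborel) \<partial>lborel) \<partial>lborel)"
    by (intro nn_integral_mono pt)
  also have "\<dots> = (\<integral>\<^sup>+a. (\<integral>\<^sup>+y. (\<integral>\<^sup>+b. ?A a y * ?B b y \<partial>lborel) \<partial>lborel) \<partial>lborel)"
    by (rule lborel_pair.Fubini') measurable
  also have "\<dots> = (\<integral>\<^sup>+a. (\<integral>\<^sup>+b. (\<integral>\<^sup>+y. ?A a y * ?B b y \<partial>lborel) \<partial>lborel) \<partial>lborel)"
    by (intro nn_integral_cong lborel_pair.Fubini') measurable
  also have "\<dots> = (\<integral>\<^sup>+a. (\<integral>\<^sup>+b. gauss TYPE('a) * (?K a b * indicator {0<..} a * indicator {0<..} b) \<partial>lborel) \<partial>lborel)"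
    by (simp only: inner)
  also have "\<dots> = (\<integral>\<^sup>+a. gauss TYPE('a) * (\<integral>\<^sup>+b. (?K a b * indicator {0<..} a * indicator {0<..} b) \<partial>lborel) \<partial>lborel)"
    by (intro nn_integral_cong nn_integral_cmult) measurable
  also have "\<dots> = gauss TYPE('a) * (\<integral>\<^sup>+a. (\<integral>\<^sup>+b. (?K a b * indicator {0<..} a * indicator {0<..} b) \<partial>lborel) \<partial>lborel)"
    by (rule nn_integral_cmult) measurable
  also have "\<dots> \<le> gauss TYPE('a) * (\<integral>\<^sup>+a. (\<integral>\<^sup>+v. ennreal (exp (- a * t\<^sup>2)) * (ennreal (v powr (s / 2 - 1) * (a - v) powr ((n - s) / 2 - 1) * exp (- v * (Z + T))) * indicator {0<..<a} v) \<partial>lborel) \<partial>lborel)"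
  proof (rule mult_left_mono, rule nn_integral_mono)
    fix a :: real
    show "(\<integral>\<^sup>+b. (?K a b * indicator {0<..} a * indicator {0<..} b) \<partial>lborel)
      \<le> (\<integral>\<^sup>+v. ennreal (exp (- a * t\<^sup>2)) * (ennreal (v powr (s / 2 - 1) * (a - v) powr ((n - s) / 2 - 1) * exp (- v * (Z + T))) * indicator {0<..<a} v) \<partial>lborel)"
    proof (cases "a > 0")
      case True
      then have "(\<integral>\<^sup>+b. (?K a b * indicator {0<..} a * indicator {0<..} b) \<partial>lborel)
         = ennreal (exp (- a * t\<^sup>2)) * (\<integral>\<^sup>+b. ennreal (a powr (n - s / 2 - 1) * b powr (s / 2 - 1) * exp (- b * T) * (a + b) powr (- n / 2)
           * exp (- (a * b / (a + b)) * Z)) * indicator {0<..} b \<partial>lborel)"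
        by (subst nn_integral_cmult[symmetric]) (auto simp: mult_ac)
      also have "\<dots> \<le> ennreal (exp (- a * t\<^sup>2)) * (\<integral>\<^sup>+v. ennreal (v powr (s / 2 - 1) * (a - v) powr ((n - s) / 2 - 1) * exp (- v * (Z + T))) * indicator {0<..<a} v \<partial>lborel)"
        by (intro mult_left_mono nn_integral_mixture_substitution_le True T s') (auto simp: Z_def)
      also have "\<dots> = (\<integral>\<^sup>+v. ennreal (exp (- a * t\<^sup>2)) * (ennreal (v powr (s / 2 - 1) * (a - v) powr ((n - s) / 2 - 1) * exp (- v * (Z + T))) * indicator {0<..<a} v) \<partial>lborel)"
        by (rule nn_integral_cmult[symmetric]) measurable
      finally show ?thesis .
    qed simp
  qed simp
  also have "\<dots> = gauss TYPE('a) * ennreal (Gamma ((n - s) / 2) * (t\<^sup>2) powr (- ((n - s) / 2)) * (Gamma (s / 2) * (t\<^sup>2 + (Z + T)) powr (- s / 2)))"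
    using T by (subst nn_integral_mixture_eq[OF s' t]) (auto simp: Z_def)
  also have "(t\<^sup>2) powr (- ((n - s) / 2)) = t powr (- (n - s))"
  proof -
    have "t\<^sup>2 = t powr 2" using t by simp
    then have "(t\<^sup>2) powr (- ((n - s) / 2)) = t powr (2 * (- ((n - s) / 2)))" by (simp only: powr_powr)
    also have "2 * (- ((n - s) / 2)) = - (n - s)" by (simp add: field_simps)
    finally show ?thesis .
  qed
  also have "gauss TYPE('a) * ennreal (Gamma ((n - s) / 2) * t powr (- (n - s)) * (Gamma (s / 2) * (t\<^sup>2 + (Z + T)) powr (- s / 2)))
     = gauss TYPE('a) * ennreal (Gamma ((n - s) / 2) * t powr (- (n - s))) * ennreal (Gamma (s / 2)) * ennreal ((t\<^sup>2 + (Z + T)) powr (- s / 2))"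
    using s' by (simp add: ennreal_mult Gamma_real_nonneg mult_ac)
  also have "gauss TYPE('a) * ennreal (Gamma ((n - s) / 2) * t powr (- (n - s))) = ennreal (Gamma ?q) * bubble_mass TYPE('a) s t"
    using bubble_mass_eq[OF s t] by (simp add: n_def)
  finally have "ennreal (Gamma ?q) * ennreal (Gamma (s / 2)) * (\<integral>\<^sup>+y. ennreal (bubble s t y * X y powr (- s / 2)) \<partial>lborel)
    \<le> ennreal (Gamma ?q) * ennreal (Gamma (s / 2)) * (bubble_mass TYPE('a) s t * ennreal ((t\<^sup>2 + (Z + T)) powr (- s / 2)))"
    by (simp only: mult_ac)
  moreover have "Gamma ?q > 0" "Gamma (s / 2) > 0" using s' by (auto intro!: Gamma_real_pos)
  then have "ennreal (Gamma ?q) * ennreal (Gamma (s / 2)) \<noteq> 0" "ennreal (Gamma ?q) * ennreal (Gamma (s / 2)) \<noteq> top"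
    by (auto simp: ennreal_mult_eq_top_iff)
  ultimately have "(\<integral>\<^sup>+y. ennreal (bubble s t y * X y powr (- s / 2)) \<partial>lborel)
    \<le> bubble_mass TYPE('a) s t * ennreal ((t\<^sup>2 + (Z + T)) powr (- s / 2))"
    using ennreal_mult_le_mult_iff by blast
  then show ?thesis by (simp only: X_def Z_def add.assoc)
qed

section \<open>Optimal configurations and test measures\<close>

lemma riesz_kernel_measurable [measurable]:
  fixes z :: "'a::euclidean_space"
  shows "(\<lambda>y. riesz_kernel s y z) \<in> borel_measurable borel"
  unfolding riesz_kernel_def by measurable

lemma riesz_kernel_commute: "riesz_kernel s x y = riesz_kernel s y x"
  by (simp add: riesz_kernel_def norm_minus_commute)

text \<open>Isolates the terms that change when \<open>x j\<close> is moved. The energy runs over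
  ordered pairs, so the potential at \<open>x j\<close> occurs twice.\<close>

lemma riesz_energy_insert:
  fixes x :: "nat \<Rightarrow> 'a::real_normed_vector"
  assumes j: "j \<in> {1..N}"
  defines "I \<equiv> {1..N} - {j}"
  shows "riesz_energy s N x = (\<Sum>i\<in>I. riesz_kernel s (x j) (x i)) + (\<Sum>i\<in>I. riesz_kernel s (x j) (x i))
     + (\<Sum>i\<in>I. \<Sum>l\<in>I - {i}. riesz_kernel s (x i) (x l))"
proof -
  let ?k = "riesz_kernel s"
  have "riesz_energy s N x = (\<Sum>l\<in>{1..N} - {j}. ?k (x j) (x l)) + (\<Sum>i\<in>I. \<Sum>l\<in>{1..N} - {i}. ?k (x i) (x l))"
    unfolding riesz_energy_def I_def using j by (simp add: sum.remove)
  also have "(\<Sum>i\<in>I. \<Sum>l\<in>{1..N} - {i}. ?k (x i) (x l)) = (\<Sum>i\<in>I. ?k (x j) (x i) + (\<Sum>l\<in>I - {i}. ?k (x i) (x l)))"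
  proof (rule sum.cong)
    fix i assume i: "i \<in> I"
    have "(\<Sum>l\<in>{1..N} - {i}. ?k (x i) (x l)) = ?k (x i) (x j) + (\<Sum>l\<in>{1..N} - {i} - {j}. ?k (x i) (x l))"
      using i j by (subst sum.remove[of _ j]) (auto simp: I_def)
    also have "{1..N} - {i} - {j} = I - {i}" by (auto simp: I_def)
    finally show "(\<Sum>l\<in>{1..N} - {i}. ?k (x i) (x l)) = ?k (x j) (x i) + (\<Sum>l\<in>I - {i}. ?k (x i) (x l))"
      by (simp add: riesz_kernel_commute)
  qed simp
  finally show ?thesis by (simp add: sum.distrib add.assoc I_def)
qed

text \<open>Any N distinct points of the infinite set form a competitor of finite energy.\<close>

lemma optimal_configuration_energy_finite:
  fixes A :: "'a::real_normed_vector set"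
  assumes "infinite A" and opt: "optimal_configuration s A N x"
  shows "riesz_energy s N x < \<infinity>"
proof -
  obtain B where B: "B \<subseteq> A" "finite B" "card B = N"
    using infinite_arbitrarily_large[OF \<open>infinite A\<close>] by blast
  then obtain y where y: "bij_betw y {1..N} B"
    using finite_same_card_bij[of "{1..N}" B] by auto
  then have "y ` {1..N} \<subseteq> A" using B by (auto simp: bij_betw_def)
  then have "riesz_energy s N x \<le> riesz_energy s N y"
    using opt by (auto simp: optimal_configuration_def)
  also have "riesz_energy s N y < \<infinity>"
  proof -
    have "riesz_kernel s (y i) (y l) < top" if "i \<in> {1..N}" "l \<in> {1..N} - {i}" for i l
    proof -
      have "y i \<noteq> y l" using y that by (auto simp: bij_betw_def dest: inj_onD)
      then show ?thesis by (simp add: riesz_kernel_def)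
    qed
    then show ?thesis unfolding riesz_energy_def by simp
  qed
  finally show ?thesis .
qed

text \<open>Moving only \<open>x j\<close> leaves the interaction \<open>R\<close> of the other
  points unchanged. Finite energy allows \<open>R\<close> to be cancelled in \<open>ennreal\<close>,
  and it also excludes coinciding points, whose kernel is infinite.\<close>

lemma optimal_configuration_minimizes_potential:
  fixes A :: "'a::real_normed_vector set"
  assumes "infinite A" and opt: "optimal_configuration s A N x" and j: "j \<in> {1..N}" and y: "y \<in> A"
  shows "(\<Sum>i\<in>{1..N} - {j}. riesz_kernel s (x j) (x i)) \<le> (\<Sum>i\<in>{1..N} - {j}. riesz_kernel s y (x i))"
    and "\<And>i. i \<in> {1..N} - {j} \<Longrightarrow> x i \<noteq> x j"
proof -
  let ?I = "{1..N} - {j}" and ?k = "riesz_kernel s"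
  define R where "R = (\<Sum>i\<in>?I. \<Sum>l\<in>?I - {i}. ?k (x i) (x l))"
  define F where "F y = (\<Sum>i\<in>?I. ?k y (x i))" for y
  define x' where "x' = x(j := y)"
  have ex: "riesz_energy s N x = F (x j) + F (x j) + R"
    unfolding riesz_energy_insert[OF j] F_def R_def ..
  have ey: "riesz_energy s N x' = F y + F y + R"
    unfolding riesz_energy_insert[OF j] F_def R_def x'_def
    by (intro arg_cong2[where f="(+)"] sum.cong refl) auto
  have fin: "F (x j) + F (x j) + R < \<infinity>"
    using optimal_configuration_energy_finite[OF assms(1) opt] by (simp add: ex)
  have "x' ` {1..N} \<subseteq> A" using opt y by (auto simp: x'_def optimal_configuration_def)
  then have "F (x j) + F (x j) + R \<le> F y + F y + R"
    using opt unfolding ex[symmetric] ey[symmetric] by (auto simp: optimal_configuration_def)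
  then have le: "F (x j) + F (x j) \<le> F y + F y"
    using fin ennreal_add_left_cancel_le[of R "F (x j) + F (x j)" "F y + F y"] by (auto simp: add.commute)
  show "F (x j) \<le> F y"
  proof (rule ccontr)
    assume "\<not> F (x j) \<le> F y"
    then have "F y < F (x j)" by simp
    then have "F y + F y < F (x j) + F (x j)" by (rule add_strict_mono[OF _ \<open>F y < F (x j)\<close>])
    with le show False by simp
  qed
  fix i assume i: "i \<in> ?I"
  have "?k (x j) (x i) \<le> F (x j)" unfolding F_def using i by (intro member_le_sum) auto
  also have "F (x j) < \<infinity>" using fin by simp
  finally have "?k (x j) (x i) \<noteq> \<infinity>" by simp
  then show "x i \<noteq> x j" by (auto simp: riesz_kernel_def)
qed

text \<open>A regularised unit point mass at \<open>p\<close>: the point mass itself has potential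
  |z - p|^(-s), and \<epsilon> bounds both the mass that may be missing and the relative excess of
  the potential. The point z = p is left out because there the real power has the default value
  0.\<close>

definition test_measure :: "real \<Rightarrow> 'a::euclidean_space set \<Rightarrow> 'a \<Rightarrow> real \<Rightarrow> real \<Rightarrow> 'a measure \<Rightarrow> bool" where
  "test_measure s A p t \<epsilon> \<sigma> \<longleftrightarrow> sets \<sigma> = sets borel \<and> (AE y in \<sigma>. y \<in> A) \<and>
     (\<exists>m. emeasure \<sigma> UNIV = ennreal m \<and> 1 - \<epsilon> \<le> m) \<and>
     (\<forall>z\<in>A. z \<noteq> p \<longrightarrow> (\<integral>\<^sup>+y. riesz_kernel s y z \<partial>\<sigma>) \<le> ennreal (norm (z - p) powr (- s) * (1 + \<epsilon>)) \<and>
        (\<integral>\<^sup>+y. riesz_kernel s y z \<partial>\<sigma>) \<le> ennreal (t powr (- s)))"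

lemma optimal_configurations_separatedI:
  fixes A A' :: "'a::euclidean_space set" and s D K :: real
  assumes s: "0 < s" "s < D" and K: "K \<ge> 0" and inf: "infinite A"
    and test: "\<And>p t. p \<in> A \<Longrightarrow> p \<in> A' \<Longrightarrow> 0 < t \<Longrightarrow> t \<le> 1 \<Longrightarrow> \<exists>\<sigma>. test_measure s A p t (K * t powr (D - s)) \<sigma>"
  shows "optimal_configurations_separated s A A' D"
proof -
  define e where "e = D - s"
  have e: "e > 0" using s by (simp add: e_def)
  \<comment> \<open>Gives K t0^e \<le> K / (2 K + 1) \<le> 1/2, so at scale \<open>t0\<close> at
    least half of the mass is present; this yields M = O(N).\<close>
  define t0 where "t0 = (1 / (2 * K + 1)) powr (1 / e)"
  have t0: "0 < t0" "t0 \<le> 1" "K * t0 powr e \<le> 1 / 2"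
    using K e by (auto simp: t0_def powr_powr powr_le1 field_simps)
  define Q where "Q = 4 * K * t0 powr (- s) + 1"
  have Q: "Q > 0" using K by (simp add: Q_def add_nonneg_pos)
  \<comment> \<open>The argument gives the distance Q^(-1/s) N^(-1/D); the factor 1/2 makes the
    inequality strict.\<close>
  define C where "C = Q powr (- 1 / s) / 2"
  have C: "C > 0" using Q by (simp add: C_def)
  have main: "norm (x j - x k) > C * real N powr (- 1 / D)"
    if N: "N \<ge> 2" and opt: "optimal_configuration s A N x" and j: "j \<in> {1..N}" and k: "k \<in> {1..N}"
      and xj: "x j \<in> A'" and kj: "k \<noteq> j" for N x j k
  proof -
    let ?I = "{1..N} - {j}"
    have xA: "x i \<in> A" if "i \<in> {1..N}" for i using opt that by (auto simp: optimal_configuration_def)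
    note mini = optimal_configuration_minimizes_potential[OF inf opt j]
    define r where "r i = norm (x i - x j)" for i
    have ne: "x i \<noteq> x j" if "i \<in> ?I" for i using mini(2)[OF xA[OF j] that] .
    have r: "r i > 0" if "i \<in> ?I" for i using ne[OF that] by (simp add: r_def)
    define M where "M = (\<Sum>i\<in>?I. r i powr (- s))"
    have M0: "M \<ge> 0" unfolding M_def by (intro sum_nonneg) auto
    have M: "(\<Sum>i\<in>?I. riesz_kernel s (x j) (x i)) = ennreal M"
      unfolding M_def sum_ennreal[symmetric, OF powr_ge_zero]
      by (intro sum.cong) (simp_all add: riesz_kernel_def r_def norm_minus_commute ne[symmetric])
    have kI: "k \<in> ?I" using k kj by simp
    \<comment> \<open>Both estimates integrate the potential, which is at least M on
      \<open>A\<close>, against \<open>\<sigma>\<close>. The first caps every point at t^(-s). The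
      second caps only \<open>x k\<close> and charges each other point its potential at
      \<open>x j\<close>, up to the relative error.\<close>
    have est: "M * (1 - K * t powr e) \<le> real N * t powr (- s)"
      "M * (1 - K * t powr e) \<le> (M - r k powr (- s)) * (1 + K * t powr e) + t powr (- s)"
      if t: "0 < t" "t \<le> 1" for t
    proof -
      obtain \<sigma> m where \<sigma>: "sets \<sigma> = sets borel" "AE y in \<sigma>. y \<in> A" "emeasure \<sigma> UNIV = ennreal m" "1 - K * t powr e \<le> m"
        and pot: "\<And>z. z \<in> A \<Longrightarrow> z \<noteq> x j \<Longrightarrow> (\<integral>\<^sup>+y. riesz_kernel s y z \<partial>\<sigma>) \<le> ennreal (norm (z - x j) powr (- s) * (1 + K * t powr e))"
          "\<And>z. z \<in> A \<Longrightarrow> z \<noteq> x j \<Longrightarrow> (\<integral>\<^sup>+y. riesz_kernel s y z \<partial>\<sigma>) \<le> ennreal (t powr (- s))"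
        using test[OF xA[OF j] xj t] unfolding e_def test_measure_def by blast
      have sp: "space \<sigma> = UNIV" using sets_eq_imp_space_eq[OF \<sigma>(1)] by simp
      have meas[measurable]: "(\<lambda>y. riesz_kernel s y z) \<in> borel_measurable \<sigma>" for z
        using measurable_cong_sets[OF \<sigma>(1) refl] riesz_kernel_measurable by blast
      have "ennreal (M * (1 - K * t powr e)) \<le> ennreal M * ennreal m"
        using M0 \<sigma>(4) by (simp add: ennreal_mult'[symmetric] ennreal_leI mult_left_mono)
      also have "\<dots> = (\<integral>\<^sup>+y. ennreal M \<partial>\<sigma>)" using \<sigma>(3) sp by simp
      also have "\<dots> \<le> (\<integral>\<^sup>+y. (\<Sum>i\<in>?I. riesz_kernel s y (x i)) \<partial>\<sigma>)"
        using \<sigma>(2) by (intro nn_integral_mono_AE, eventually_elim) (use mini(1) M in auto)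
      also have "\<dots> = (\<Sum>i\<in>?I. \<integral>\<^sup>+y. riesz_kernel s y (x i) \<partial>\<sigma>)"
        by (rule nn_integral_sum) measurable
      finally have F: "ennreal (M * (1 - K * t powr e)) \<le> (\<Sum>i\<in>?I. \<integral>\<^sup>+y. riesz_kernel s y (x i) \<partial>\<sigma>)" .
      have "(\<Sum>i\<in>?I. \<integral>\<^sup>+y. riesz_kernel s y (x i) \<partial>\<sigma>) \<le> (\<Sum>i\<in>?I. ennreal (t powr (- s)))"
        by (intro sum_mono pot(2)) (use xA ne in auto)
      also have "\<dots> = ennreal (real (card ?I) * t powr (- s))"
        by (simp add: ennreal_mult ennreal_of_nat_eq_real_of_nat)
      also have "\<dots> \<le> ennreal (real N * t powr (- s))"
        using j by (intro ennreal_leI mult_right_mono) auto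
      finally show "M * (1 - K * t powr e) \<le> real N * t powr (- s)"
        using F by (metis (no_types, lifting) ennreal_le_iff mult_nonneg_nonneg of_nat_0_le_iff order_trans powr_ge_zero)
      have "(\<Sum>i\<in>?I. \<integral>\<^sup>+y. riesz_kernel s y (x i) \<partial>\<sigma>)
          = (\<Sum>i\<in>?I - {k}. \<integral>\<^sup>+y. riesz_kernel s y (x i) \<partial>\<sigma>) + (\<integral>\<^sup>+y. riesz_kernel s y (x k) \<partial>\<sigma>)"
        using kI by (subst sum.remove[of _ k]) (auto simp: add.commute)
      also have "\<dots> \<le> (\<Sum>i\<in>?I - {k}. ennreal (r i powr (- s) * (1 + K * t powr e))) + ennreal (t powr (- s))"
        unfolding r_def by (intro add_mono sum_mono pot) (use xA ne kI in auto)
      also have "\<dots> = ennreal ((\<Sum>i\<in>?I - {k}. r i powr (- s) * (1 + K * t powr e)) + t powr (- s))"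
        using K by (subst sum_ennreal) (auto intro!: ennreal_plus[symmetric] sum_nonneg mult_nonneg_nonneg add_nonneg_nonneg)
      finally have "ennreal (M * (1 - K * t powr e)) \<le> ennreal ((\<Sum>i\<in>?I - {k}. r i powr (- s) * (1 + K * t powr e)) + t powr (- s))"
        by (rule order_trans[OF F])
      moreover have "0 \<le> (\<Sum>i\<in>?I - {k}. r i powr (- s) * (1 + K * t powr e)) + t powr (- s)"
        using K by (intro add_nonneg_nonneg sum_nonneg mult_nonneg_nonneg) auto
      ultimately have "M * (1 - K * t powr e) \<le> (\<Sum>i\<in>?I - {k}. r i powr (- s) * (1 + K * t powr e)) + t powr (- s)"
        using ennreal_le_iff by blast
      also have "(\<Sum>i\<in>?I - {k}. r i powr (- s) * (1 + K * t powr e)) = (M - r k powr (- s)) * (1 + K * t powr e)"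
        unfolding M_def sum_distrib_right[symmetric] using kI by (subst (2) sum.remove[of _ k]) auto
      finally show "M * (1 - K * t powr e) \<le> (M - r k powr (- s)) * (1 + K * t powr e) + t powr (- s)" .
    qed
    have "M * (1 / 2) \<le> M * (1 - K * t0 powr e)" using t0 M0 by (intro mult_left_mono) auto
    also have "\<dots> \<le> real N * t0 powr (- s)" by (rule est(1)[OF t0(1,2)])
    finally have Mb: "M \<le> 2 * (real N * t0 powr (- s))" by simp
    define t where "t = real N powr (- 1 / D)"
    have t: "0 < t" "t \<le> 1" using N s powr_mono[of "- 1 / D" 0 "real N"] by (auto simp: t_def)
    \<comment> \<open>This choice of \<open>t\<close> makes the accumulated error t^e N equal to the
      cap t^(-s).\<close>
    have tN: "t powr e * real N = t powr (- s)"
    proof -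
      have "real N = real N powr 1" using N by simp
      also have "1 = (- 1 / D) * (- D)" using s by simp
      also have "real N powr \<dots> = t powr (- D)" unfolding t_def by (simp only: powr_powr)
      finally show ?thesis by (simp add: powr_add[symmetric] e_def)
    qed
    \<comment> \<open>The main terms M cancel. The relative error survives twice, once from the
      missing mass and once from the excess of the potential.\<close>
    have "r k powr (- s) \<le> 2 * K * t powr e * M + t powr (- s) - r k powr (- s) * (K * t powr e)"
      using est(2)[OF t] by (simp add: algebra_simps)
    also have "\<dots> \<le> 2 * K * t powr e * M + t powr (- s)" using K by simp
    also have "\<dots> \<le> 2 * K * t powr e * (2 * (real N * t0 powr (- s))) + t powr (- s)"
      using K Mb by (intro add_mono mult_left_mono) auto
    also have "\<dots> = 4 * K * t0 powr (- s) * (t powr e * real N) + t powr (- s)" by simp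
    also have "\<dots> = Q * t powr (- s)" unfolding tN Q_def by (simp add: algebra_simps)
    also have "Q = (Q powr (- 1 / s)) powr (- s)" using s Q by (simp add: powr_powr)
    also have "(Q powr (- 1 / s)) powr (- s) * t powr (- s) = (Q powr (- 1 / s) * t) powr (- s)"
      using t Q by (simp add: powr_mult)
    finally have "r k powr (- s) \<le> (Q powr (- 1 / s) * t) powr (- s)" .
    then have "Q powr (- 1 / s) * t \<le> r k"
      using powr_less_mono2_neg[of "- s" "r k" "Q powr (- 1 / s) * t"] s r[OF kI] by (meson neg_less_0_iff_less not_less)
    moreover have "C * t < Q powr (- 1 / s) * t" using t Q by (simp add: C_def)
    ultimately show ?thesis by (simp add: r_def t_def norm_minus_commute)
  qed
  show ?thesis unfolding optimal_configurations_separated_def using C main by blast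
qed

text \<open>The power of \<open>t\<close> comes from scaling. At t = 1 the integral is finite, since
  the density is at most 1 and decays like |y|^(-(2 d - s)) with 2 d - s > d, and it is positive
  since the density is.\<close>

lemma bubble_mass_value:
  fixes s :: real
  assumes s: "0 < s" "s < DIM('a::euclidean_space)"
  obtains m where "m > 0" "\<And>t. t > 0 \<Longrightarrow> bubble_mass TYPE('a) s t = ennreal (m * t powr (- (DIM('a) - s)))"
proof -
  let ?d = "real DIM('a)"
  let ?M = "bubble_mass TYPE('a) s 1"
  have pos: "bubble s 1 (y::'a) > 0" for y
    using power2_eq_square by (simp add: bubble_def add_pos_nonneg less_imp_neq[symmetric])
  have le1: "bubble s 1 (y::'a) \<le> 1" for y
    using s powr_mono2'[of "- (?d - s / 2)" 1 "1 + (norm y)\<^sup>2"] by (simp add: bubble_def)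
  have le2: "bubble s 1 (y::'a) \<le> norm y powr (- (2 * ?d - s))" if "norm y \<ge> 1" for y
  proof -
    have "(1 + (norm y)\<^sup>2) powr (- (?d - s / 2)) \<le> ((norm y)\<^sup>2) powr (- (?d - s / 2))"
      using that s by (intro powr_mono2') auto
    also have "(norm y)\<^sup>2 = norm y powr 2" using that by simp
    also have "(norm y powr 2) powr (- (?d - s / 2)) = norm y powr (- (2 * ?d - s))"
      unfolding powr_powr by (simp add: algebra_simps)
    finally show ?thesis by (simp add: bubble_def)
  qed
  have "?M \<le> (\<integral>\<^sup>+(y::'a). indicator (ball 0 1) y + ennreal (norm y powr (- (2 * ?d - s))) * indicator {y. norm y \<ge> 1} y \<partial>lborel)"
    unfolding bubble_mass_def using le1 le2
    by (intro nn_integral_mono) (auto simp: indicator_def intro: ennreal_leI)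
  also have "\<dots> = emeasure lborel (ball 0 1 :: 'a set) + (\<integral>\<^sup>+(y::'a). ennreal (norm y powr (- (2 * ?d - s))) * indicator {y. norm y \<ge> 1} y \<partial>lborel)"
    by (subst nn_integral_add) (auto intro!: borel_measurable_indicator)
  also have "\<dots> < \<infinity>"
    using nn_integral_norm_powr_near_infinity[where 'a='a, of "2 * ?d - s"] s emeasure_lborel_ball_finite[of "0::'a" 1] by simp
  finally have fin: "?M < \<infinity>" .
  have "?M \<noteq> 0"
  proof
    assume "?M = 0"
    then have "AE y in lborel. ennreal (bubble s 1 (y::'a)) = 0"
      unfolding bubble_mass_def by (subst (asm) nn_integral_0_iff_AE) auto
    then have "AE y in (lborel :: 'a measure). False" by eventually_elim (metis ennreal_eq_0_iff not_le pos)
    then show False by (simp add: AE_iff_measurable[of UNIV])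
  qed
  define m where "m = enn2real ?M"
  have m: "m > 0" "?M = ennreal m"
    using fin \<open>?M \<noteq> 0\<close> by (auto simp: m_def enn2real_positive_iff zero_less_iff_neq_zero)
  have "bubble_mass TYPE('a) s t = ennreal (m * t powr (- (?d - s)))" if t: "t > 0" for t
  proof -
    have sc: "bubble s t (0 + t *\<^sub>R y) = t powr (- (2 * ?d - s)) * bubble s 1 (y::'a)" for y
    proof -
      have "t\<^sup>2 + (norm (t *\<^sub>R y))\<^sup>2 = t powr 2 * (1 + (norm y)\<^sup>2)" using t by (simp add: power_mult_distrib algebra_simps)
      moreover have "(t powr 2) powr (- (?d - s / 2)) = t powr (- (2 * ?d - s))"
        unfolding powr_powr by (simp add: algebra_simps)
      ultimately show ?thesis by (simp only: bubble_def add_0 powr_mult powr_ge_zero one_power2)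
    qed
    have "bubble_mass TYPE('a) s t = ennreal (t ^ DIM('a)) * (\<integral>\<^sup>+(y::'a). ennreal (bubble s t (0 + t *\<^sub>R y)) \<partial>lborel)"
      unfolding bubble_mass_def using t by (intro nn_integral_lborel_scale) auto
    also have "\<dots> = ennreal (t ^ DIM('a)) * (ennreal (t powr (- (2 * ?d - s))) * ?M)"
      unfolding sc bubble_mass_def by (subst nn_integral_cmult[symmetric]) (auto simp: ennreal_mult)
    also have "\<dots> = ennreal (t powr ?d * t powr (- (2 * ?d - s)) * m)"
      using t m by (simp add: powr_realpow ennreal_mult mult.assoc)
    also have "t powr ?d * t powr (- (2 * ?d - s)) = t powr (- (?d - s))"
      by (simp add: powr_add[symmetric])
    finally show ?thesis by (simp add: mult.commute)
  qed
  with m show ?thesis using that by blast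
qed

section \<open>Elementary bounds for powers and for the kernel at a small height\<close>

lemma powr_one_plus_ge:
  assumes "x \<ge> 0" "p \<ge> (0::real)"
  shows "(1 + x) powr (- p) \<ge> 1 - p * x"
proof -
  have "1 - p * x \<le> exp (- p * x)" using exp_ge_add_one_self[of "- p * x"] by simp
  also have "\<dots> \<le> exp (- p * ln (1 + x))"
    using assms ln_add_one_self_le_self[of x] by (simp add: mult_left_mono)
  finally show ?thesis using assms by (simp add: powr_def)
qed

text \<open>Combines - ln (1 - x) \<le> 2 x on [0, 1/2] with exp u \<le> 1 + u exp u at u = 2 p x
  \<le> p.\<close>

lemma powr_one_minus_le:
  assumes "0 \<le> x" "x \<le> 1 / 2" "p \<ge> (0::real)"
  shows "(1 - x) powr (- p) \<le> 1 + 2 * p * exp p * x"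
proof -
  have "- x - 2 * x\<^sup>2 \<le> ln (1 - x)" using assms by (intro ln_one_minus_pos_lower_bound) auto
  moreover have "2 * x\<^sup>2 \<le> x" using assms mult_left_mono[of x "1/2" x] by (simp add: power2_eq_square)
  ultimately have "- p * ln (1 - x) \<le> p * (2 * x)"
    using assms mult_left_mono[of "- ln (1 - x)" "2 * x" p] by simp
  then have "(1 - x) powr (- p) \<le> exp (p * (2 * x))" using assms by (simp add: powr_def)
  also have "\<dots> \<le> 1 + (p * (2 * x)) * exp (p * (2 * x))"
  proof -
    let ?u = "p * (2 * x)"
    have "(1 - ?u) * exp ?u \<le> exp (- ?u) * exp ?u"
      using exp_ge_add_one_self[of "- ?u"] by (intro mult_right_mono) auto
    then show ?thesis by (simp add: exp_minus algebra_simps)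
  qed
  also have "\<dots> \<le> 1 + (p * (2 * x)) * exp p"
    using assms by (intro add_left_mono mult_left_mono) (auto intro: mult_left_le)
  finally show ?thesis by (simp add: mult_ac)
qed

text \<open>The defect between the kernel on the plane and at height sqrt T is at most |w|^(-s) and,
  by expansion, at most a multiple of T |w|^(-s-2). Using the first for |w| < sqrt T and the second
  beyond, both parts scale like T^((d - s)/2). The second converges at infinity since d - s <
  2.\<close>

lemma nn_integral_kernel_defect_le:
  fixes s :: real
  assumes s: "0 < s" "s < DIM('a::euclidean_space)" "DIM('a) - s < 2"
  obtains K where "K \<ge> 0" "\<And>T. T \<ge> 0 \<Longrightarrow>
    (\<integral>\<^sup>+(w::'a). ennreal (norm w powr (- s) - ((norm w)\<^sup>2 + T) powr (- s / 2)) \<partial>lborel) \<le> ennreal (K * T powr ((DIM('a) - s) / 2))"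
proof -
  let ?d = "real DIM('a)"
  let ?I1 = "\<integral>\<^sup>+(y::'a). ennreal (norm y powr (- s)) * indicator {y. norm y < 1} y \<partial>lborel"
  let ?I2 = "\<integral>\<^sup>+(y::'a). ennreal (norm y powr (- (s + 2))) * indicator {y. norm y \<ge> 1} y \<partial>lborel"
  have "?I1 < \<infinity>" by (rule nn_integral_norm_powr_near_0) (use s in auto)
  then obtain k1 where k1: "k1 \<ge> 0" "?I1 = ennreal k1" by (cases ?I1) auto
  have "?I2 < \<infinity>" by (rule nn_integral_norm_powr_near_infinity) (use s in auto)
  then obtain k2 where k2: "k2 \<ge> 0" "?I2 = ennreal k2" by (cases ?I2) auto
  define K where "K = k1 + s / 2 * k2"
  have "(\<integral>\<^sup>+(w::'a). ennreal (norm w powr (- s) - ((norm w)\<^sup>2 + T) powr (- s / 2)) \<partial>lborel) \<le> ennreal (K * T powr ((?d - s) / 2))"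
    if "T \<ge> 0" for T
  proof (cases "T = 0")
    case True
    have "norm w powr (- s) - ((norm w)\<^sup>2 + T) powr (- s / 2) \<le> 0" for w :: 'a
    proof (cases "w = 0")
      case False
      then have "(norm w)\<^sup>2 = norm w powr 2" by simp
      then have "((norm w)\<^sup>2) powr (- s / 2) = norm w powr (2 * (- s / 2))" by (simp only: powr_powr)
      then show ?thesis by (simp add: True)
    qed (simp add: True)
    then show ?thesis by (simp add: ennreal_neg)
  next
    case False
    define c where "c = sqrt T"
    have c: "c > 0" "T = c\<^sup>2" using that False by (auto simp: c_def)
    have pt: "norm w powr (- s) - ((norm w)\<^sup>2 + T) powr (- s / 2) \<le> s / 2 * T * norm w powr (- (s + 2))" if "w \<noteq> 0" for w :: 'a
    proof -
      let ?n = "norm w"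
      have n: "?n > 0" "?n\<^sup>2 = ?n powr 2" using that by auto
      have "?n\<^sup>2 + T = ?n powr 2 * (1 + T / ?n\<^sup>2)" using n by (simp add: field_simps)
      then have "(?n\<^sup>2 + T) powr (- s / 2) = (?n powr 2) powr (- s / 2) * (1 + T / ?n\<^sup>2) powr (- s / 2)"
        using c by (simp only: powr_mult)
      also have "(?n powr 2) powr (- s / 2) = ?n powr (- s)" unfolding powr_powr by simp
      finally have "(?n\<^sup>2 + T) powr (- s / 2) \<ge> ?n powr (- s) * (1 - s / 2 * (T / ?n\<^sup>2))"
        using powr_one_plus_ge[of "T / ?n\<^sup>2" "s / 2"] s c by (simp add: mult_left_mono)
      moreover have "?n powr (- (s + 2)) = ?n powr (- s) / ?n\<^sup>2"
        using n(1) by (simp add: powr_diff)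
      ultimately show ?thesis by (simp add: algebra_simps)
    qed
    have "(\<integral>\<^sup>+(w::'a). ennreal (norm w powr (- s) - ((norm w)\<^sup>2 + T) powr (- s / 2)) \<partial>lborel)
       \<le> (\<integral>\<^sup>+(w::'a). ennreal (norm w powr (- s)) * indicator {w. norm w / c < 1} w
           + ennreal (s / 2 * T) * (ennreal (norm w powr (- (s + 2))) * indicator {w. norm w / c \<ge> 1} w) \<partial>lborel)"
    proof (intro nn_integral_mono)
      fix w :: 'a
      show "ennreal (norm w powr (- s) - ((norm w)\<^sup>2 + T) powr (- s / 2)) \<le>
         ennreal (norm w powr (- s)) * indicator {w. norm w / c < 1} w
           + ennreal (s / 2 * T) * (ennreal (norm w powr (- (s + 2))) * indicator {w. norm w / c \<ge> 1} w)"
      proof (cases "norm w / c < 1")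
        case False
        then have "w \<noteq> 0" by auto
        then show ?thesis using False pt[of w] s c by (simp add: ennreal_mult[symmetric] ennreal_leI)
      qed (auto intro: ennreal_leI)
    qed
    also have "\<dots> = (\<integral>\<^sup>+(w::'a). ennreal (norm w powr (- s)) * indicator {w. norm w / c < 1} w \<partial>lborel)
           + ennreal (s / 2 * T) * (\<integral>\<^sup>+(w::'a). ennreal (norm w powr (- (s + 2))) * indicator {w. norm w / c \<ge> 1} w \<partial>lborel)"
      by (subst nn_integral_add; (subst nn_integral_cmult)?) auto
    also have "\<dots> = ennreal (c powr (?d - s)) * ?I1 + ennreal (s / 2 * T) * (ennreal (c powr (?d - (s + 2))) * ?I2)"
      by (subst (1 2) nn_integral_norm_powr_scale[OF c(1)]) auto
    also have "\<dots> = ennreal (c powr (?d - s) * k1 + s / 2 * (T * c powr (?d - (s + 2))) * k2)"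
      unfolding k1 k2 using s k1(1) k2(1) that by (simp add: ennreal_mult[symmetric] ennreal_plus[symmetric] mult_ac del: ennreal_plus)
    also have "T * c powr (?d - (s + 2)) = c powr (?d - s)"
    proof -
      have "T = c powr 2" using c by simp
      then show ?thesis by (simp add: powr_add[symmetric] del: powr_numeral)
    qed
    also have "c powr (?d - s) = T powr ((?d - s) / 2)"
      unfolding c_def using that False by (simp add: powr_half_sqrt[symmetric] powr_powr)
    finally show ?thesis by (simp add: K_def algebra_simps)
  qed
  moreover have "K \<ge> 0" using k1 k2 s by (simp add: K_def)
  ultimately show ?thesis using that by blast
qed


section \<open>Test measures on graphs\<close>

text \<open>\<open>A\<close> contains a graph over a disc of the tangent plane p + range L; it need
  not coincide with that graph near \<open>p\<close>. The last clause concerns all of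
  \<open>A\<close>, because the potential is estimated at every point of \<open>A\<close>: the
  normal part \<open>\<eta>\<close> of z - p is quadratically small. An open piece of the ambient
  space is the case h = 0 and C = 0.\<close>

definition local_graph ::
    "('b::euclidean_space \<Rightarrow> 'a::euclidean_space) \<Rightarrow> ('b \<Rightarrow> 'a) \<Rightarrow> real \<Rightarrow> real \<Rightarrow> 'a set \<Rightarrow> 'a \<Rightarrow> bool" where
  "local_graph L h \<delta> C A p \<longleftrightarrow> linear L \<and> (\<forall>y. norm (L y) = norm y) \<and> continuous_on (ball 0 \<delta>) h \<and>
     (\<forall>y\<in>ball 0 \<delta>. p + L y + h y \<in> A \<and> norm (h y) \<le> C * (norm y)\<^sup>2 \<and> (\<forall>v. h y \<bullet> L v = 0)) \<and>
     (\<forall>z\<in>A. \<exists>\<zeta> \<eta>. z = p + L \<zeta> + \<eta> \<and> (\<forall>v. \<eta> \<bullet> L v = 0) \<and> norm \<eta> \<le> C * (norm (z - p))\<^sup>2)"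

context
  fixes L :: "'b::euclidean_space \<Rightarrow> 'a::euclidean_space" and p z \<eta> h :: 'a and \<zeta> y :: 'b and C \<delta> s t R T :: real
  assumes L: "linear L" "\<And>y. norm (L y) = norm y"
    and orth: "\<And>v. h \<bullet> L v = 0" "\<And>v. \<eta> \<bullet> L v = 0"
    and z: "z = p + L \<zeta> + \<eta>" and R: "R = norm (z - p)" "R > 0" and T: "T = (norm \<eta>)\<^sup>2"
    and h: "norm h \<le> C * (norm y)\<^sup>2" and \<eta>: "norm \<eta> \<le> C * R\<^sup>2"
begin

lemma graph_norm_sq: "(norm (p + L y + h - z))\<^sup>2 = (norm (y - \<zeta>))\<^sup>2 + (norm (h - \<eta>))\<^sup>2"
proof -
  have "p + L y + h - z = L (y - \<zeta>) + (h - \<eta>)" using L by (simp add: z linear_diff)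
  moreover have "L (y - \<zeta>) \<bullet> (h - \<eta>) = 0"
    using orth[of "y - \<zeta>"] by (simp add: inner_diff_right inner_commute[of "L (y - \<zeta>)"])
  ultimately show ?thesis using norm_add_Pythagorean[unfolded orthogonal_def] L(2) by metis
qed

lemma graph_dist_sq: "R\<^sup>2 = (norm \<zeta>)\<^sup>2 + T"
proof -
  have "z - p = L \<zeta> + \<eta>" by (simp add: z)
  then show ?thesis using L orth by (simp add: R T norm_add_Pythagorean[unfolded orthogonal_def] inner_commute)
qed

lemma graph_tangent_dist_sq: "(norm (y - \<zeta>))\<^sup>2 + T = (norm (L y - (z - p)))\<^sup>2"
proof -
  have "L y - (z - p) = L (y - \<zeta>) + - \<eta>" using L by (simp add: z linear_diff)
  then show ?thesis using L orth by (simp add: T norm_add_Pythagorean[unfolded orthogonal_def] inner_commute del: add_uminus_conv_diff)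
qed

lemma graph_norm_ge: "norm (y - \<zeta>) \<le> norm (p + L y + h - z)"
  using graph_norm_sq by (metis le_add_same_cancel1 norm_ge_zero power2_le_imp_le zero_le_power2)

text \<open>Let X be the squared distance from \<open>z\<close> to the tangent point under the graph
  point. Passing to the graph lowers it by at most the cross term 2 |h| |\<eta>| \<le> 2 C^2 |y|^2
  R^2. As |y| \<le> R / 2 forces X \<ge> R^2 / 4, the relative error is at most 8 C^2 |y|^2.\<close>

lemma graph_kernel_near:
  assumes C: "C \<ge> 0" "4 * C * \<delta> \<le> 1" and y: "norm y < \<delta>" "y \<noteq> 0" "y \<noteq> \<zeta>" "norm y \<le> R / 2" and s: "s > 0"
  shows "norm (p + L y + h - z) powr (- s)
    \<le> ((norm (y - \<zeta>))\<^sup>2 + T) powr (- s / 2) + 8 * C\<^sup>2 * s * exp (s / 2) * (R / 2) powr (- s) * (norm y)\<^sup>2"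
proof -
  define X where "X = (norm (y - \<zeta>))\<^sup>2 + T"
  define \<xi> where "\<xi> = 2 * C\<^sup>2 * (norm y)\<^sup>2 * R\<^sup>2"
  have "R / 2 \<le> norm (z - p) - norm (L y)" using y by (simp add: L R(1)[symmetric])
  also have "\<dots> \<le> norm (L y - (z - p))" by (metis norm_minus_commute norm_triangle_ineq2)
  finally have X: "(R / 2)\<^sup>2 \<le> X" unfolding X_def graph_tangent_dist_sq using R by (intro power_mono) auto
  have X0: "X > 0" using X R by (smt (verit) zero_less_power half_gt_zero)
  have "\<xi> = X * (8 * C\<^sup>2 * (norm y)\<^sup>2) - (8 * C\<^sup>2 * (norm y)\<^sup>2) * (X - (R / 2)\<^sup>2)"
    by (simp add: \<xi>_def power2_eq_square algebra_simps)
  also have "\<dots> \<le> X * (8 * C\<^sup>2 * (norm y)\<^sup>2)" using X by simp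
  finally have \<xi>: "\<xi> / X \<le> 8 * C\<^sup>2 * (norm y)\<^sup>2" using X0 by (simp add: field_simps)
  \<comment> \<open>The condition on C \<delta> keeps the relative error within [0, 1/2], the range
    of \<open>powr_one_minus_le\<close>.\<close>
  have "(4 * C * norm y)\<^sup>2 \<le> 1"
  proof -
    have "4 * C * norm y \<le> 4 * C * \<delta>" using C y by (intro mult_left_mono) auto
    then show ?thesis using C by (intro power_le_one) auto
  qed
  then have "16 * (C\<^sup>2 * (norm y)\<^sup>2) \<le> 1" by (simp add: power_mult_distrib)
  then have \<xi>2: "\<xi> / X \<le> 1 / 2" using \<xi> by linarith
  have \<xi>0: "\<xi> / X \<ge> 0" using X0 by (simp add: \<xi>_def)
  have "norm h * norm \<eta> \<le> (C * (norm y)\<^sup>2) * (C * R\<^sup>2)"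
    using h \<eta> C by (intro mult_mono) auto
  then have "2 * (norm h * norm \<eta>) \<le> \<xi>" by (simp add: \<xi>_def power2_eq_square mult_ac)
  moreover have "(norm (h - \<eta>))\<^sup>2 \<ge> T - 2 * (norm h * norm \<eta>)"
  proof -
    have "(norm (h - \<eta>))\<^sup>2 = h \<bullet> h - 2 * (h \<bullet> \<eta>) + T"
      unfolding T by (simp add: power2_norm_eq_inner inner_diff inner_commute)
    then show ?thesis using norm_cauchy_schwarz[of h \<eta>] inner_ge_zero[of h] by linarith
  qed
  ultimately have "X - \<xi> \<le> (norm (p + L y + h - z))\<^sup>2" unfolding graph_norm_sq X_def by linarith
  moreover have "X * (1 - \<xi> / X) = X - \<xi>" using X0 by (simp add: right_diff_distrib)
  ultimately have "X * (1 - \<xi> / X) \<le> (norm (p + L y + h - z))\<^sup>2" by simp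
  then have "((norm (p + L y + h - z))\<^sup>2) powr (- s / 2) \<le> (X * (1 - \<xi> / X)) powr (- s / 2)"
    using X0 \<xi>2 s by (intro powr_mono2') auto
  also have "\<dots> = X powr (- s / 2) * (1 - \<xi> / X) powr (- (s / 2))"
    using X0 \<xi>2 by (simp add: powr_mult)
  also have "\<dots> \<le> X powr (- s / 2) * (1 + 2 * (s / 2) * exp (s / 2) * (\<xi> / X))"
    using s by (intro mult_left_mono powr_one_minus_le \<xi>2 \<xi>0) auto
  also have "\<dots> \<le> X powr (- s / 2) * (1 + 2 * (s / 2) * exp (s / 2) * (8 * C\<^sup>2 * (norm y)\<^sup>2))"
    using s by (intro mult_left_mono add_left_mono \<xi>) auto
  also have "\<dots> = X powr (- s / 2) + X powr (- s / 2) * (8 * C\<^sup>2 * s * exp (s / 2) * (norm y)\<^sup>2)"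
    by (simp add: algebra_simps)
  also have "\<dots> \<le> X powr (- s / 2) + ((R / 2)\<^sup>2) powr (- s / 2) * (8 * C\<^sup>2 * s * exp (s / 2) * (norm y)\<^sup>2)"
    using X R s by (intro add_left_mono mult_right_mono powr_mono2') auto
  also have "((R / 2)\<^sup>2) powr (- s / 2) = (R / 2) powr (- s)"
  proof -
    have "(R / 2)\<^sup>2 = (R / 2) powr 2" using R by simp
    then have "((R / 2)\<^sup>2) powr (- s / 2) = (R / 2) powr (2 * (- s / 2))" by (simp only: powr_powr)
    then show ?thesis by simp
  qed
  also have "((norm (p + L y + h - z))\<^sup>2) powr (- s / 2) = norm (p + L y + h - z) powr (- s)"
  proof -
    have "norm (p + L y + h - z) > 0" using graph_norm_ge y by (smt (verit) right_minus_eq zero_less_norm_iff)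
    then have "(norm (p + L y + h - z))\<^sup>2 = norm (p + L y + h - z) powr 2" by simp
    then have "((norm (p + L y + h - z))\<^sup>2) powr (- s / 2) = norm (p + L y + h - z) powr (2 * (- s / 2))" by (simp only: powr_powr)
    then show ?thesis by simp
  qed
  finally show ?thesis by (simp add: X_def mult_ac)
qed

end

lemma bubble_le_norm_powr:
  fixes y :: "'b::euclidean_space" and s :: real
  assumes "y \<noteq> 0" "s < 2 * DIM('b)"
  shows "bubble s t y \<le> norm y powr (- (2 * DIM('b) - s))"
proof -
  have "(t\<^sup>2 + (norm y)\<^sup>2) powr (- (DIM('b) - s / 2)) \<le> ((norm y)\<^sup>2) powr (- (DIM('b) - s / 2))"
    using assms by (intro powr_mono2') auto
  also have "(norm y)\<^sup>2 = norm y powr 2" using assms by simp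
  also have "(norm y powr 2) powr (- (DIM('b) - s / 2)) = norm y powr (- (2 * DIM('b) - s))"
    unfolding powr_powr by (simp add: algebra_simps)
  finally show ?thesis by (simp add: bubble_def)
qed

text \<open>Scaled to total mass 1, the bubble carries a factor of order t^\<alpha>, so every error
  in the potential only has to be O(R^(-s)) for R = |z - p|, uniformly in \<open>t\<close>. The main
  term has no error: the flat bubble has potential at most (t^2 + R^2)^(-s/2) at \<open>z\<close>,
  whose height over the tangent plane is sqrt T. The errors come from lifting the plane to the
  graph. For |y| \<le> R / 2 this changes the kernel by O(R^(-s) |y|^2). For |y| > R / 2 the height
  is simply discarded, and the kernel defect is integrated against a bubble of size at most (R /
  2)^(-q).\<close>

lemma graph_test_measure:
  fixes s \<delta> C :: real
  assumes s: "0 < s" "s < DIM('b::euclidean_space)" "DIM('b) - s < 2"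
    and \<delta>: "0 < \<delta>" "\<delta> \<le> 1" and C: "C \<ge> 0" "4 * C * \<delta> \<le> 1"
  obtains K where "K \<ge> 0"
    "\<And>(A :: 'a::euclidean_space set) p L (h :: 'b \<Rightarrow> 'a) t. closed A \<Longrightarrow> local_graph L h \<delta> C A p \<Longrightarrow> 0 < t \<Longrightarrow> t \<le> 1 \<Longrightarrow>
      \<exists>\<sigma>. test_measure s A p t (K * t powr (DIM('b) - s)) \<sigma>"
proof -
  let ?d = "real DIM('b)"
  define \<alpha> where "\<alpha> = ?d - s"
  define q where "q = 2 * ?d - s"
  \<comment> \<open>The bubble is at most |y|^(-q). The curvature error brings a factor |y|^2, and
    |y|^(-q') is integrable near 0 because d - s < 2.\<close>
  define q' where "q' = q - 2"
  have \<alpha>: "0 < \<alpha>" "\<alpha> < 2" using s by (auto simp: \<alpha>_def)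
  obtain m0 where m0: "m0 > 0" and bm: "\<And>t. t > 0 \<Longrightarrow> bubble_mass TYPE('b) s t = ennreal (m0 * t powr (- \<alpha>))"
    by (rule bubble_mass_value[OF s(1,2), folded \<alpha>_def]) (rule that)
  obtain kE where kE: "kE \<ge> 0" "\<And>T. T \<ge> 0 \<Longrightarrow>
    (\<integral>\<^sup>+(w::'b). ennreal (norm w powr (- s) - ((norm w)\<^sup>2 + T) powr (- s / 2)) \<partial>lborel) \<le> ennreal (kE * T powr (\<alpha> / 2))"
    by (rule nn_integral_kernel_defect_le[OF s, folded \<alpha>_def]) (rule that)
  let ?I1 = "\<integral>\<^sup>+(y::'b). ennreal (norm y powr (- q')) * indicator {y. norm y < 1} y \<partial>lborel"
  let ?I2 = "\<integral>\<^sup>+(y::'b). ennreal (norm y powr (- q)) * indicator {y. norm y \<ge> 1} y \<partial>lborel"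
  have "?I1 < \<infinity>" by (rule nn_integral_norm_powr_near_0) (use s in \<open>auto simp: q'_def q_def\<close>)
  then obtain k1 where k1: "k1 \<ge> 0" "?I1 = ennreal k1" by (cases ?I1) auto
  have "?I2 < \<infinity>" by (rule nn_integral_norm_powr_near_infinity) (use s in \<open>auto simp: q_def\<close>)
  then obtain k2 where k2: "k2 \<ge> 0" "?I2 = ennreal k2" by (cases ?I2) auto
  define B1 where "B1 = 8 * C\<^sup>2 * s * exp (s / 2) * 2 powr s"
  define B2 where "B2 = 2 powr q"
  have B: "B1 \<ge> 0" "B2 \<ge> 0" using s by (auto simp: B1_def B2_def)
  define Km where "Km = \<delta> powr (- \<alpha>) * k2 / m0"
  define Kp where "Kp = (B1 * k1 + B2 * (kE * C powr \<alpha>)) / m0"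
  have KK: "Km \<ge> 0" "Kp \<ge> 0" using k1 k2 kE m0 B by (auto simp: Km_def Kp_def)
  have "\<exists>\<sigma>. test_measure s A p t ((Km + Kp) * t powr \<alpha>) \<sigma>"
    if A: "closed A" and lg: "local_graph L h \<delta> C A p" and t: "0 < t" "t \<le> 1"
    for A :: "'a set" and p L and h :: "'b \<Rightarrow> 'a" and t
  proof -
    have L: "linear L" "\<And>y. norm (L y) = norm y" and hc: "continuous_on (ball 0 \<delta>) h"
      and gA: "\<And>y. norm y < \<delta> \<Longrightarrow> p + L y + h y \<in> A"
      and h: "\<And>y. norm y < \<delta> \<Longrightarrow> norm (h y) \<le> C * (norm y)\<^sup>2" and ho: "\<And>y v. norm y < \<delta> \<Longrightarrow> h y \<bullet> L v = 0"
      and dec: "\<And>z. z \<in> A \<Longrightarrow> \<exists>\<zeta> \<eta>. z = p + L \<zeta> + \<eta> \<and> (\<forall>v. \<eta> \<bullet> L v = 0) \<and> norm \<eta> \<le> C * (norm (z - p))\<^sup>2"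
      using lg unfolding local_graph_def by auto
    \<comment> \<open>\<open>h\<close> is controlled only on the disc and is extended by 0 to make
      the lift Borel measurable; the density \<open>b\<close> vanishes outside the disc.\<close>
    define g where "g y = p + L y + indicator (ball 0 \<delta>) y *\<^sub>R h y" for y
    have [measurable]: "L \<in> borel_measurable borel"
      using L(1) by (intro borel_measurable_continuous_onI linear_continuous_on linear_conv_bounded_linear[THEN iffD1])
    have [measurable]: "(\<lambda>y. indicator (ball 0 \<delta>) y *\<^sub>R h y) \<in> borel_measurable borel"
      using hc by (intro borel_measurable_continuous_on_indicator) auto
    have [measurable]: "ball (0::'b) \<delta> \<in> sets borel" by simp
    have gm[measurable]: "g \<in> borel_measurable borel" unfolding g_def by measurable
    have [measurable]: "A \<in> sets borel" using A by simp
    \<comment> \<open>Normalises the untruncated bubble to mass 1 and supplies the factor t^\<alpha>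
      of all errors.\<close>
    define c where "c = t powr \<alpha> / m0"
    have c: "c > 0" using t m0 by (simp add: c_def)
    define b where "b y = c * bubble s t y * indicator (ball 0 \<delta>) y" for y :: 'b
    have [measurable]: "b \<in> borel_measurable borel" unfolding b_def by measurable
    have b0: "b y \<ge> 0" for y using c by (simp add: b_def)
    have cm: "ennreal c * bubble_mass TYPE('b) s t = 1"
      using t m0 by (simp add: bm c_def ennreal_mult[symmetric] powr_minus field_simps)
    define \<sigma> where "\<sigma> = distr (density lborel (\<lambda>y. ennreal (b y))) borel g"
    have int\<sigma>: "(\<integral>\<^sup>+x. f x \<partial>\<sigma>) = (\<integral>\<^sup>+y. ennreal (b y) * f (g y) \<partial>lborel)" if [measurable]: "f \<in> borel_measurable borel" for f
      unfolding \<sigma>_def by (simp add: nn_integral_distr nn_integral_density)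
    have AE: "AE y in \<sigma>. y \<in> A"
      unfolding \<sigma>_def by (subst AE_distr_iff) (auto simp: AE_density b_def g_def indicator_def gA)
    have b1: "(\<integral>\<^sup>+y. ennreal (b y) \<partial>lborel) \<le> 1"
    proof -
      have "(\<integral>\<^sup>+y. ennreal (b y) \<partial>lborel) \<le> (\<integral>\<^sup>+y. ennreal c * ennreal (bubble s t (y::'b)) \<partial>lborel)"
        using c by (intro nn_integral_mono) (auto simp: b_def indicator_def ennreal_mult[symmetric])
      also have "\<dots> = 1" using cm by (subst nn_integral_cmult) (auto simp: bubble_mass_def)
      finally show ?thesis .
    qed
    define m where "m = enn2real (\<integral>\<^sup>+y. ennreal (b y) \<partial>lborel)"
    have m: "(\<integral>\<^sup>+y. ennreal (b y) \<partial>lborel) = ennreal m" "m \<ge> 0"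
    proof -
      have "(\<integral>\<^sup>+y. ennreal (b y) \<partial>lborel) < top" by (rule le_less_trans[OF b1]) simp
      then show "(\<integral>\<^sup>+y. ennreal (b y) \<partial>lborel) = ennreal m" unfolding m_def by simp
    qed (simp add: m_def)
    have em: "emeasure \<sigma> UNIV = ennreal m"
      using int\<sigma>[of "\<lambda>_. 1"] m by (simp add: \<sigma>_def)
    have "1 - Km * t powr \<alpha> \<le> m"
    proof -
      have "1 = (\<integral>\<^sup>+y. ennreal c * ennreal (bubble s t (y::'b)) \<partial>lborel)"
        using cm by (subst nn_integral_cmult) (auto simp: bubble_mass_def)
      also have "\<dots> \<le> (\<integral>\<^sup>+y. ennreal (b y) + ennreal c * (ennreal (norm y powr (- q)) * indicator {y. norm y / \<delta> \<ge> 1} y) \<partial>lborel)"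
      proof (intro nn_integral_mono)
        fix y :: 'b
        show "ennreal c * ennreal (bubble s t y) \<le> ennreal (b y) + ennreal c * (ennreal (norm y powr (- q)) * indicator {y. norm y / \<delta> \<ge> 1} y)"
        proof (cases "norm y < \<delta>")
          case False
          then have "y \<noteq> 0" using \<delta> by auto
          then have "bubble s t y \<le> norm y powr (- q)"
            using bubble_le_norm_powr[of y s t] s by (auto simp: q_def)
          then show ?thesis using False \<delta> c by (auto simp: b_def intro!: mult_left_mono ennreal_leI)
        qed (use c in \<open>simp add: b_def ennreal_mult\<close>)
      qed
      also have "\<dots> = ennreal m + ennreal c * (\<integral>\<^sup>+(y::'b). ennreal (norm y powr (- q)) * indicator {y. norm y / \<delta> \<ge> 1} y \<partial>lborel)"
        by (subst nn_integral_add; (subst nn_integral_cmult)?) (auto simp: m)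
      also have "\<dots> = ennreal m + ennreal c * (ennreal (\<delta> powr (?d - q)) * ?I2)"
        by (subst nn_integral_norm_powr_scale[OF \<delta>(1)]) auto
      also have "\<dots> = ennreal (m + c * \<delta> powr (- \<alpha>) * k2)"
        unfolding k2 using c k2(1) m(2) by (simp add: \<alpha>_def q_def ennreal_mult[symmetric] ennreal_plus[symmetric] mult_ac del: ennreal_plus)
      finally have "ennreal 1 \<le> ennreal (m + c * \<delta> powr (- \<alpha>) * k2)" by simp
      then have "1 \<le> m + c * \<delta> powr (- \<alpha>) * k2"
        using m(2) c k2(1) by (subst (asm) ennreal_le_iff) auto
      then show ?thesis by (simp add: Km_def c_def mult_ac)
    qed
    moreover have "Kp * t powr \<alpha> \<ge> 0" using KK by simp
    ultimately have mass: "1 - (Km + Kp) * t powr \<alpha> \<le> m" by (simp add: algebra_simps)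
    have bp: "(\<integral>\<^sup>+y. ennreal c * ennreal (bubble s t y * ((norm (y - \<zeta>))\<^sup>2 + T) powr (- s / 2)) \<partial>lborel)
       \<le> ennreal ((t\<^sup>2 + (norm \<zeta>)\<^sup>2 + T) powr (- s / 2))" if "T \<ge> 0" for T and \<zeta> :: 'b
    proof -
      have "(\<integral>\<^sup>+y. ennreal c * ennreal (bubble s t y * ((norm (y - \<zeta>))\<^sup>2 + T) powr (- s / 2)) \<partial>lborel)
        \<le> ennreal c * (bubble_mass TYPE('b) s t * ennreal ((t\<^sup>2 + (norm \<zeta>)\<^sup>2 + T) powr (- s / 2)))"
        using mult_left_mono[OF bubble_potential_le[OF s(1,2) t(1) that], of "ennreal c"]
        by (subst nn_integral_cmult) auto
      then show ?thesis by (simp add: mult.assoc[symmetric] cm)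
    qed
    have sqrt_powr: "(x\<^sup>2) powr (- s / 2) = x powr (- s)" if "x > 0" for x :: real
    proof -
      have "x\<^sup>2 = x powr 2" using that by simp
      then have "(x\<^sup>2) powr (- s / 2) = x powr (2 * (- s / 2))" by (simp only: powr_powr)
      then show ?thesis by simp
    qed
    then have sqrt_powr': "(x\<^sup>2) powr (- (s / 2)) = x powr (- s)" if "x > 0" for x :: real
      using that by simp
    have pot: "(\<integral>\<^sup>+y. riesz_kernel s y z \<partial>\<sigma>) \<le> ennreal (norm (z - p) powr (- s) * (1 + (Km + Kp) * t powr \<alpha>)) \<and>
          (\<integral>\<^sup>+y. riesz_kernel s y z \<partial>\<sigma>) \<le> ennreal (t powr (- s))" if z: "z \<in> A" "z \<noteq> p" for z
    proof -
      obtain \<zeta> \<eta> where dz: "z = p + L \<zeta> + \<eta>" "\<And>v. \<eta> \<bullet> L v = 0" "norm \<eta> \<le> C * (norm (z - p))\<^sup>2"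
        using dec[OF z(1)] by blast
      define R where "R = norm (z - p)"
      define T where "T = (norm \<eta>)\<^sup>2"
      have R: "R > 0" using z by (simp add: R_def)
      have T: "T \<ge> 0" by (simp add: T_def)
      have \<eta>: "norm \<eta> \<le> C * R\<^sup>2" using dz by (simp add: R_def)
      let ?U = "\<integral>\<^sup>+y. riesz_kernel s y z \<partial>\<sigma>"
      let ?Q = "\<lambda>y. ((norm (y - \<zeta>))\<^sup>2 + T) powr (- s / 2)"
      let ?c8 = "8 * C\<^sup>2 * s * exp (s / 2) * (R / 2) powr (- s)"
      have gy: "g y = p + L y + h y" if "norm y < \<delta>" for y using that by (simp add: g_def)
      have ge: "norm (y - \<zeta>) \<le> norm (g y - z)" if "norm y < \<delta>" for y
        unfolding gy[OF that] using graph_norm_ge[OF L ho[OF that] dz(2) dz(1) R_def R T_def h[OF that] \<eta>] .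
      have RT: "R\<^sup>2 = (norm \<zeta>)\<^sup>2 + T"
        using graph_dist_sq[OF L _ dz(2) dz(1) R_def R T_def _ \<eta>, of 0 0] by simp
      have int: "?U = (\<integral>\<^sup>+y. ennreal (b y) * riesz_kernel s (g y) z \<partial>lborel)"
        by (rule int\<sigma>) measurable
      have AE0: "AE y in lborel. y \<noteq> \<zeta> \<and> y \<noteq> (0::'b)"
        using AE_lborel_singleton[of \<zeta>] AE_lborel_singleton[of "0::'b"] by eventually_elim simp
      have kern: "ennreal (b y) * riesz_kernel s (g y) z = ennreal (b y * norm (g y - z) powr (- s))" if "y \<noteq> \<zeta>" for y
      proof (cases "norm y < \<delta>")
        case True
        then have "g y \<noteq> z" using ge[OF True] that by auto
        then show ?thesis using b0 by (simp add: riesz_kernel_def ennreal_mult)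
      qed (simp add: b_def)
      have le: "norm (g y - z) powr (- s) \<le> norm (y - \<zeta>) powr (- s)" if "norm y < \<delta>" "y \<noteq> \<zeta>" for y
        using ge[OF that(1)] that s by (intro powr_mono2') auto
      \<comment> \<open>The cap: discarding normal components only shortens distances, and the
        planar potential is largest above its centre, where it is t^(-s).\<close>
      have "?U \<le> (\<integral>\<^sup>+y. ennreal c * ennreal (bubble s t y * ((norm (y - \<zeta>))\<^sup>2 + 0) powr (- s / 2)) \<partial>lborel)"
        unfolding int
      proof (rule nn_integral_mono_AE, use AE0 in eventually_elim)
        fix y assume y: "y \<noteq> \<zeta> \<and> y \<noteq> (0::'b)"
        have "b y * norm (g y - z) powr (- s) \<le> c * (bubble s t y * norm (y - \<zeta>) powr (- s))"
          using le[of y] y c by (cases "norm y < \<delta>") (auto simp: b_def mult.assoc intro!: mult_left_mono)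
        then show "ennreal (b y) * riesz_kernel s (g y) z \<le> ennreal c * ennreal (bubble s t y * ((norm (y - \<zeta>))\<^sup>2 + 0) powr (- s / 2))"
          using y c by (simp add: kern sqrt_powr' ennreal_mult[symmetric] ennreal_leI)
      qed
      also have "\<dots> \<le> ennreal ((t\<^sup>2 + (norm \<zeta>)\<^sup>2 + 0) powr (- s / 2))" by (rule bp) simp
      also have "\<dots> \<le> ennreal ((t\<^sup>2) powr (- s / 2))" using t s by (intro ennreal_leI powr_mono2') auto
      also have "(t\<^sup>2) powr (- s / 2) = t powr (- s)" by (rule sqrt_powr[OF t(1)])
      finally have P2: "?U \<le> ennreal (t powr (- s))" .
      let ?E = "\<lambda>w::'b. norm w powr (- s) - ((norm w)\<^sup>2 + T) powr (- s / 2)"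
      let ?X = "\<lambda>y. ennreal (c * B1 * R powr (- s)) * (ennreal (norm y powr (- q')) * indicator {y. norm y < 1} y) + ennreal (c * B2 * R powr (- q)) * ennreal (?E (y - \<zeta>))"
      have E0: "?E w \<ge> 0" if "w \<noteq> 0" for w
      proof -
        have "((norm w)\<^sup>2 + T) powr (- s / 2) \<le> ((norm w)\<^sup>2) powr (- s / 2)" using that T s by (intro powr_mono2') auto
        then show ?thesis using that by (simp add: sqrt_powr')
      qed
      have bub: "bubble s t y \<le> norm y powr (- q)" if "y \<noteq> 0" for y :: 'b
        using bubble_le_norm_powr[of y s t] s that by (auto simp: q_def)
      have pt: "b y * norm (g y - z) powr (- s) \<le> c * (bubble s t y * ?Q y)
          + c * B1 * R powr (- s) * (norm y powr (- q') * indicator {y. norm y < 1} y) + c * B2 * R powr (- q) * max 0 (?E (y - \<zeta>))"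
        (is "_ \<le> ?t1 + ?t2 + ?t3")
        if y: "y \<noteq> \<zeta>" "y \<noteq> 0" for y
      proof -
        have nn: "?t1 \<ge> 0" "?t2 \<ge> 0" "?t3 \<ge> 0" using c B by (auto intro!: mult_nonneg_nonneg)
        consider "norm y \<ge> \<delta>" | "norm y < \<delta>" "norm y \<le> R / 2" | "norm y < \<delta>" "norm y > R / 2" by linarith
        then show ?thesis
        proof cases
          case 1
          then show ?thesis using nn by (simp add: b_def)
        next
          case 2
          have "bubble s t y * (norm y)\<^sup>2 \<le> norm y powr (- q')"
          proof -
            have "bubble s t y * (norm y)\<^sup>2 \<le> norm y powr (- q) * norm y powr 2"
              using bub[OF y(2)] y by (simp add: mult_right_mono)
            also have "\<dots> = norm y powr (- q')" by (simp add: q'_def powr_add[symmetric] del: powr_numeral)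
            finally show ?thesis .
          qed
          moreover have "?c8 = B1 * R powr (- s)"
            using R by (simp add: B1_def powr_divide powr_minus field_simps)
          ultimately have "bubble s t y * (?c8 * (norm y)\<^sup>2) \<le> B1 * R powr (- s) * norm y powr (- q')"
            using B mult_left_mono[of "bubble s t y * (norm y)\<^sup>2" "norm y powr (- q')" "B1 * R powr (- s)"] by (simp add: mult_ac)
          moreover have "norm (g y - z) powr (- s) \<le> ?Q y + ?c8 * (norm y)\<^sup>2"
            unfolding gy[OF 2(1)] using graph_kernel_near[OF L ho[OF 2(1)] dz(2) dz(1) R_def R T_def h[OF 2(1)] \<eta> C 2(1) y(2) y(1) 2(2) s(1)] .
          then have "bubble s t y * norm (g y - z) powr (- s) \<le> bubble s t y * (?Q y + ?c8 * (norm y)\<^sup>2)"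
            by (rule mult_left_mono) simp
          ultimately have "bubble s t y * norm (g y - z) powr (- s) \<le> bubble s t y * ?Q y + B1 * R powr (- s) * norm y powr (- q')"
            by (simp add: distrib_left)
          then have "c * (bubble s t y * norm (g y - z) powr (- s)) \<le> c * (bubble s t y * ?Q y + B1 * R powr (- s) * norm y powr (- q'))"
            using c by (intro mult_left_mono) auto
          then have "b y * norm (g y - z) powr (- s) \<le> ?t1 + ?t2" using 2 \<delta> by (simp add: b_def distrib_left mult.assoc)
          then show ?thesis using nn by linarith
        next
          case 3
          have "norm y powr (- q) \<le> (R / 2) powr (- q)" using 3 R s by (intro powr_mono2') (auto simp: q_def)
          also have "\<dots> = B2 * R powr (- q)" using R by (simp add: B2_def powr_divide powr_minus field_simps)
          finally have "bubble s t y \<le> B2 * R powr (- q)" using bub[OF y(2)] by linarith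
          then have "bubble s t y * ?E (y - \<zeta>) \<le> B2 * R powr (- q) * max 0 (?E (y - \<zeta>))"
            using E0[of "y - \<zeta>"] y by (intro mult_mono) (auto simp: B)
          moreover have "bubble s t y * norm (g y - z) powr (- s) \<le> bubble s t y * (?Q y + ?E (y - \<zeta>))"
            using le[OF 3(1) y(1)] by (intro mult_left_mono) auto
          ultimately have "bubble s t y * norm (g y - z) powr (- s) \<le> bubble s t y * ?Q y + B2 * R powr (- q) * max 0 (?E (y - \<zeta>))"
            unfolding distrib_left by linarith
          then have "c * (bubble s t y * norm (g y - z) powr (- s)) \<le> c * (bubble s t y * ?Q y + B2 * R powr (- q) * max 0 (?E (y - \<zeta>)))"
            using c by (intro mult_left_mono) auto
          then have "b y * norm (g y - z) powr (- s) \<le> ?t1 + ?t3" using 3 by (simp add: b_def distrib_left mult.assoc)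
          then show ?thesis using nn by linarith
        qed
      qed
      have "?U \<le> (\<integral>\<^sup>+y. ennreal c * ennreal (bubble s t y * ?Q y)
          + ?X y \<partial>lborel)"
        unfolding int
      proof (rule nn_integral_mono_AE, use AE0 in eventually_elim)
        fix y assume y: "y \<noteq> \<zeta> \<and> y \<noteq> (0::'b)"
        have "ennreal (b y) * riesz_kernel s (g y) z \<le> ennreal (c * (bubble s t y * ?Q y)
          + c * B1 * R powr (- s) * (norm y powr (- q') * indicator {y. norm y < 1} y) + c * B2 * R powr (- q) * max 0 (?E (y - \<zeta>)))"
          using pt[of y] y by (simp add: kern ennreal_leI)
        also have "\<dots> = ennreal c * ennreal (bubble s t y * ?Q y)
          + ?X y"
        proof -
          have i: "ennreal (norm y powr (- q')) * indicator {y. norm y < 1} y = ennreal (norm y powr (- q') * indicator {y. norm y < 1} y)"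
            by (simp add: indicator_def)
          have m: "ennreal (?E (y - \<zeta>)) = ennreal (max 0 (?E (y - \<zeta>)))" by (simp add: max_def ennreal_neg)
          show ?thesis unfolding i m using c B
            by (simp add: ennreal_mult[symmetric] ennreal_plus[symmetric] add.assoc del: ennreal_plus)
        qed
        finally show "ennreal (b y) * riesz_kernel s (g y) z \<le> ennreal c * ennreal (bubble s t y * ?Q y)
          + ?X y" .
      qed
      also have "\<dots> = (\<integral>\<^sup>+y. ennreal c * ennreal (bubble s t y * ?Q y) \<partial>lborel)
          + (ennreal (c * B1 * R powr (- s)) * ?I1 + ennreal (c * B2 * R powr (- q)) * (\<integral>\<^sup>+y. ennreal (?E (y - \<zeta>)) \<partial>lborel))"
        by (subst nn_integral_add, measurable, subst nn_integral_add, measurable, subst (2) nn_integral_cmult, measurable, subst (2) nn_integral_cmult, measurable)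
      also have "(\<integral>\<^sup>+y. ennreal (?E (y - \<zeta>)) \<partial>lborel) = (\<integral>\<^sup>+y. ennreal (?E y) \<partial>lborel)"
        using nn_integral_lborel_translate[of "\<lambda>y. ennreal (?E y)" "- \<zeta>"] by simp
      also have "(\<integral>\<^sup>+y. ennreal c * ennreal (bubble s t y * ?Q y) \<partial>lborel)
          + (ennreal (c * B1 * R powr (- s)) * ?I1 + ennreal (c * B2 * R powr (- q)) * (\<integral>\<^sup>+y. ennreal (?E y) \<partial>lborel))
         \<le> ennreal (R powr (- s)) + (ennreal (c * B1 * R powr (- s)) * ennreal k1 + ennreal (c * B2 * R powr (- q)) * ennreal (kE * (C powr \<alpha> * R powr (2 * \<alpha>))))"
      proof (intro add_mono mult_left_mono)
        have "(t\<^sup>2 + (norm \<zeta>)\<^sup>2 + T) powr (- s / 2) \<le> (R\<^sup>2) powr (- s / 2)"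
        proof -
          have "(norm \<zeta>)\<^sup>2 + T > 0" using R RT by (metis zero_less_power)
          then show ?thesis unfolding RT using s by (intro powr_mono2') auto
        qed
        then have "ennreal ((t\<^sup>2 + (norm \<zeta>)\<^sup>2 + T) powr (- s / 2)) \<le> ennreal (R powr (- s))"
          unfolding sqrt_powr[OF R] by (rule ennreal_leI)
        then show "(\<integral>\<^sup>+y. ennreal c * ennreal (bubble s t y * ?Q y) \<partial>lborel) \<le> ennreal (R powr (- s))"
          by (rule order_trans[OF bp[OF T]])
        show "?I1 \<le> ennreal k1" using k1 by simp
        have "T powr (\<alpha> / 2) = norm \<eta> powr \<alpha>"
        proof (cases "\<eta> = 0")
          case False
          then have "(norm \<eta>)\<^sup>2 = norm \<eta> powr 2" by simp
          then have "T powr (\<alpha> / 2) = norm \<eta> powr (2 * (\<alpha> / 2))" unfolding T_def by (simp only: powr_powr)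
          then show ?thesis by simp
        qed (simp add: T_def)
        also have "\<dots> \<le> (C * R\<^sup>2) powr \<alpha>" using \<eta> \<alpha> by (intro powr_mono2) auto
        also have "R\<^sup>2 = R powr 2" using R by simp
        also have "(C * R powr 2) powr \<alpha> = C powr \<alpha> * R powr (2 * \<alpha>)" using C by (simp only: powr_mult powr_powr powr_ge_zero)
        finally have "kE * T powr (\<alpha> / 2) \<le> kE * (C powr \<alpha> * R powr (2 * \<alpha>))" using kE by (intro mult_left_mono) auto
        then show "(\<integral>\<^sup>+y. ennreal (?E y) \<partial>lborel) \<le> ennreal (kE * (C powr \<alpha> * R powr (2 * \<alpha>)))"
          by (intro order_trans[OF kE(2)[OF T]] ennreal_leI)
      qed auto
      also have "\<dots> = ennreal (R powr (- s) + (c * B1 * R powr (- s) * k1 + c * B2 * kE * C powr \<alpha> * (R powr (- q) * R powr (2 * \<alpha>))))"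
        using c B k1 kE by (simp add: ennreal_mult[symmetric] ennreal_plus[symmetric] mult_ac del: ennreal_plus)
      \<comment> \<open>The far error scales exactly like the main term: |\<eta>| \<le> C R^2 turns
        T^(\<alpha>/2) into R^(2 \<alpha>), and - q + 2 \<alpha> = - s.\<close>
      also have "R powr (- q) * R powr (2 * \<alpha>) = R powr (- s)"
        by (simp add: powr_add[symmetric] q_def \<alpha>_def)
      also have "R powr (- s) + (c * B1 * R powr (- s) * k1 + c * B2 * kE * C powr \<alpha> * R powr (- s)) = R powr (- s) * (1 + Kp * t powr \<alpha>)"
        using m0 by (simp add: Kp_def c_def field_simps)
      also have "ennreal \<dots> \<le> ennreal (R powr (- s) * (1 + (Km + Kp) * t powr \<alpha>))"
        using KK by (intro ennreal_leI mult_left_mono add_left_mono mult_right_mono) auto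
      finally show ?thesis using P2 by (simp add: R_def)
    qed
    show ?thesis
      unfolding test_measure_def using AE em mass pot by (intro exI[of _ \<sigma>]) (auto simp: \<sigma>_def)
  qed
  then show ?thesis using that[of "Km + Kp"] KK unfolding \<alpha>_def by fastforce
qed

section \<open>From local graphs to separation, and the interior cases\<close>

lemma optimal_configurations_separated_mono:
  assumes "optimal_configurations_separated s A A'' d" "A \<inter> A' \<subseteq> A''"
  shows "optimal_configurations_separated s A A' d"
proof -
  obtain C where C: "C > 0" "\<And>N x j k. N \<ge> 2 \<Longrightarrow> optimal_configuration s A N x \<Longrightarrow> j \<in> {1..N} \<Longrightarrow> k \<in> {1..N}
      \<Longrightarrow> x j \<in> A'' \<Longrightarrow> k \<noteq> j \<Longrightarrow> norm (x j - x k) > C * real N powr (- 1 / d)"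
    using assms(1) unfolding optimal_configurations_separated_def by metis
  have "x j \<in> A''" if "optimal_configuration s A N x" "j \<in> {1..N}" "x j \<in> A'" for N x j
  proof -
    have "x j \<in> A" using that by (auto simp del: One_nat_def simp: optimal_configuration_def image_subset_iff)
    with that assms(2) show ?thesis by blast
  qed
  with C show ?thesis unfolding optimal_configurations_separated_def by metis
qed

lemma optimal_configurations_separated_empty:
  assumes "A \<inter> A' = {}"
  shows "optimal_configurations_separated s A A' d"
proof (rule optimal_configurations_separated_mono[of s A "{}"])
  show "optimal_configurations_separated s A {} d"
    unfolding optimal_configurations_separated_def by (auto intro: exI[of _ 1])
qed (use assms in auto)

lemma local_graph_shrink:
  assumes "local_graph L h \<delta> C A p" "\<delta>' \<le> \<delta>" "C \<le> C'"
  shows "local_graph L h \<delta>' C' A p"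
proof -
  have "C * (norm y)\<^sup>2 \<le> C' * (norm y)\<^sup>2" for y :: "'c::real_normed_vector"
    using assms(3) by (intro mult_right_mono) auto
  then show ?thesis
    using assms(1,2) unfolding local_graph_def
    by (smt (verit, ccfv_threshold) continuous_on_subset dist_0_norm mem_ball subset_ball)
qed

lemma separated_if_local_graphs:
  fixes A A' :: "'a::euclidean_space set" and s \<delta> C :: real
  assumes s: "0 < s" "s < DIM('b::euclidean_space)" "DIM('b) - s < 2"
    and A: "closed A" "infinite A" and \<delta>: "\<delta> > 0"
    and graph: "\<And>p. p \<in> A \<Longrightarrow> p \<in> A' \<Longrightarrow> \<exists>L (h :: 'b \<Rightarrow> 'a). local_graph L h \<delta> C A p"
  shows "optimal_configurations_separated s A A' DIM('b)"
proof -
  \<comment> \<open>C' \<ge> 1 lets the single bound 1 / (4 C') on the radius yield both \<delta>'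
    \<le> 1 and 4 C' \<delta>' \<le> 1.\<close>
  define C' where "C' = max C 1"
  define \<delta>' where "\<delta>' = min \<delta> (1 / (4 * C'))"
  have C': "C' \<ge> 1" "C \<le> C'" by (auto simp: C'_def)
  have "\<delta>' > 0" "\<delta>' \<le> \<delta>" "\<delta>' \<le> 1 / (4 * C')" using \<delta> C' by (auto simp: \<delta>'_def)
  moreover have "1 / (4 * C') \<le> 1" using C' by simp
  moreover have "4 * C' * \<delta>' \<le> 1" using C' \<open>\<delta>' \<le> 1 / (4 * C')\<close> by (simp add: field_simps)
  ultimately have \<delta>': "\<delta>' > 0" "\<delta>' \<le> \<delta>" "\<delta>' \<le> 1" "4 * C' * \<delta>' \<le> 1" by linarith+
  have C0: "C' \<ge> 0" using C' by simp
  obtain K where K: "K \<ge> 0"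
    "\<And>(A :: 'a set) p L (h :: 'b \<Rightarrow> 'a) t. closed A \<Longrightarrow> local_graph L h \<delta>' C' A p \<Longrightarrow> 0 < t \<Longrightarrow> t \<le> 1 \<Longrightarrow>
      \<exists>\<sigma>. test_measure s A p t (K * t powr (DIM('b) - s)) \<sigma>"
    by (rule graph_test_measure[OF s \<delta>'(1,3) C0 \<delta>'(4), where 'a='a]) (rule that)
  show ?thesis
  proof (rule optimal_configurations_separatedI[OF s(1,2) K(1) A(2)])
    fix p t assume p: "p \<in> A" "p \<in> A'" and t: "0 < t" "t \<le> (1::real)"
    obtain L and h :: "'b \<Rightarrow> 'a" where "local_graph L h \<delta> C A p" using graph[OF p] by blast
    then have "local_graph L h \<delta>' C' A p" using \<delta>'(2) C'(2) by (rule local_graph_shrink)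
    then show "\<exists>\<sigma>. test_measure s A p t (K * t powr (DIM('b) - s)) \<sigma>"
      using K(2)[OF A(1) _ t] by blast
  qed
qed

text \<open>A ball is connected, so if it met both \<open>A\<close> and the complement it would meet
  the boundary at distance less than \<epsilon> from \<open>p\<close>.\<close>

lemma ball_subset_if_infdist_frontier_ge:
  fixes A :: "'a::euclidean_space set"
  assumes "p \<in> A" "infdist p (frontier A) \<ge> \<epsilon>" "\<epsilon> > 0"
  shows "ball p \<epsilon> \<subseteq> A"
proof (rule ccontr)
  assume "\<not> ball p \<epsilon> \<subseteq> A"
  then have "ball p \<epsilon> \<inter> frontier A \<noteq> {}"
    using assms centre_in_ball[of p \<epsilon>] by (intro connected_Int_frontier) blast+
  then obtain w where w: "w \<in> frontier A" "dist p w < \<epsilon>" by auto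
  then show False using infdist_le[OF w(1), of p] assms(2) by simp
qed

lemma separated_in_interior:
  fixes A :: "'a::euclidean_space set" and s :: real
  assumes A: "compact A" and s: "0 < s" "real DIM('a) - 2 < s" "s < real DIM('a)" and \<epsilon>: "\<epsilon> > 0"
  shows "optimal_configurations_separated s A {x \<in> A. infdist x (frontier A) \<ge> \<epsilon>} DIM('a)"
\<comment> \<open>If some point qualifies, \<open>A\<close> contains a ball and is therefore
  infinite, which makes the optimal energy finite.\<close>
proof (cases "{x \<in> A. infdist x (frontier A) \<ge> \<epsilon>} = {}")
  case True
  then show ?thesis by (intro optimal_configurations_separated_empty) auto
next
  case False
  then obtain p where "p \<in> A" "infdist p (frontier A) \<ge> \<epsilon>" by auto
  then have "ball p \<epsilon> \<subseteq> A" using \<epsilon> by (rule ball_subset_if_infdist_frontier_ge)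
  moreover have "infinite (ball p \<epsilon>)" using uncountable_ball[OF \<epsilon>] countable_finite by blast
  ultimately have inf: "infinite A" using finite_subset by blast
  show ?thesis
  proof (rule separated_if_local_graphs[OF _ _ _ _ inf \<epsilon>])
    fix p assume "p \<in> A" "p \<in> {x \<in> A. infdist x (frontier A) \<ge> \<epsilon>}"
    then have sub: "ball p \<epsilon> \<subseteq> A" using ball_subset_if_infdist_frontier_ge[of p A \<epsilon>] \<epsilon> by auto
    \<comment> \<open>In the interior the whole space serves as tangent plane: every z - p is
      tangential, and nothing is curved.\<close>
    have "local_graph (\<lambda>y. y) (\<lambda>_. 0) \<epsilon> 0 A p"
      unfolding local_graph_def
    proof (intro conjI ballI)
      show "p + y + 0 \<in> A" if "y \<in> ball 0 \<epsilon>" for y using sub that by (auto simp: dist_norm)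
      show "\<exists>\<zeta> \<eta>. z = p + \<zeta> + \<eta> \<and> (\<forall>v. \<eta> \<bullet> v = 0) \<and> norm \<eta> \<le> 0 * (norm (z - p))\<^sup>2" for z
        by (rule exI[of _ "z - p"], rule exI[of _ 0]) simp
    qed (auto intro: linear_ident)
    then show "\<exists>L (h :: 'a \<Rightarrow> 'a). local_graph L h \<epsilon> 0 A p" by blast
  qed (use A s in \<open>auto simp: compact_imp_closed\<close>)
qed

lemma separated_in_ball_interior:
  fixes s :: real
  assumes s: "0 < s" "real DIM('a::euclidean_space) - 2 < s" "s < real DIM('a)" and \<epsilon>: "\<epsilon> > 0"
  shows "optimal_configurations_separated s (cball (0 :: 'a) 1) {x. norm x \<le> 1 - \<epsilon>} DIM('a)"
proof (rule optimal_configurations_separated_mono[OF separated_in_interior[OF compact_cball s \<epsilon>]])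
  have "infdist x (frontier (cball 0 1)) \<ge> \<epsilon>" if "norm x \<le> 1 - \<epsilon>" for x :: 'a
  proof -
    \<comment> \<open>\<open>infdist\<close> to the empty set is 0 by convention, so nonemptiness is
      what makes it an infimum of distances.\<close>
    have ne: "sphere (0::'a) 1 \<noteq> {}" by simp
    have "\<epsilon> \<le> dist x y" if "y \<in> sphere 0 1" for y
      using norm_triangle_ineq2[of y x] that \<open>norm x \<le> 1 - \<epsilon>\<close> by (simp add: dist_norm norm_minus_commute)
    then show ?thesis using ne by (auto simp: infdist_notempty intro!: cINF_greatest)
  qed
  then show "cball (0 :: 'a) 1 \<inter> {x. norm x \<le> 1 - \<epsilon>} \<subseteq> {x \<in> cball 0 1. \<epsilon> \<le> infdist x (frontier (cball 0 1))}" by auto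
qed

section \<open>Smooth submanifolds are local graphs\<close>

text \<open>\<open>Ck_on\<close> provides continuity of each directional derivative separately.
  Compactness bounds it for the finitely many basis directions, and linearity gives a bound for all
  directions.\<close>

lemma Ck_on_Suc_0_derivative_bound:
  fixes g :: "'a::euclidean_space \<Rightarrow> 'b::euclidean_space"
  assumes g: "Ck_on (Suc 0) g S" and T: "compact T" "T \<subseteq> S"
  obtains K where "K \<ge> 0" "\<And>x v. x \<in> T \<Longrightarrow> norm (frechet_derivative g (at x) v) \<le> K * norm v"
proof -
  have "\<exists>B. \<forall>x\<in>T. norm (frechet_derivative g (at x) b) \<le> B" for b
  proof -
    have "continuous_on T (\<lambda>x. frechet_derivative g (at x) b)"
      using g T(2) by (auto intro: continuous_on_subset)
    then have "bounded ((\<lambda>x. frechet_derivative g (at x) b) ` T)"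
      using T(1) compact_continuous_image compact_imp_bounded by blast
    then show ?thesis by (auto simp: bounded_iff)
  qed
  then obtain B where B: "\<And>b x. x \<in> T \<Longrightarrow> norm (frechet_derivative g (at x) b) \<le> B b" by metis
  define K where "K = (\<Sum>b\<in>(Basis::'a set). \<bar>B b\<bar>)"
  have "norm (frechet_derivative g (at x) v) \<le> K * norm v" if x: "x \<in> T" for x v
  proof -
    have "g differentiable (at x)" using g x T(2) by auto
    then have lin: "linear (frechet_derivative g (at x))" by (rule linear_frechet_derivative)
    have "norm (frechet_derivative g (at x) v) = norm (\<Sum>b\<in>Basis. (v \<bullet> b) *\<^sub>R frechet_derivative g (at x) b)"
      by (subst (1) euclidean_representation[of v, symmetric]) (simp add: linear_sum[OF lin] linear_scale[OF lin])
    also have "\<dots> \<le> (\<Sum>b\<in>Basis. norm v * \<bar>B b\<bar>)"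
    proof (rule sum_norm_le)
      fix b :: 'a assume b: "b \<in> Basis"
      have "\<bar>v \<bullet> b\<bar> \<le> norm v" using b by (rule Basis_le_norm)
      moreover have "norm (frechet_derivative g (at x) b) \<le> \<bar>B b\<bar>" using B[OF x, of b] by linarith
      ultimately show "norm ((v \<bullet> b) *\<^sub>R frechet_derivative g (at x) b) \<le> norm v * \<bar>B b\<bar>"
        by (simp add: mult_mono)
    qed
    finally show ?thesis by (simp add: K_def sum_distrib_left mult.commute)
  qed
  moreover have "K \<ge> 0" by (simp add: K_def sum_nonneg)
  ultimately show ?thesis using that by blast
qed

lemma Cinfinity_on_has_derivative:
  assumes "Cinfinity_on f S" "x \<in> S"
  shows "(f has_derivative frechet_derivative f (at x)) (at x)"
proof -
  have "Ck_on (Suc 0) f S" using assms(1) unfolding Cinfinity_on_def by blast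
  then show ?thesis using assms(2) by (auto simp: frechet_derivative_works)
qed

text \<open>For the Lipschitz bound, the mean value inequality on the convex set \<open>T\<close> is
  applied to the directional derivative along each basis vector, whose own derivative is bounded by
  compactness.\<close>

lemma Cinfinity_on_C2_bounds:
  fixes f :: "'a::euclidean_space \<Rightarrow> 'b::euclidean_space"
  assumes f: "Cinfinity_on f S" and T: "compact T" "convex T" "T \<subseteq> S"
  obtains K where "K \<ge> 0" "\<And>x v. x \<in> T \<Longrightarrow> norm (frechet_derivative f (at x) v) \<le> K * norm v"
    "\<And>x y v. x \<in> T \<Longrightarrow> y \<in> T \<Longrightarrow> norm (frechet_derivative f (at x) v - frechet_derivative f (at y) v) \<le> K * norm (x - y) * norm v"
proof -
  let ?D = "\<lambda>x. frechet_derivative f (at x)"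
  have C2: "Ck_on (Suc (Suc 0)) f S" and C1: "Ck_on (Suc 0) f S" using f unfolding Cinfinity_on_def by blast+
  obtain K1 where K1: "K1 \<ge> 0" "\<And>x v. x \<in> T \<Longrightarrow> norm (?D x v) \<le> K1 * norm v"
    by (rule Ck_on_Suc_0_derivative_bound[OF C1 T(1,3)]) (rule that)
  have "\<exists>B\<ge>0. \<forall>x\<in>T. \<forall>y\<in>T. norm (?D x b - ?D y b) \<le> B * norm (x - y)" for b
  proof -
    have C1b: "Ck_on (Suc 0) (\<lambda>x. ?D x b) S" using C2 Ck_on.simps(2)[of "Suc 0" f S] by blast
    obtain B where B: "B \<ge> 0" "\<And>x v. x \<in> T \<Longrightarrow> norm (frechet_derivative (\<lambda>x. ?D x b) (at x) v) \<le> B * norm v"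
      by (rule Ck_on_Suc_0_derivative_bound[OF C1b T(1,3)]) (rule that)
    have "norm (?D x b - ?D y b) \<le> B * norm (x - y)" if "x \<in> T" "y \<in> T" for x y
    proof (rule differentiable_bound[OF T(2) _ _ that])
      fix z assume z: "z \<in> T"
      have "(\<lambda>x. ?D x b) differentiable (at z)" using C1b z T(3) by auto
      then show "((\<lambda>x. ?D x b) has_derivative frechet_derivative (\<lambda>x. ?D x b) (at z)) (at z within T)"
        using frechet_derivative_works has_derivative_at_withinI by blast
      show "onorm (frechet_derivative (\<lambda>x. ?D x b) (at z)) \<le> B"
        using B z by (intro onorm_bound) auto
    qed
    then show ?thesis using B(1) by blast
  qed
  then obtain B where B: "\<And>b. B b \<ge> 0" "\<And>b x y. x \<in> T \<Longrightarrow> y \<in> T \<Longrightarrow> norm (?D x b - ?D y b) \<le> B b * norm (x - y)" by metis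
  define K2 where "K2 = (\<Sum>b\<in>(Basis::'a set). B b)"
  have K2: "K2 \<ge> 0" using B(1) by (simp add: K2_def sum_nonneg)
  have lip: "norm (?D x v - ?D y v) \<le> K2 * norm (x - y) * norm v" if xy: "x \<in> T" "y \<in> T" for x y v
  proof -
    have "f differentiable (at x)" "f differentiable (at y)" using C1 xy T(3) by auto
    then have lin: "linear (\<lambda>v. ?D x v - ?D y v)" by (intro linear_compose_sub linear_frechet_derivative)
    have "norm (?D x v - ?D y v) = norm (\<Sum>b\<in>Basis. (v \<bullet> b) *\<^sub>R (?D x b - ?D y b))"
      using linear_sum[OF lin, of "\<lambda>b. (v \<bullet> b) *\<^sub>R b" Basis] linear_scale[OF lin] by (simp add: euclidean_representation)
    also have "\<dots> \<le> (\<Sum>b\<in>Basis. norm v * (B b * norm (x - y)))"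
    proof (rule sum_norm_le)
      fix b :: 'a assume b: "b \<in> Basis"
      show "norm ((v \<bullet> b) *\<^sub>R (?D x b - ?D y b)) \<le> norm v * (B b * norm (x - y))"
        using Basis_le_norm[OF b, of v] B(2)[OF xy, of b] by (simp add: mult_mono)
    qed
    finally show ?thesis by (simp add: K2_def sum_distrib_left sum_distrib_right mult_ac)
  qed
  show ?thesis
  proof (rule that[of "max K1 K2"])
    show "norm (?D x v) \<le> max K1 K2 * norm v" if "x \<in> T" for x v
      by (rule order_trans[OF K1(2)[OF that]]) (simp add: mult_right_mono)
    show "norm (?D x v - ?D y v) \<le> max K1 K2 * norm (x - y) * norm v" if "x \<in> T" "y \<in> T" for x y v
      by (rule order_trans[OF lip[OF that]]) (simp add: mult_right_mono)
  qed (use K1 in auto)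
qed

text \<open>Mean value inequality for f - D v0, whose derivative is at most K t on the ball of
  radius \<open>t\<close>.\<close>

lemma has_derivative_linearization_bound:
  fixes f :: "'a::euclidean_space \<Rightarrow> 'b::euclidean_space"
  assumes der: "\<And>x. x \<in> S \<Longrightarrow> (f has_derivative D x) (at x)" and sub: "cball v\<^sub>0 t \<subseteq> S"
    and lip: "\<And>x y v. x \<in> S \<Longrightarrow> y \<in> S \<Longrightarrow> norm (D x v - D y v) \<le> K * norm (x - y) * norm v"
    and K: "K \<ge> 0" and t: "t \<ge> 0" and x: "x \<in> cball v\<^sub>0 t" and x': "x' \<in> cball v\<^sub>0 t"
  shows "norm (f x - f x' - D v\<^sub>0 (x - x')) \<le> K * t * norm (x - x')"
proof -
  have v0: "v\<^sub>0 \<in> S" using sub t by auto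
  have bl: "bounded_linear (D v\<^sub>0)" using der[OF v0] by (rule has_derivative_bounded_linear)
  have "norm ((f x - D v\<^sub>0 x) - (f x' - D v\<^sub>0 x')) \<le> K * t * norm (x - x')"
  proof (rule differentiable_bound[OF convex_cball _ _ x x'])
    fix z assume z: "z \<in> cball v\<^sub>0 t"
    then have zS: "z \<in> S" using sub by blast
    show "((\<lambda>x. f x - D v\<^sub>0 x) has_derivative (\<lambda>v. D z v - D v\<^sub>0 v)) (at z within cball v\<^sub>0 t)"
      by (rule has_derivative_diff[OF has_derivative_at_withinI[OF der[OF zS]] bounded_linear_imp_has_derivative[OF bl]])
    show "onorm (\<lambda>v. D z v - D v\<^sub>0 v) \<le> K * t"
    proof (rule onorm_bound)
      fix v
      have "norm (D z v - D v\<^sub>0 v) \<le> K * norm (z - v\<^sub>0) * norm v" by (rule lip[OF zS v0])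
      also have "\<dots> \<le> K * t * norm v" using z K by (intro mult_right_mono mult_left_mono) (auto simp: dist_norm norm_minus_commute)
      finally show "norm (D z v - D v\<^sub>0 v) \<le> K * t * norm v" .
    qed (use K t in simp)
  qed
  moreover have "D v\<^sub>0 x - D v\<^sub>0 x' = D v\<^sub>0 (x - x')" using bl by (simp add: bounded_linear.linear linear_diff)
  ultimately show ?thesis by (simp add: algebra_simps)
qed

text \<open>For an isometric \<open>L\<close>, \<open>L (adjoint L w)\<close> is the orthogonal
  projection of \<open>w\<close> onto the range of \<open>L\<close>; everything follows from
  Pythagoras.\<close>

lemma isometric_linear_adjoint:
  fixes L :: "'b::euclidean_space \<Rightarrow> 'a::euclidean_space"
  assumes L: "linear L" "\<And>y. norm (L y) = norm y"
  shows "L u \<bullet> L v = u \<bullet> v" "adjoint L (L u) = u" "norm (adjoint L w) \<le> norm w"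
    "norm (w - L (adjoint L w)) \<le> norm (w - L u)" "(w - L (adjoint L w)) \<bullet> L v = 0"
proof -
  have ip: "L u \<bullet> L v = u \<bullet> v" for u v
    using L(2)[of u] L(2)[of v] L(2)[of "u + v"] linear_add[OF L(1), of u v] by (simp add: dot_norm)
  then show "L u \<bullet> L v = u \<bullet> v" .
  have adj: "adjoint L w \<bullet> v = w \<bullet> L v" for w v using adjoint_works[OF L(1), of v w] by (simp add: inner_commute)
  show "adjoint L (L u) = u"
    by (rule vector_eq_rdot[THEN iffD1]) (simp add: adj ip)
  show o: "(w - L (adjoint L w)) \<bullet> L v = 0" for v by (simp add: inner_diff_left ip adj)
  have "(norm (w - L u))\<^sup>2 = (norm (w - L (adjoint L w)))\<^sup>2 + (norm (L (adjoint L w - u)))\<^sup>2" for u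
  proof -
    have "w - L u = (w - L (adjoint L w)) + L (adjoint L w - u)" by (simp add: linear_diff[OF L(1)])
    then show ?thesis
      using norm_add_Pythagorean[of "w - L (adjoint L w)" "L (adjoint L w - u)"] o[of "adjoint L w - u"]
      unfolding orthogonal_def by (simp only:)
  qed
  note pyth = this
  show "norm (w - L (adjoint L w)) \<le> norm (w - L u)"
    by (rule power2_le_imp_le) (simp_all add: pyth[of u])
  have "(norm (adjoint L w))\<^sup>2 \<le> (norm w)\<^sup>2" using pyth[of 0] by (simp add: linear_0[OF L(1)] L(2))
  then show "norm (adjoint L w) \<le> norm w" by (rule power2_le_imp_le) simp
qed

text \<open>A parametrisation \<open>G\<close> tangent to the isometry \<open>L\<close> is turned into a graph by inverting its tangential part,
  a perturbation of the identity with Lipschitz constant \<open>1/2\<close>.\<close>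

lemma local_graph_of_parametrization:
  fixes L :: "'b::euclidean_space \<Rightarrow> 'a::euclidean_space" and G :: "'b \<Rightarrow> 'a"
  assumes L: "linear L" "\<And>y. norm (L y) = norm y" and r: "r > 0" and C: "C \<ge> 0"
    and GM: "\<And>y. norm y \<le> r \<Longrightarrow> G y \<in> M" and G0: "G 0 = p"
    and lip: "\<And>y y'. norm y \<le> r \<Longrightarrow> norm y' \<le> r \<Longrightarrow> norm (G y - G y' - L (y - y')) \<le> norm (y - y') / 2"
    and quad: "\<And>z. z \<in> M \<Longrightarrow> norm ((z - p) - L (adjoint L (z - p))) \<le> C * (norm (z - p))\<^sup>2"
  shows "\<exists>h. local_graph L h (r / 2) (9 * C) M p"
proof -
  note iso = isometric_linear_adjoint[OF L]
  have linA: "linear (adjoint L)" using L(1) by (rule adjoint_linear)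
  define e where "e y = adjoint L (G y - p - L y)" for y
  have e_lip: "norm (e y - e y') \<le> norm (y - y') / 2" if "norm y \<le> r" "norm y' \<le> r" for y y'
  proof -
    have "e y - e y' = adjoint L (G y - G y' - L (y - y'))"
      unfolding e_def linear_diff[OF linA, symmetric] linear_diff[OF L(1)] by (simp add: algebra_simps)
    then have "norm (e y - e y') \<le> norm (G y - G y' - L (y - y'))" by (simp add: iso(3))
    then show ?thesis using lip[OF that] by linarith
  qed
  have e0: "e 0 = 0" by (simp add: e_def G0 linear_0[OF L(1)] linear_0[OF linA])
  \<comment> \<open>A fixed point satisfies y + e y = u, which says that the tangential part of G y
    - p is u. Since \<open>e\<close> halves distances and e 0 = 0, the map preserves the ball of
    radius r as soon as |u| \<le> r / 2.\<close>
  have "\<exists>!y\<in>cball 0 r. u - e y = y" if u: "norm u \<le> r / 2" for u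
  proof (rule Banach_fix[where c = "1/2"])
    show "(\<lambda>y. u - e y) ` cball 0 r \<subseteq> cball 0 r"
    proof clarify
      fix y assume "y \<in> cball (0::'b) r"
      then have "norm (e y) \<le> norm y / 2" "norm y \<le> r" using e_lip[of y 0] r by (auto simp: e0)
      then show "u - e y \<in> cball 0 r" using norm_triangle_ineq4[of u "e y"] u by simp
    qed
    show "dist (u - e y) (u - e y') \<le> 1 / 2 * dist y y'" if "y \<in> cball 0 r" "y' \<in> cball 0 r" for y y'
      using e_lip[of y' y] that by (simp add: dist_norm norm_minus_commute)
  qed (use r in \<open>auto simp: complete_eq_closed\<close>)
  then have "\<exists>y. y \<in> cball 0 r \<and> u - e y = y" if "norm u \<le> r / 2" for u using that by blast
  then have "\<forall>u. \<exists>y. norm u \<le> r / 2 \<longrightarrow> norm y \<le> r \<and> u - e y = y" by (simp only: mem_cball_0) blast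
  from choice[OF this] obtain Y where Y: "\<And>u. norm u \<le> r / 2 \<Longrightarrow> norm (Y u) \<le> r \<and> u - e (Y u) = Y u" by blast
  have Ylip: "norm (Y u - Y u') \<le> 2 * norm (u - u')" if "norm u \<le> r / 2" "norm u' \<le> r / 2" for u u'
  proof -
    have "Y u - Y u' = (u - e (Y u)) - (u' - e (Y u'))" using Y that by simp
    also have "\<dots> = (u - u') - (e (Y u) - e (Y u'))" by simp
    finally have "norm (Y u - Y u') \<le> norm (u - u') + norm (e (Y u) - e (Y u'))"
      using norm_triangle_ineq4[of "u - u'" "e (Y u) - e (Y u')"] by simp
    also have "norm (e (Y u) - e (Y u')) \<le> norm (Y u - Y u') / 2" using Y that by (intro e_lip) auto
    finally show ?thesis by simp
  qed
  have Glip: "norm (G y - G y') \<le> 3 / 2 * norm (y - y')" if "norm y \<le> r" "norm y' \<le> r" for y y'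
  proof -
    have "norm (G y - G y') \<le> norm (G y - G y' - L (y - y')) + norm (L (y - y'))"
      using norm_triangle_ineq[of "G y - G y' - L (y - y')" "L (y - y')"] by simp
    then show ?thesis using lip[OF that] by (simp add: L(2))
  qed
  have Y0: "Y 0 = 0"
  proof -
    have y0: "norm (Y 0) \<le> r" "- e (Y 0) = Y 0" using Y[of 0] r by auto
    have "norm (- e (Y 0)) \<le> norm (Y 0) / 2" using e_lip[of "Y 0" 0] y0(1) r by (simp add: e0)
    then show ?thesis unfolding y0(2) by simp
  qed
  define h where "h u = G (Y u) - p - L u" for u
  have tang: "adjoint L (G (Y u) - p) = u" if "norm u \<le> r / 2" for u
  proof -
    have "adjoint L (G (Y u) - p) = e (Y u) + Y u"
      unfolding e_def linear_diff[OF linA, of "G (Y u) - p"] by (simp add: iso(2))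
    also have "\<dots> = u" using Y[OF that] by (auto simp: algebra_simps)
    finally show ?thesis .
  qed
  \<comment> \<open>9 = 3^2: \<open>G\<close> is 3/2-Lipschitz and \<open>Y\<close> is 2-Lipschitz,
    so |G (Y u) - p| \<le> 3 |u|.\<close>
  have hq: "norm (h u) \<le> 9 * C * (norm u)\<^sup>2" if u: "norm u \<le> r / 2" for u
  proof -
    have "norm (h u) = norm ((G (Y u) - p) - L (adjoint L (G (Y u) - p)))" unfolding tang[OF u] h_def ..
    also have "\<dots> \<le> C * (norm (G (Y u) - p))\<^sup>2" using Y[OF u] by (intro quad GM) auto
    also have "\<dots> \<le> C * (3 * norm u)\<^sup>2"
    proof (intro mult_left_mono power_mono C)
      have "norm (G (Y u) - p) \<le> 3 / 2 * norm (Y u)" using Glip[of "Y u" 0] Y[OF u] r by (simp add: G0)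
      also have "norm (Y u) \<le> 2 * norm u" using Ylip[OF u, of 0] r by (simp add: Y0)
      finally show "norm (G (Y u) - p) \<le> 3 * norm u" by simp
    qed simp
    finally show ?thesis by (simp add: power_mult_distrib mult_ac)
  qed
  have orth: "h u \<bullet> L v = 0" if u: "norm u \<le> r / 2" for u v
    using iso(5)[of "G (Y u) - p" v] unfolding tang[OF u] h_def .
  have cont: "continuous_on (ball 0 (r / 2)) h"
  proof -
    have "norm (G (Y u) - G (Y u')) \<le> 3 * norm (u - u')" if "u \<in> ball 0 (r/2)" "u' \<in> ball 0 (r / 2)" for u u'
    proof -
      have "norm u \<le> r / 2" "norm u' \<le> r / 2" using that by auto
      then show ?thesis using Glip[of "Y u" "Y u'"] Ylip[of u u'] Y[of u] Y[of u'] by linarith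
    qed
    then have "continuous_on (ball 0 (r / 2)) (\<lambda>u. G (Y u))"
      by (intro lipschitz_on_continuous_on[of 3] lipschitz_onI) (auto simp: dist_norm)
    moreover have "continuous_on (ball 0 (r / 2)) L"
      using L(1) by (simp add: linear_continuous_on linear_conv_bounded_linear)
    ultimately show ?thesis unfolding h_def by (intro continuous_on_diff continuous_on_const)
  qed
  have "local_graph L h (r / 2) (9 * C) M p"
    unfolding local_graph_def
  proof (intro conjI ballI allI)
    fix y :: 'b assume "y \<in> ball 0 (r / 2)"
    then have y: "norm y \<le> r / 2" by simp
    show "p + L y + h y \<in> M" using GM[of "Y y"] Y[OF y] by (simp add: h_def)
    show "norm (h y) \<le> 9 * C * (norm y)\<^sup>2" by (rule hq[OF y])
    show "h y \<bullet> L v = 0" for v by (rule orth[OF y])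
  next
    fix z assume z: "z \<in> M"
    have "C * (norm (z - p))\<^sup>2 \<le> 9 * C * (norm (z - p))\<^sup>2" using C by (intro mult_right_mono) auto
    then have "norm ((z - p) - L (adjoint L (z - p))) \<le> 9 * C * (norm (z - p))\<^sup>2" using quad[OF z] by linarith
    then show "\<exists>\<zeta> \<eta>. z = p + L \<zeta> + \<eta> \<and> (\<forall>v. \<eta> \<bullet> L v = 0) \<and> norm \<eta> \<le> 9 * C * (norm (z - p))\<^sup>2"
      using iso(5)[of "z - p"] by (intro exI[of _ "adjoint L (z - p)"] exI[of _ "(z - p) - L (adjoint L (z - p))"]) simp
  qed (use L cont in auto)
  then show ?thesis by blast
qed


text \<open>The constants must be uniform in \<open>p\<close> near \<open>q\<close>, so that
  compactness can finish the argument; hence the bounds on the chart are fixed on balls around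
  \<open>q\<close> and its image. The tangent space at \<open>p\<close> is the image of
  \<open>W\<close> under the derivative of \<psi>, and \<open>M\<close> is parametrised by applying
  \<psi> to an affine piece of \<open>W\<close>. The quadratic deviation is the Taylor remainder of
  \<psi>.\<close>

lemma smooth_submanifold_local_graph_near:
  fixes M :: "'a::euclidean_space set"
  assumes M: "smooth_submanifold DIM('b::euclidean_space) M" and q: "q \<in> M"
  obtains \<rho> \<delta> C where "\<rho> > 0" "\<delta> > 0"
    "\<And>p. p \<in> M \<Longrightarrow> norm (p - q) < \<rho> \<Longrightarrow> \<exists>L (h :: 'b \<Rightarrow> 'a). local_graph L h \<delta> C M p"
proof -
  obtain U V \<phi> \<psi> W where chart: "open U" "q \<in> U" "open (V::'a set)" "homeomorphism U V \<phi> \<psi>"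
      "Cinfinity_on \<phi> U" "Cinfinity_on \<psi> V" "subspace W" "dim W = DIM('b)" "\<phi> ` (U \<inter> M) = V \<inter> W"
    using bspec[OF M[unfolded smooth_submanifold_def] q] by (elim exE conjE) (rule that)
  have inv: "\<And>x. x \<in> U \<Longrightarrow> \<psi> (\<phi> x) = x" "\<And>v. v \<in> V \<Longrightarrow> \<phi> (\<psi> v) = v"
    and maps: "\<And>x. x \<in> U \<Longrightarrow> \<phi> x \<in> V" "\<And>v. v \<in> V \<Longrightarrow> \<psi> v \<in> U"
    using chart(4)[unfolded homeomorphism_def] by auto
  let ?D\<phi> = "\<lambda>x. frechet_derivative \<phi> (at x)" and ?D\<psi> = "\<lambda>v. frechet_derivative \<psi> (at v)"
  define c where "c = \<phi> q"
  have cV: "c \<in> V" using maps chart(2) by (simp add: c_def)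
  obtain r where r: "r > 0" "cball c r \<subseteq> V" using chart(3) cV open_contains_cball by blast
  obtain r1 where r1: "r1 > 0" "cball q r1 \<subseteq> U" using chart(1,2) open_contains_cball by blast
  obtain K1 where K1: "K1 \<ge> 0" "\<And>x v. x \<in> cball q r1 \<Longrightarrow> norm (?D\<phi> x v) \<le> K1 * norm v"
    by (rule Cinfinity_on_C2_bounds[OF chart(5) compact_cball convex_cball r1(2)]) (rule that)
  obtain K2 where K2: "K2 \<ge> 0" "\<And>v w. v \<in> cball c r \<Longrightarrow> norm (?D\<psi> v w) \<le> K2 * norm w"
    "\<And>x y v. x \<in> cball c r \<Longrightarrow> y \<in> cball c r \<Longrightarrow> norm (?D\<psi> x v - ?D\<psi> y v) \<le> K2 * norm (x - y) * norm v"
    by (rule Cinfinity_on_C2_bounds[OF chart(6) compact_cball convex_cball r(2)]) (rule that)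
  have \<phi>_lip: "norm (\<phi> x - \<phi> y) \<le> K1 * norm (x - y)" if "x \<in> cball q r1" "y \<in> cball q r1" for x y
  proof (rule differentiable_bound[OF convex_cball _ _ that])
    fix z assume z: "z \<in> cball q r1"
    then show "(\<phi> has_derivative ?D\<phi> z) (at z within cball q r1)"
      using Cinfinity_on_has_derivative[OF chart(5)] r1(2) has_derivative_at_withinI by blast
    show "onorm (?D\<phi> z) \<le> K1" using K1 z by (intro onorm_bound) auto
  qed
  \<comment> \<open>Points within \<rho> of \<open>p\<close> are within 2 \<rho> of
    \<open>q\<close>: they stay in the ball of radius \<open>r1\<close>, and their chart images stay
    within r / 2 of \<open>c\<close>.\<close>
  define \<rho> where "\<rho> = min r1 (r / (K1 + 1)) / 4"
  have "r / (K1 + 1) > 0" using r K1 by simp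
  then have \<rho>: "\<rho> > 0" using r1 by (simp add: \<rho>_def)
  have \<rho>1: "4 * \<rho> \<le> r1" by (simp add: \<rho>_def)
  have \<rho>2: "K1 * (2 * \<rho>) \<le> r / 2"
  proof -
    have "4 * \<rho> * (K1 + 1) \<le> r / (K1 + 1) * (K1 + 1)" using K1 by (intro mult_right_mono) (auto simp: \<rho>_def)
    then have "4 * \<rho> * (K1 + 1) \<le> r" using K1 by simp
    then show ?thesis using \<rho> by (simp add: algebra_simps)
  qed
  \<comment> \<open>The first bound keeps the arguments of \<psi> in the ball where
    \<open>K2\<close> is valid; the second makes the deviation of the parametrisation from
    \<open>L\<close> Lipschitz with constant 1/2.\<close>
  define \<delta> where "\<delta> = min (r / (2 * (K1 + 1))) (1 / (2 * (K2 * K1 * K1 + 1)))"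
  have \<delta>: "\<delta> > 0" using r K1 K2 by (auto simp: \<delta>_def intro!: divide_pos_pos add_nonneg_pos mult_nonneg_nonneg)
  have half: "a / (2 * k) * k = a / 2" if "k > 0" for a k :: real using that by (simp add: field_simps)
  have \<delta>1: "K1 * \<delta> \<le> r / 2"
  proof -
    have "\<delta> * (K1 + 1) \<le> r / (2 * (K1 + 1)) * (K1 + 1)" using K1 by (intro mult_right_mono) (auto simp: \<delta>_def)
    also have "r / (2 * (K1 + 1)) * (K1 + 1) = r / 2" using half[of "K1 + 1" r] K1(1) by simp
    finally have "\<delta> * (K1 + 1) \<le> r / 2" .
    then show ?thesis using \<delta> by (simp add: algebra_simps)
  qed
  have \<delta>2: "K2 * (K1 * \<delta>) * K1 \<le> 1 / 2"
  proof -
    let ?k = "K2 * K1 * K1"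
    have k: "?k \<ge> 0" using K1 K2 by simp
    have "\<delta> * (?k + 1) \<le> 1 / (2 * (?k + 1)) * (?k + 1)" using k by (intro mult_right_mono) (auto simp: \<delta>_def)
    also have "1 / (2 * (?k + 1)) * (?k + 1) = 1 / 2" using half[of "?k + 1" 1] k by simp
    finally have "\<delta> * (?k + 1) \<le> 1 / 2" .
    then show ?thesis using \<delta> by (simp add: algebra_simps)
  qed
  \<comment> \<open>The first term is the Taylor remainder near \<open>p\<close>. The second serves
    points at distance at least \<rho>, where |z - p| \<le> |z - p|^2 / \<rho>.\<close>
  define C where "C = K2 * K1 * K1 + 1 / \<rho>"
  have C: "C \<ge> 0" using K1 K2 \<rho> by (simp add: C_def)
  have \<psi>_der: "(\<psi> has_derivative ?D\<psi> v) (at v)" if "v \<in> cball c r" for v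
    using Cinfinity_on_has_derivative[OF chart(6)] that r(2) by blast
  have "\<exists>L (h :: 'b \<Rightarrow> 'a). local_graph L h (\<delta> / 2) (9 * C) M p" if p: "p \<in> M" "norm (p - q) < \<rho>" for p
  proof -
    have pq: "p \<in> cball q r1" using p(2) \<rho> \<rho>1 by (simp add: dist_norm norm_minus_commute)
    have pU: "p \<in> U" using pq r1 by blast
    define v\<^sub>0 where "v\<^sub>0 = \<phi> p"
    have v0W: "v\<^sub>0 \<in> W" "v\<^sub>0 \<in> V" using chart(9) p pU by (auto simp: v\<^sub>0_def)
    have near: "\<phi> z \<in> cball c (r / 2)" if "norm (z - q) < 2 * \<rho>" for z
    proof -
      have "z \<in> cball q r1" using that \<rho> \<rho>1 by (simp add: dist_norm norm_minus_commute)
      then have "norm (\<phi> z - \<phi> q) \<le> K1 * norm (z - q)" using r1 by (intro \<phi>_lip) auto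
      also have "\<dots> \<le> K1 * (2 * \<rho>)" using that K1 by (intro mult_left_mono) auto
      finally show ?thesis using \<rho>2 by (simp add: c_def dist_norm norm_minus_commute)
    qed
    have v0c: "v\<^sub>0 \<in> cball c (r / 2)" unfolding v\<^sub>0_def using p(2) \<rho> by (intro near) auto
    define A where "A = ?D\<psi> v\<^sub>0"
    define B where "B = ?D\<phi> p"
    have v0r: "v\<^sub>0 \<in> cball c r" using v0c r by auto
    have derA: "(\<psi> has_derivative A) (at v\<^sub>0)" unfolding A_def by (rule \<psi>_der[OF v0r])
    have derB: "(\<phi> has_derivative B) (at p)" unfolding B_def by (rule Cinfinity_on_has_derivative[OF chart(5) pU])
    have linA: "linear A" and linB: "linear B"
      using derA derB has_derivative_bounded_linear bounded_linear.linear by blast+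
    have psi_v0: "\<psi> v\<^sub>0 = p" using inv(1)[OF pU] by (simp add: v\<^sub>0_def)
    have AB: "A (B x) = x" for x
    proof -
      have "((\<lambda>x. \<psi> (\<phi> x)) has_derivative (\<lambda>x. A (B x))) (at p)"
        using derA derB unfolding v\<^sub>0_def by (rule has_derivative_compose[rotated])
      then have "((\<lambda>x. x) has_derivative (\<lambda>x. A (B x))) (at p)"
        by (rule has_derivative_transform_within_open[OF _ chart(1) pU]) (rule inv(1))
      then have "(\<lambda>x. A (B x)) = (\<lambda>x. x)" using has_derivative_ident by (rule has_derivative_unique)
      then show ?thesis by metis
    qed
    have BA: "B (A x) = x" for x
    proof -
      have "((\<lambda>x. \<phi> (\<psi> x)) has_derivative (\<lambda>x. B (A x))) (at v\<^sub>0)"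
        using derA derB unfolding psi_v0[symmetric] by (rule has_derivative_compose)
      then have "((\<lambda>x. x) has_derivative (\<lambda>x. B (A x))) (at v\<^sub>0)"
        by (rule has_derivative_transform_within_open[OF _ chart(3) v0W(2)]) (rule inv(2))
      then have "(\<lambda>x. B (A x)) = (\<lambda>x. x)" using has_derivative_ident by (rule has_derivative_unique)
      then show ?thesis by metis
    qed
    have Bn: "norm (B x) \<le> K1 * norm x" for x unfolding B_def by (rule K1(2)[OF pq])
    have "inj_on A (span W)" by (rule inj_on_inverseI[of _ B]) (rule BA)
    then have dimT: "dim (A ` W) = DIM('b)" using dim_image_eq[OF linA] chart(8) by simp
    have subT: "subspace (A ` W)" using linA chart(7) by (rule linear_subspace_image)
    obtain L :: "'b \<Rightarrow> 'a" where L: "linear L" "range L = A ` W" "\<And>y. norm (L y) = norm y"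
    proof (rule isometries_subspaces[OF subspace_UNIV[where 'a='b] subT])
      show "dim (UNIV :: 'b set) = dim (A ` W)" by (simp add: dimT)
      fix f :: "'b \<Rightarrow> 'a"
      assume f: "linear f" "range f = A ` W" "\<And>x. x \<in> UNIV \<Longrightarrow> norm (f x) = norm x"
      show thesis using f(3) by (intro that[OF f(1,2)]) simp
    qed
    have BLW: "B (L y) \<in> W" for y
    proof -
      have "L y \<in> A ` W" using L(2) by blast
      then show ?thesis by (auto simp: BA)
    qed
    have psi_lin: "norm (\<psi> x - \<psi> x' - A (x - x')) \<le> K2 * t * norm (x - x')"
      if "x \<in> cball v\<^sub>0 t" "x' \<in> cball v\<^sub>0 t" "t \<ge> 0" "cball v\<^sub>0 t \<subseteq> cball c r" for x x' t
      unfolding A_def by (rule has_derivative_linearization_bound[OF \<psi>_der that(4) K2(3) K2(1) that(3,1,2)])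
    have sub2: "cball v\<^sub>0 (r / 2) \<subseteq> cball c r"
    proof
      fix x assume "x \<in> cball v\<^sub>0 (r / 2)"
      then show "x \<in> cball c r" using v0c dist_triangle[of c x v\<^sub>0] by simp
    qed
    \<comment> \<open>As \<open>A\<close> inverts \<open>B\<close>, the derivative of
      \<open>G\<close> at 0 is \<open>L\<close>, as required for a parametrisation over the tangent
      space.\<close>
    define G where "G y = \<psi> (v\<^sub>0 + B (L y))" for y
    have Gin: "v\<^sub>0 + B (L y) \<in> cball v\<^sub>0 (K1 * \<delta>)" if "norm y \<le> \<delta>" for y
    proof -
      have "norm (B (L y)) \<le> K1 * norm y" using Bn[of "L y"] by (simp add: L(3))
      also have "\<dots> \<le> K1 * \<delta>" using that K1 by (intro mult_left_mono) auto
      finally show ?thesis by (simp add: dist_norm)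
    qed
    have sub3: "cball v\<^sub>0 (K1 * \<delta>) \<subseteq> cball c r" using sub2 \<delta>1 subset_cball[of "K1 * \<delta>" "r / 2" v\<^sub>0] by blast
    have GM: "G y \<in> M" if "norm y \<le> \<delta>" for y
    proof -
      have "v\<^sub>0 + B (L y) \<in> V" using Gin[OF that] sub3 r(2) by blast
      moreover have "v\<^sub>0 + B (L y) \<in> W" using v0W(1) BLW chart(7) by (simp add: subspace_add)
      ultimately obtain m where "m \<in> U" "m \<in> M" "v\<^sub>0 + B (L y) = \<phi> m" using chart(9) by blast
      then show ?thesis using inv(1) by (simp add: G_def)
    qed
    have G0: "G 0 = p" by (simp add: G_def linear_0[OF L(1)] linear_0[OF linB] psi_v0)
    have lip: "norm (G y - G y' - L (y - y')) \<le> norm (y - y') / 2" if "norm y \<le> \<delta>" "norm y' \<le> \<delta>" for y y'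
    proof -
      have dif: "(v\<^sub>0 + B (L y)) - (v\<^sub>0 + B (L y')) = B (L (y - y'))" by (simp add: linear_diff[OF L(1)] linear_diff[OF linB])
      have "norm (G y - G y' - L (y - y')) \<le> K2 * (K1 * \<delta>) * norm (B (L (y - y')))"
        using psi_lin[OF Gin[OF that(1)] Gin[OF that(2)] _ sub3] K1 \<delta> unfolding dif AB by (simp add: G_def)
      also have "\<dots> \<le> K2 * (K1 * \<delta>) * (K1 * norm (y - y'))"
        using Bn[of "L (y - y')"] K1 K2 \<delta> by (intro mult_left_mono) (auto simp: L(3))
      also have "\<dots> = (K2 * (K1 * \<delta>) * K1) * norm (y - y')" by simp
      also have "\<dots> \<le> 1 / 2 * norm (y - y')" using \<delta>2 by (intro mult_right_mono) auto
      finally show ?thesis by simp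
    qed
    have quad: "norm ((z - p) - L (adjoint L (z - p))) \<le> C * (norm (z - p))\<^sup>2" if z: "z \<in> M" for z
    proof (cases "norm (z - p) < \<rho>")
      case True
      then have zq: "norm (z - q) < 2 * \<rho>" using p(2) norm_triangle_ineq[of "z - p" "p - q"] by simp
      then have zb: "z \<in> cball q r1" using \<rho> \<rho>1 by (simp add: dist_norm norm_minus_commute)
      then have zU: "z \<in> U" using r1 by blast
      define v where "v = \<phi> z"
      have vW: "v \<in> W" using chart(9) z zU by (auto simp: v_def)
      have psi_v: "\<psi> v = z" using inv(1)[OF zU] by (simp add: v_def)
      \<comment> \<open>Both chart images lie in \<open>W\<close>, so the linear part of z - p is
        tangential. By minimality, the projection leaves no more than the Taylor remainder.\<close>
      have "A (v - v\<^sub>0) \<in> range L" unfolding L(2) using vW v0W chart(7) by (auto intro: subspace_diff)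
      then obtain u where u: "A (v - v\<^sub>0) = L u" by blast
      have vd: "norm (v - v\<^sub>0) \<le> K1 * norm (z - p)" unfolding v_def v\<^sub>0_def by (rule \<phi>_lip[OF zb pq])
      have "norm (v - v\<^sub>0) \<le> r / 2"
      proof -
        have "K1 * norm (z - p) \<le> K1 * \<rho>" using True K1 by (intro mult_left_mono) auto
        moreover have "K1 * \<rho> \<ge> 0" using K1 \<rho> by simp
        ultimately show ?thesis using vd \<rho>2 by simp
      qed
      then have sub: "cball v\<^sub>0 (norm (v - v\<^sub>0)) \<subseteq> cball c r" using sub2 subset_cball[of "norm (v - v\<^sub>0)" "r / 2" v\<^sub>0] by blast
      have "norm ((z - p) - L (adjoint L (z - p))) \<le> norm ((z - p) - L u)"
        by (rule isometric_linear_adjoint(4)[OF L(1,3)])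
      also have "\<dots> \<le> K2 * norm (v - v\<^sub>0) * norm (v - v\<^sub>0)"
        using psi_lin[of v "norm (v - v\<^sub>0)" v\<^sub>0] sub by (simp add: psi_v psi_v0 u dist_norm norm_minus_commute)
      also have "\<dots> \<le> K2 * (K1 * norm (z - p)) * (K1 * norm (z - p))"
        using vd K1 K2 by (intro mult_mono) auto
      also have "\<dots> = K2 * K1 * K1 * (norm (z - p))\<^sup>2" by (simp add: power2_eq_square)
      also have "\<dots> \<le> C * (norm (z - p))\<^sup>2" using \<rho> by (intro mult_right_mono) (auto simp: C_def)
      finally show ?thesis .
    next
      case False
      have "norm ((z - p) - L (adjoint L (z - p))) \<le> norm (z - p)"
        using isometric_linear_adjoint(4)[OF L(1,3), of "z - p" 0] by (simp add: linear_0[OF L(1)])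
      also have "\<dots> * 1 \<le> norm (z - p) * (norm (z - p) / \<rho>)" using False \<rho> by (intro mult_left_mono) auto
      then have "norm (z - p) \<le> 1 / \<rho> * (norm (z - p))\<^sup>2" by (simp add: power2_eq_square)
      also have "\<dots> \<le> C * (norm (z - p))\<^sup>2" using K1 K2 by (intro mult_right_mono) (auto simp: C_def)
      finally show ?thesis .
    qed
    show ?thesis
      using local_graph_of_parametrization[OF L(1,3) \<delta> C GM G0 lip quad] by blast
  qed
  then show ?thesis using that[of \<rho> "\<delta> / 2" "9 * C"] \<rho> \<delta> by simp
qed

text \<open>The chart image of \<open>M\<close> contains a segment in a nonzero direction of
  \<open>W\<close>, and l \<ge> 1 provides such a direction.\<close>

lemma smooth_submanifold_infinite:
  fixes M :: "'a::euclidean_space set"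
  assumes M: "smooth_submanifold l M" "M \<noteq> {}" and l: "l \<ge> 1"
  shows "infinite M"
proof
  assume fin: "finite M"
  obtain q where q: "q \<in> M" using M by blast
  obtain U V \<phi> \<psi> W where chart: "q \<in> U" "open (V::'a set)" "homeomorphism U V \<phi> \<psi>"
      "subspace W" "dim W = l" "\<phi> ` (U \<inter> M) = V \<inter> W"
    using bspec[OF M(1)[unfolded smooth_submanifold_def] q] by (elim exE conjE) (rule that)
  have fin: "finite (V \<inter> W)" using fin chart(6) by (metis finite_Int finite_imageI)
  have c: "\<phi> q \<in> V \<inter> W" using chart(1,6) q by blast
  then obtain r where r: "r > 0" "ball (\<phi> q) r \<subseteq> V" using chart(2) openE by blast
  have "\<not> W \<subseteq> {0}" using chart(5) l by (metis dim_eq_0 not_one_le_zero)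
  then obtain w where w: "w \<in> W" "w \<noteq> 0" by blast
  let ?f = "\<lambda>t. \<phi> q + t *\<^sub>R w"
  have "?f ` {0<..<r / norm w} \<subseteq> V \<inter> W"
  proof clarify
    fix t assume t: "t \<in> {0<..<r / norm w}"
    then have "norm (t *\<^sub>R w) < r" using w by (simp add: field_simps)
    then have "?f t \<in> ball (\<phi> q) r" by (simp add: dist_norm)
    moreover have "?f t \<in> W" using c w chart(4) by (simp add: subspace_add subspace_scale)
    ultimately show "?f t \<in> V \<inter> W" using r by blast
  qed
  then have "finite (?f ` {0<..<r / norm w})" using fin finite_subset by blast
  moreover have "inj_on ?f {0<..<r / norm w}" using w by (auto simp: inj_on_def)
  ultimately have "finite {0<..<r / norm w}" by (rule finite_imageD)
  then show False using r w by (simp add: infinite_Ioo)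
qed

text \<open>A finite subcover by the balls on which the graph constants are uniform yields one
  radius, the minimum, and one curvature bound, the maximum, for all of \<open>M\<close>.\<close>

lemma separated_on_smooth_submanifold:
  fixes M :: "'a::euclidean_space set"
  assumes M: "compact M" "smooth_submanifold DIM('b::euclidean_space) M"
    and s: "0 < s" "s < real DIM('b)" "real DIM('b) - s < 2"
  shows "optimal_configurations_separated s M M (real DIM('b))"
proof (cases "M = {}")
  case True
  then show ?thesis by (intro optimal_configurations_separated_empty) auto
next
  case False
  have inf: "infinite M" by (rule smooth_submanifold_infinite[OF M(2) False]) (simp add: Suc_leI)
  have "\<exists>\<rho> \<delta> C. \<rho> > 0 \<and> \<delta> > 0 \<and> (\<forall>p. p \<in> M \<longrightarrow> norm (p - q) < \<rho> \<longrightarrow> (\<exists>L (h :: 'b \<Rightarrow> 'a). local_graph L h \<delta> C M p))"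
    if "q \<in> M" for q
    by (rule smooth_submanifold_local_graph_near[OF M(2) that]) blast
  then obtain \<rho> \<delta> C where loc: "\<And>q. q \<in> M \<Longrightarrow> \<rho> q > 0" "\<And>q. q \<in> M \<Longrightarrow> \<delta> q > 0"
    "\<And>q p. q \<in> M \<Longrightarrow> p \<in> M \<Longrightarrow> norm (p - q) < \<rho> q \<Longrightarrow> \<exists>L (h :: 'b \<Rightarrow> 'a). local_graph L h (\<delta> q) (C q) M p"
    by metis
  have "M \<subseteq> (\<Union>q\<in>M. ball q (\<rho> q))" using loc(1) by auto
  then obtain F where F: "F \<subseteq> M" "finite F" "M \<subseteq> (\<Union>q\<in>F. ball q (\<rho> q))"
    using compactE_image[OF M(1), of M "\<lambda>q. ball q (\<rho> q)"] by auto
  have Fne: "F \<noteq> {}" using F(3) False by auto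
  define \<delta>0 where "\<delta>0 = Min (\<delta> ` F)"
  define C0 where "C0 = Max (C ` F)"
  have \<delta>0: "\<delta>0 > 0" using F Fne loc(2) by (auto simp: \<delta>0_def)
  show ?thesis
  proof (rule separated_if_local_graphs[OF s compact_imp_closed[OF M(1)] inf \<delta>0])
    fix p assume p: "p \<in> M"
    then obtain q where q: "q \<in> F" "p \<in> ball q (\<rho> q)" using F(3) by blast
    then have "norm (p - q) < \<rho> q" by (simp add: dist_norm norm_minus_commute)
    then obtain L and h :: "'b \<Rightarrow> 'a" where "local_graph L h (\<delta> q) (C q) M p" using loc(3) q F p by blast
    then have "local_graph L h \<delta>0 C0 M p"
      by (rule local_graph_shrink) (use q F in \<open>auto simp: \<delta>0_def C0_def\<close>)
    then show "\<exists>L (h :: 'b \<Rightarrow> 'a). local_graph L h \<delta>0 C0 M p" by blast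
  qed
qed

section \<open>The equilibrium potential of the ball\<close>

text \<open>For 0 < \<beta> < 1 this is the Beta integral with value \<pi> / sin (\<pi> \<beta>),
  kept symbolic.\<close>

definition chord_const :: "real \<Rightarrow> ennreal" where
  "chord_const \<beta> = (\<integral>\<^sup>+m. ennreal (m powr (- \<beta>) / (1 + m)) * indicator {0<..} m \<partial>lborel)"

lemma chord_const_finite:
  assumes "0 < \<beta>" "\<beta> < 1"
  shows "chord_const \<beta> < \<infinity>"
proof -
  have "chord_const \<beta> \<le> (\<integral>\<^sup>+m. ennreal (m powr ((1 - \<beta>) - 1)) * indicator {0<..1} m + ennreal (m powr (- \<beta> - 1)) * indicator {1..} m \<partial>lborel)"
    unfolding chord_const_def
  proof (intro nn_integral_mono)
    fix m :: real
    have "m powr (- \<beta>) / (1 + m) \<le> m powr (- \<beta>)" if "m > 0"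
      using that by (simp add: field_simps)
    moreover have "m powr (- \<beta>) / (1 + m) \<le> m powr (- \<beta> - 1)" if "m > 0"
      using that by (simp add: powr_diff field_simps)
    ultimately show "ennreal (m powr (- \<beta>) / (1 + m)) * indicator {0<..} m
       \<le> ennreal (m powr ((1 - \<beta>) - 1)) * indicator {0<..1} m + ennreal (m powr (- \<beta> - 1)) * indicator {1..} m"
    proof -
      consider "m \<le> 0" | "0 < m" "m \<le> 1" | "m > 1" by linarith
      then show ?thesis
      proof cases
        case 2
        then have "m powr (- \<beta>) / (1 + m) \<le> m powr ((1 - \<beta>) - 1)" using \<open>m > 0 \<Longrightarrow> m powr (- \<beta>) / (1 + m) \<le> m powr (- \<beta>)\<close> by simp
        then have "ennreal (m powr (- \<beta>) / (1 + m)) \<le> ennreal (m powr ((1 - \<beta>) - 1))" by (rule ennreal_leI)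
        with 2 show ?thesis by (simp add: add_increasing2)
      next
        case 3
        then have "m powr (- \<beta>) / (1 + m) \<le> m powr (- \<beta> - 1)" using \<open>m > 0 \<Longrightarrow> m powr (- \<beta>) / (1 + m) \<le> m powr (- \<beta> - 1)\<close> by simp
        with 3 show ?thesis by (simp add: ennreal_leI)
      qed simp
    qed
  qed
  also have "\<dots> = ennreal (1 powr (1 - \<beta>) / (1 - \<beta>)) + ennreal (1 powr (- \<beta>) / \<beta>)"
    using assms by (subst nn_integral_add, measurable, subst nn_integral_powr_from_0, simp, simp, subst nn_integral_powr_to_inf) auto
  also have "\<dots> < \<infinity>" by simp
  finally show ?thesis .
qed

text \<open>The variable m = (b - t) / t removes the length \<open>b\<close>. This is a chord seen
  from one of its end points, the limit a = 0 of the two-sided case.\<close>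

lemma nn_integral_chord_one_sided:
  assumes \<beta>: "0 < \<beta>" "\<beta> < 1" and b: "b > 0"
  shows "(\<integral>\<^sup>+t. ennreal ((b - t) powr (- \<beta>) * t powr (\<beta> - 1)) * indicator {0<..<b} t \<partial>lborel) = chord_const \<beta>"
proof -
  define g :: "real \<Rightarrow> real" where "g m = b / (1 + m)" for m
  define g' :: "real \<Rightarrow> real" where "g' m = - b / (1 + m)\<^sup>2" for m
  let ?f = "\<lambda>t. (b - t) powr (- \<beta>) * t powr (\<beta> - 1)"
  have img: "g ` {0<..} = {0<..<b}"
  proof (intro equalityI subsetI)
    fix t assume t: "t \<in> {0<..<b}"
    then have "b / t - 1 \<in> {0<..}" "t = g (b / t - 1)" using b by (auto simp: g_def field_simps)
    then show "t \<in> g ` {0<..}" by blast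
  qed (use b in \<open>auto simp: g_def field_simps\<close>)
  have "(\<integral>\<^sup>+t. ennreal (?f t) * indicator {0<..<b} t \<partial>lborel)
     = (\<integral>\<^sup>+m. ennreal (\<bar>g' m\<bar> * ?f (g m)) * indicator {0<..} m \<partial>lborel)"
  proof (rule nn_integral_change_of_variables_real[OF _ img])
    show "(g has_real_derivative g' x) (at x)" if "x \<in> {0<..}" for x
      unfolding g_def g'_def using that by (auto intro!: derivative_eq_intros simp: power2_eq_square)
    show "inj_on g {0<..}" using b by (auto simp: inj_on_def g_def field_simps)
    show "(\<lambda>x. \<bar>g' x\<bar> * ?f (g x) * indicat_real {0<..} x) \<in> borel_measurable borel"
      unfolding g_def g'_def by measurable
  qed auto
  also have "\<dots> = chord_const \<beta>"
    unfolding chord_const_def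
  proof (rule nn_integral_cong)
    fix m :: real
    have "\<bar>g' m\<bar> * ?f (g m) = m powr (- \<beta>) / (1 + m)" if m: "m > 0"
    proof -
      define c where "c = 1 + m"
      have c: "c > 0" using m by (simp add: c_def)
      have "b - g m = b * m / c" using c by (simp add: g_def c_def field_simps)
      then have "\<bar>g' m\<bar> * ?f (g m) = b / c\<^sup>2 * ((b * m / c) powr (- \<beta>) * (b / c) powr (\<beta> - 1))"
        using b by (simp add: g'_def g_def c_def)
      also have "(b * m / c) powr (- \<beta>) * (b / c) powr (\<beta> - 1) = m powr (- \<beta>) * ((b / c) powr (- \<beta>) * (b / c) powr (\<beta> - 1))"
        using b m c by (simp add: powr_mult[symmetric] mult.commute mult.assoc[symmetric])
      also have "(b / c) powr (- \<beta>) * (b / c) powr (\<beta> - 1) = c / b"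
        unfolding powr_add[symmetric] using b c by (simp add: powr_minus)
      finally show ?thesis using b c by (simp add: c_def[symmetric] power2_eq_square field_simps)
    qed
    then show "ennreal (\<bar>g' m\<bar> * ?f (g m)) * indicator {0<..} m = ennreal (m powr (- \<beta>) / (1 + m)) * indicator {0<..} m"
      by (simp add: indicator_def)
  qed
  finally show ?thesis .
qed

text \<open>In the variable v = 1 / t - B the product of the distances to the two ends becomes v (v
  + A + B) up to a factor. This is symmetric in \<open>A\<close> and \<open>B\<close>, so the two
  halves of a chord can be added.\<close>

lemma nn_integral_chord_half:
  assumes \<beta>: "0 < \<beta>" "\<beta> < 1" and A: "A > 0" and B: "B > 0"
  shows "(\<integral>\<^sup>+t. ennreal (((1 / B - t) * (t + 1 / A)) powr (- \<beta>) * t powr (2 * \<beta> - 1)) * indicator {0<..<1 / B} t \<partial>lborel)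
     = (\<integral>\<^sup>+v. ennreal ((A * B) powr \<beta> * (v * (v + A + B)) powr (- \<beta>) / (v + B)) * indicator {0<..} v \<partial>lborel)"
proof -
  define g :: "real \<Rightarrow> real" where "g v = 1 / (v + B)" for v
  define g' :: "real \<Rightarrow> real" where "g' v = - 1 / (v + B)\<^sup>2" for v
  let ?f = "\<lambda>t. ((1 / B - t) * (t + 1 / A)) powr (- \<beta>) * t powr (2 * \<beta> - 1)"
  have img: "g ` {0<..} = {0<..<1 / B}"
  proof (intro equalityI subsetI)
    fix t assume t: "t \<in> {0<..<1 / B}"
    then have "1 / t - B \<in> {0<..}" "t = g (1 / t - B)" using B by (auto simp: g_def field_simps)
    then show "t \<in> g ` {0<..}" by blast
  qed (use B in \<open>auto simp: g_def field_simps\<close>)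
  have "(\<integral>\<^sup>+t. ennreal (?f t) * indicator {0<..<1 / B} t \<partial>lborel)
     = (\<integral>\<^sup>+v. ennreal (\<bar>g' v\<bar> * ?f (g v)) * indicator {0<..} v \<partial>lborel)"
  proof (rule nn_integral_change_of_variables_real[OF _ img])
    show "(g has_real_derivative g' x) (at x)" if "x \<in> {0<..}" for x
      unfolding g_def g'_def using that B by (auto intro!: derivative_eq_intros simp: power2_eq_square)
    show "inj_on g {0<..}" using B by (auto simp: inj_on_def g_def field_simps)
    show "(\<lambda>x. \<bar>g' x\<bar> * ?f (g x) * indicat_real {0<..} x) \<in> borel_measurable borel"
      unfolding g_def g'_def by measurable
  qed auto
  also have "\<dots> = (\<integral>\<^sup>+v. ennreal ((A * B) powr \<beta> * (v * (v + A + B)) powr (- \<beta>) / (v + B)) * indicator {0<..} v \<partial>lborel)"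
  proof (rule nn_integral_cong)
    fix v :: real
    have "\<bar>g' v\<bar> * ?f (g v) = (A * B) powr \<beta> * (v * (v + A + B)) powr (- \<beta>) / (v + B)" if v: "v > 0"
    proof -
      define c where "c = v + B"
      have c: "c > 0" using v B by (simp add: c_def)
      define M where "M = v * (v + A + B)"
      have M: "M > 0" using v A B by (simp add: M_def)
      have gc: "g v = c powr (- 1)" using c by (simp add: g_def c_def powr_minus field_simps)
      have c2: "c powr (- 2) = 1 / (c * c)" using c by (simp add: powr_minus power2_eq_square field_simps)
      have "1 / B - g v = v / (B * c)" "g v + 1 / A = (v + A + B) / (A * c)"
        using c A B v by (simp_all add: g_def c_def field_simps)
      then have "(1 / B - g v) * (g v + 1 / A) = M / (A * B) * c powr (- 2)"
        unfolding c2 by (simp add: M_def)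
      then have "?f (g v) = (M / (A * B) * c powr (- 2)) powr (- \<beta>) * (c powr (- 1)) powr (2 * \<beta> - 1)"
        by (simp only: gc)
      also have "\<dots> = (M / (A * B)) powr (- \<beta>) * (c powr ((- 2) * (- \<beta>)) * c powr ((- 1) * (2 * \<beta> - 1)))"
        using A B M by (subst powr_mult) (simp_all only: powr_powr mult.assoc powr_ge_zero)
      also have "c powr ((- 2) * (- \<beta>)) * c powr ((- 1) * (2 * \<beta> - 1)) = c" using c by (simp add: powr_add[symmetric])
      also have "(M / (A * B)) powr (- \<beta>) = (A * B) powr \<beta> * M powr (- \<beta>)"
        using A B M by (simp add: powr_divide powr_minus field_simps)
      finally show ?thesis using c by (simp add: g'_def c_def[symmetric] M_def power2_eq_square)
    qed
    then show "ennreal (\<bar>g' v\<bar> * ?f (g v)) * indicator {0<..} v = ennreal ((A * B) powr \<beta> * (v * (v + A + B)) powr (- \<beta>) / (v + B)) * indicator {0<..} v"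
      by (simp add: indicator_def)
  qed
  finally show ?thesis .
qed

text \<open>In the coordinates \<open>v = 1 / t - 1 / b\<close> and \<open>v = 1 / t - 1 / a\<close> on the two halves of the chord, the integrands add up to
  a function of \<open>m = v * (v + 1 / a + 1 / b)\<close> times \<open>dm / dv\<close>.\<close>

lemma nn_integral_chord_two_sided:
  assumes \<beta>: "0 < \<beta>" "\<beta> < 1" and a: "a > 0" and b: "b > 0"
  shows "(\<integral>\<^sup>+t. ennreal (((b - t) * (t + a)) powr (- \<beta>) * t powr (2 * \<beta> - 1)) * indicator {0<..<b} t \<partial>lborel)
     + (\<integral>\<^sup>+t. ennreal (((a - t) * (t + b)) powr (- \<beta>) * t powr (2 * \<beta> - 1)) * indicator {0<..<a} t \<partial>lborel) = chord_const \<beta>"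
proof -
  define A where "A = 1 / a"
  define B where "B = 1 / b"
  have AB: "A > 0" "B > 0" "a = 1 / A" "b = 1 / B" using a b by (auto simp: A_def B_def)
  define g :: "real \<Rightarrow> real" where "g v = v * (v + A + B) / (A * B)" for v
  define g' :: "real \<Rightarrow> real" where "g' v = (2 * v + A + B) / (A * B)" for v
  let ?f = "\<lambda>m. m powr (- \<beta>) / (1 + m)"
  have gpos: "g v > 0" if "v > 0" for v using that AB by (simp add: g_def)
  have mono: "g v < g w" if "0 < v" "v < w" for v w
    unfolding g_def using that AB by (intro divide_strict_right_mono mult_strict_mono) auto
  have img: "g ` {0<..} = {0<..}"
  proof (intro equalityI subsetI)
    fix x :: real assume x: "x \<in> {0<..}"
    \<comment> \<open>(D - (A + B)) / 2 is the positive root of v (v + A + B) = A B x.\<close>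
    define D where "D = sqrt ((A + B)\<^sup>2 + 4 * (A * B * x))"
    have D2: "D\<^sup>2 = (A + B)\<^sup>2 + 4 * (A * B * x)" using AB x by (simp add: D_def)
    have "A + B < D" unfolding D_def using AB x by (intro real_less_rsqrt) auto
    then have "(D - (A + B)) / 2 \<in> {0<..}" by simp
    moreover have "g ((D - (A + B)) / 2) = (D\<^sup>2 - (A + B)\<^sup>2) / (4 * (A * B))"
      by (simp add: g_def power2_eq_square field_simps)
    then have "g ((D - (A + B)) / 2) = x" unfolding D2 using AB by simp
    ultimately show "x \<in> g ` {0<..}" by (metis image_eqI)
  qed (use gpos in auto)
  have "chord_const \<beta> = (\<integral>\<^sup>+v. ennreal (\<bar>g' v\<bar> * ?f (g v)) * indicator {0<..} v \<partial>lborel)"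
    unfolding chord_const_def
  proof (rule nn_integral_change_of_variables_real[OF _ img])
    show "(g has_real_derivative g' x) (at x)" if "x \<in> {0<..}" for x
      unfolding g_def g'_def using AB by (auto intro!: derivative_eq_intros simp: field_simps)
    show "inj_on g {0<..}"
      using mono by (intro linorder_inj_onI) (auto simp: less_imp_neq)
    show "(\<lambda>x. \<bar>g' x\<bar> * ?f (g x) * indicat_real {0<..} x) \<in> borel_measurable borel"
      unfolding g_def g'_def by measurable
  qed auto
  also have "\<dots> = (\<integral>\<^sup>+v. ennreal ((A * B) powr \<beta> * (v * (v + A + B)) powr (- \<beta>) / (v + B)) * indicator {0<..} v
      + ennreal ((B * A) powr \<beta> * (v * (v + B + A)) powr (- \<beta>) / (v + A)) * indicator {0<..} v \<partial>lborel)"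
  proof (rule nn_integral_cong)
    fix v :: real
    have "\<bar>g' v\<bar> * ?f (g v) = (A * B) powr \<beta> * (v * (v + A + B)) powr (- \<beta>) / (v + B) + (B * A) powr \<beta> * (v * (v + B + A)) powr (- \<beta>) / (v + A)"
      if v: "v > 0"
    proof -
      define M where "M = v * (v + A + B)"
      have M: "M > 0" using v AB by (simp add: M_def)
      \<comment> \<open>Hence 1 + g v = (v + A) (v + B) / (A B), and partial fractions split g' / (1
        + g) into the contributions of the two halves.\<close>
      have fac: "M + A * B = (v + A) * (v + B)" by (simp add: M_def algebra_simps)
      have "\<bar>g' v\<bar> * ?f (g v) = (2 * v + A + B) / (A * B) * ((M / (A * B)) powr (- \<beta>) / (1 + M / (A * B)))"
        using v AB by (simp add: g'_def g_def M_def)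
      also have "(M / (A * B)) powr (- \<beta>) = (A * B) powr \<beta> * M powr (- \<beta>)"
        using AB M by (simp add: powr_divide powr_minus field_simps)
      also have "(2 * v + A + B) / (A * B) * ((A * B) powr \<beta> * M powr (- \<beta>) / (1 + M / (A * B)))
          = (A * B) powr \<beta> * M powr (- \<beta>) * ((2 * v + A + B) / (M + A * B))"
      proof -
        have "k / Y * (E / (1 + M / Y)) = E * (k / (M + Y))" if "Y > 0" for k E Y :: real
          using that M by (simp add: field_simps)
        then show ?thesis using AB by simp
      qed
      also have "(2 * v + A + B) / (M + A * B) = 1 / (v + B) + 1 / (v + A)"
        unfolding fac using v AB by (simp add: field_simps)
      finally show ?thesis by (simp add: M_def algebra_simps)
    qed
    moreover have "(A * B) powr \<beta> * (v * (v + A + B)) powr (- \<beta>) / (v + B) \<ge> 0" "(B * A) powr \<beta> * (v * (v + B + A)) powr (- \<beta>) / (v + A) \<ge> 0"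
      if "v > 0" using that AB by auto
    ultimately show "ennreal (\<bar>g' v\<bar> * ?f (g v)) * indicator {0<..} v = ennreal ((A * B) powr \<beta> * (v * (v + A + B)) powr (- \<beta>) / (v + B)) * indicator {0<..} v
      + ennreal ((B * A) powr \<beta> * (v * (v + B + A)) powr (- \<beta>) / (v + A)) * indicator {0<..} v"
      by (cases "v > 0") (simp_all add: ennreal_plus)
  qed
  also have "\<dots> = (\<integral>\<^sup>+v. ennreal ((A * B) powr \<beta> * (v * (v + A + B)) powr (- \<beta>) / (v + B)) * indicator {0<..} v \<partial>lborel)
      + (\<integral>\<^sup>+v. ennreal ((B * A) powr \<beta> * (v * (v + B + A)) powr (- \<beta>) / (v + A)) * indicator {0<..} v \<partial>lborel)"
    by (rule nn_integral_add) measurable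
  also have "\<dots> = (\<integral>\<^sup>+t. ennreal (((b - t) * (t + a)) powr (- \<beta>) * t powr (2 * \<beta> - 1)) * indicator {0<..<b} t \<partial>lborel)
     + (\<integral>\<^sup>+t. ennreal (((a - t) * (t + b)) powr (- \<beta>) * t powr (2 * \<beta> - 1)) * indicator {0<..<a} t \<partial>lborel)"
    unfolding nn_integral_chord_half[OF \<beta> AB(1,2), symmetric] nn_integral_chord_half[OF \<beta> AB(2,1), symmetric] AB(3,4) ..
  finally show ?thesis ..
qed

text \<open>Measures how much of a chord integral is affected by a displacement of size
  \<open>x\<close>. On t \<le> b / 2 the factor (b - t)^(-\<beta>) is harmless, and the rest, split
  at t = x, is of order x^\<beta> on either side. For t > b / 2 one has min 1 (x / t) \<le> (x /
  t)^\<beta> \<le> (2 x / b)^\<beta>.\<close>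

lemma nn_integral_chord_truncated_le:
  assumes \<beta>: "0 < \<beta>" "\<beta> < 1"
  obtains K where "K \<ge> 0" "\<And>b x. b > 0 \<Longrightarrow> x > 0 \<Longrightarrow>
    (\<integral>\<^sup>+t. ennreal ((b - t) powr (- \<beta>) * t powr (\<beta> - 1) * min 1 (x / t)) * indicator {0<..<b} t \<partial>lborel) \<le> ennreal (K * (x / b) powr \<beta>)"
proof -
  obtain cc where cc: "cc \<ge> 0" "chord_const \<beta> = ennreal cc"
    using chord_const_finite[OF \<beta>] by (cases "chord_const \<beta>") auto
  define K where "K = 2 powr \<beta> * (1 / \<beta> + 1 / (1 - \<beta>)) + 2 powr \<beta> * cc"
  have "(\<integral>\<^sup>+t. ennreal ((b - t) powr (- \<beta>) * t powr (\<beta> - 1) * min 1 (x / t)) * indicator {0<..<b} t \<partial>lborel) \<le> ennreal (K * (x / b) powr \<beta>)"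
    if b: "b > 0" and x: "x > 0" for b x :: real
  proof -
    let ?c = "(b / 2) powr (- \<beta>)" and ?e = "(2 * x / b) powr \<beta>"
    have pt: "ennreal ((b - t) powr (- \<beta>) * t powr (\<beta> - 1) * min 1 (x / t)) * indicator {0<..<b} t
      \<le> ennreal ?c * (ennreal (t powr (\<beta> - 1)) * indicator {0<..x} t + ennreal x * (ennreal (t powr (- (1 - \<beta>) - 1)) * indicator {x..} t))
        + ennreal ?e * (ennreal ((b - t) powr (- \<beta>) * t powr (\<beta> - 1)) * indicator {0<..<b} t)" for t
    proof (cases "t \<in> {0<..<b}")
      case t: True
      show ?thesis
      proof (cases "t \<le> b / 2")
        case True
        have c: "(b - t) powr (- \<beta>) \<le> ?c" using True b \<beta> by (intro powr_mono2') auto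
        have "ennreal ((b - t) powr (- \<beta>) * t powr (\<beta> - 1) * min 1 (x / t)) \<le> ennreal (?c * (t powr (\<beta> - 1) * min 1 (x / t)))"
          unfolding mult.assoc using c t x by (intro ennreal_leI mult_right_mono) auto
        also have "\<dots> = ennreal ?c * ennreal (t powr (\<beta> - 1) * min 1 (x / t))"
          using t x by (simp add: ennreal_mult)
        also have "ennreal (t powr (\<beta> - 1) * min 1 (x / t)) \<le> ennreal (t powr (\<beta> - 1)) * indicator {0<..x} t + ennreal x * (ennreal (t powr (- (1 - \<beta>) - 1)) * indicator {x..} t)"
        proof (cases "t \<le> x")
          case True
          then have "min 1 (x / t) = 1" using t by (simp add: min_def field_simps)
          then show ?thesis using True t by (simp add: add_increasing2)
        next
          case False
          then have "t powr (\<beta> - 1) * min 1 (x / t) = x * t powr (- (1 - \<beta>) - 1)"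
            using t x by (simp add: min_def field_simps powr_diff power2_eq_square)
          then show ?thesis using False t x by (simp add: ennreal_mult)
        qed
        finally show ?thesis using t by (simp add: mult_left_mono add_increasing2)
      next
        case False
        have "min 1 (x / t) \<le> (x / t) powr \<beta>"
        proof (cases "x \<le> t")
          case True
          then have "(x / t) powr 1 \<le> (x / t) powr \<beta>" using x t \<beta> by (intro powr_mono') auto
          then have "x / t \<le> (x / t) powr \<beta>" using x t by simp
          then show ?thesis by (rule min.coboundedI2)
        next
          case False
          then show ?thesis using x t \<beta> by (simp add: ge_one_powr_ge_zero min.coboundedI1)
        qed
        also have "\<dots> \<le> ?e"
        proof (intro powr_mono2)
          show "x / t \<le> 2 * x / b" using False x b t by (simp add: field_simps)
        qed (use x t \<beta> in auto)
        finally have "((b - t) powr (- \<beta>) * t powr (\<beta> - 1)) * min 1 (x / t) \<le> ((b - t) powr (- \<beta>) * t powr (\<beta> - 1)) * ?e"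
          by (intro mult_left_mono) auto
        then have "ennreal ((b - t) powr (- \<beta>) * t powr (\<beta> - 1) * min 1 (x / t)) \<le> ennreal ?e * ennreal ((b - t) powr (- \<beta>) * t powr (\<beta> - 1))"
          by (simp add: ennreal_mult[symmetric] ennreal_leI mult.commute)
        then show ?thesis using t by (simp add: add_increasing)
      qed
    qed simp
    have "(\<integral>\<^sup>+t. ennreal ((b - t) powr (- \<beta>) * t powr (\<beta> - 1) * min 1 (x / t)) * indicator {0<..<b} t \<partial>lborel)
      \<le> (\<integral>\<^sup>+t. ennreal ?c * (ennreal (t powr (\<beta> - 1)) * indicator {0<..x} t + ennreal x * (ennreal (t powr (- (1 - \<beta>) - 1)) * indicator {x..} t))
        + ennreal ?e * (ennreal ((b - t) powr (- \<beta>) * t powr (\<beta> - 1)) * indicator {0<..<b} t) \<partial>lborel)"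
      by (intro nn_integral_mono pt)
    also have "\<dots> = ennreal ?c * ((\<integral>\<^sup>+t. ennreal (t powr (\<beta> - 1)) * indicator {0<..x} t \<partial>lborel) + ennreal x * (\<integral>\<^sup>+t. ennreal (t powr (- (1 - \<beta>) - 1)) * indicator {x..} t \<partial>lborel))
        + ennreal ?e * (\<integral>\<^sup>+t. ennreal ((b - t) powr (- \<beta>) * t powr (\<beta> - 1)) * indicator {0<..<b} t \<partial>lborel)"
      by (subst nn_integral_add, measurable, subst nn_integral_cmult, measurable, subst nn_integral_add, measurable,
        subst nn_integral_cmult, measurable, subst nn_integral_cmult, measurable)
    also have "\<dots> = ennreal ?c * (ennreal (x powr \<beta> / \<beta>) + ennreal x * ennreal (x powr (- (1 - \<beta>)) / (1 - \<beta>))) + ennreal ?e * ennreal cc"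
      unfolding nn_integral_chord_one_sided[OF \<beta> b] cc(2) using \<beta> x
      by (subst nn_integral_powr_from_0, simp, simp, subst nn_integral_powr_to_inf) auto
    also have "\<dots> = ennreal (?c * (x powr \<beta> / \<beta> + x * (x powr (- (1 - \<beta>)) / (1 - \<beta>))) + ?e * cc)"
      using \<beta> x cc(1) by (simp add: ennreal_mult[symmetric] ennreal_plus[symmetric] del: ennreal_plus)
    also have "x * (x powr (- (1 - \<beta>)) / (1 - \<beta>)) = x powr \<beta> / (1 - \<beta>)"
      using x by (simp add: powr_diff)
    also have "?c = 2 powr \<beta> / b powr \<beta>" using b by (simp add: powr_divide powr_minus)
    also have "?e = 2 powr \<beta> * (x / b) powr \<beta>" using x b by (simp add: powr_mult powr_divide)
    also have "2 powr \<beta> / b powr \<beta> * (x powr \<beta> / \<beta> + x powr \<beta> / (1 - \<beta>)) + 2 powr \<beta> * (x / b) powr \<beta> * cc = K * (x / b) powr \<beta>"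
      using x b by (simp add: K_def powr_divide algebra_simps)
    finally show ?thesis .
  qed
  moreover have "K \<ge> 0" using \<beta> cc by (simp add: K_def)
  ultimately show ?thesis using that by blast
qed

text \<open>With \<beta> = (d - s)/2 this is the unnormalised equilibrium density of the unit ball.
  As 0 powr r = 0, the truncation makes it vanish on the sphere and outside.\<close>

definition ball_weight :: "real \<Rightarrow> 'a::euclidean_space \<Rightarrow> real" where
  "ball_weight \<beta> y = max 0 (1 - (norm y)\<^sup>2) powr (- \<beta>)"

lemma ball_weight_measurable [measurable]: "ball_weight \<beta> \<in> borel_measurable borel"
  unfolding ball_weight_def by measurable

lemma ball_weight_nonneg [simp]: "ball_weight \<beta> y \<ge> 0"
  by (simp add: ball_weight_def)

lemma ball_weight_outside:
  assumes "norm y \<ge> 1"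
  shows "ball_weight \<beta> y = 0"
proof -
  have "(norm y)\<^sup>2 \<ge> 1" using assms by simp
  then have "max 0 (1 - (norm y)\<^sup>2) = 0" by linarith
  then show ?thesis by (simp add: ball_weight_def)
qed

definition ball_potential :: "real \<Rightarrow> 'a::euclidean_space \<Rightarrow> ennreal" where
  "ball_potential s z = (\<integral>\<^sup>+y. ennreal (ball_weight ((real DIM('a) - s) / 2) y * norm (y - z) powr (- s)) \<partial>lborel)"

text \<open>The part of the potential at \<open>z\<close> collected along the ray in direction
  \<open>u\<close>: the exponent 2 \<beta> - 1 = d - s - 1 joins the kernel t^(-s) with the polar
  Jacobian t^(d-1).\<close>

definition chord_integral :: "real \<Rightarrow> 'a::euclidean_space \<Rightarrow> 'a \<Rightarrow> ennreal" where
  "chord_integral \<beta> z u = (\<integral>\<^sup>+t. ennreal (ball_weight \<beta> (z + t *\<^sub>R u) * t powr (2 * \<beta> - 1)) * indicator {0<..} t \<partial>lborel)"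

lemma chord_integral_measurable [measurable]: "chord_integral \<beta> z \<in> borel_measurable borel"
  unfolding chord_integral_def by measurable

lemma norm_add_scaleR_sq: "(norm (z + t *\<^sub>R u))\<^sup>2 = (norm z)\<^sup>2 + 2 * t * (z \<bullet> u) + t\<^sup>2 * (norm u)\<^sup>2"
  for z u :: "'a::real_inner"
  unfolding power2_norm_eq_inner by (simp add: inner_add inner_commute algebra_simps) (simp add: power2_eq_square)

text \<open>Opposite rays form a full chord, on which 1 - |z + t u|^2 = |u|^2 (b - t) (t + a). The
  two-sided chord integral does not depend on \<open>a\<close> and \<open>b\<close>, which is why
  the potential is constant inside the ball.\<close>

lemma chord_integral_interior:
  fixes z u :: "'a::euclidean_space"
  assumes \<beta>: "0 < \<beta>" "\<beta> < 1" and z: "norm z < 1" and u: "u \<noteq> 0"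
  shows "chord_integral \<beta> z u + chord_integral \<beta> z (- u) = ennreal (norm u powr (- 2 * \<beta>)) * chord_const \<beta>"
proof -
  let ?n = "norm u"
  have n: "?n > 0" using u by simp
  define c where "c = (z \<bullet> u) / ?n\<^sup>2"
  \<comment> \<open>The line leaves the ball at the parameters - c - D and - c + D, that is, at - a
    and b.\<close>
  define D where "D = sqrt (c\<^sup>2 + (1 - (norm z)\<^sup>2) / ?n\<^sup>2)"
  have z2: "1 - (norm z)\<^sup>2 > 0" using z by (simp add: abs_square_less_1)
  have D2: "D\<^sup>2 = c\<^sup>2 + (1 - (norm z)\<^sup>2) / ?n\<^sup>2" using z2 by (simp add: D_def)
  have "\<bar>c\<bar> < D" unfolding D_def using z2 n by (intro real_less_rsqrt) simp
  then have ab: "D - c > 0" "D + c > 0" by auto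
  define a where "a = D + c"
  define b where "b = D - c"
  have ab: "a > 0" "b > 0" using ab by (auto simp: a_def b_def)
  have chord: "1 - (norm (z + t *\<^sub>R u))\<^sup>2 = ?n\<^sup>2 * ((b - t) * (t + a))" for t
  proof -
    have "(b - t) * (t + a) = D\<^sup>2 - c\<^sup>2 - 2 * c * t - t\<^sup>2"
      by (simp add: a_def b_def power2_eq_square algebra_simps)
    also have "\<dots> = (1 - (norm z)\<^sup>2) / ?n\<^sup>2 - 2 * c * t - t\<^sup>2" unfolding D2 by simp
    finally show ?thesis using n unfolding norm_add_scaleR_sq by (simp add: c_def field_simps)
  qed
  have half: "chord_integral \<beta> z v = ennreal (?n powr (- 2 * \<beta>)) *
      (\<integral>\<^sup>+t. ennreal (((b' - t) * (t + a')) powr (- \<beta>) * t powr (2 * \<beta> - 1)) * indicator {0<..<b'} t \<partial>lborel)"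
    if ch: "\<And>t. 1 - (norm (z + t *\<^sub>R v))\<^sup>2 = ?n\<^sup>2 * ((b' - t) * (t + a'))" and a'b': "a' > 0" "b' > 0" for v a' b'
  proof -
    have "ennreal (ball_weight \<beta> (z + t *\<^sub>R v) * t powr (2 * \<beta> - 1)) * indicator {0<..} t
      = ennreal (?n powr (- 2 * \<beta>)) * (ennreal (((b' - t) * (t + a')) powr (- \<beta>) * t powr (2 * \<beta> - 1)) * indicator {0<..<b'} t)" for t
    proof (cases "t \<in> {0<..<b'}")
      case True
      then have pos: "(b' - t) * (t + a') > 0" using a'b' by auto
      have "?n\<^sup>2 = ?n powr 2" using n by simp
      then have n2: "(?n\<^sup>2) powr (- \<beta>) = ?n powr (- 2 * \<beta>)" by (simp only: powr_powr) simp
      have "ball_weight \<beta> (z + t *\<^sub>R v) = (?n\<^sup>2 * ((b' - t) * (t + a'))) powr (- \<beta>)"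
        unfolding ball_weight_def ch using pos by (simp add: max_def not_less)
      also have "\<dots> = ?n powr (- 2 * \<beta>) * ((b' - t) * (t + a')) powr (- \<beta>)"
        using pos by (subst powr_mult) (auto simp: n2)
      finally show ?thesis using True by (simp add: ennreal_mult mult.assoc)
    next
      case False
      have "ball_weight \<beta> (z + t *\<^sub>R v) = 0" if "t > 0"
      proof -
        have "(b' - t) * (t + a') \<le> 0" using False that a'b' by (intro mult_nonpos_nonneg) auto
        then have "1 - (norm (z + t *\<^sub>R v))\<^sup>2 \<le> 0" unfolding ch by (simp add: mult_nonneg_nonpos)
        then show ?thesis by (simp add: ball_weight_def max_def)
      qed
      then show ?thesis using False by (cases "t > 0") auto
    qed
    then show ?thesis unfolding chord_integral_def by (subst nn_integral_cmult[symmetric]) auto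
  qed
  have "chord_integral \<beta> z u + chord_integral \<beta> z (- u) = ennreal (?n powr (- 2 * \<beta>)) *
     ((\<integral>\<^sup>+t. ennreal (((b - t) * (t + a)) powr (- \<beta>) * t powr (2 * \<beta> - 1)) * indicator {0<..<b} t \<partial>lborel)
     + (\<integral>\<^sup>+t. ennreal (((a - t) * (t + b)) powr (- \<beta>) * t powr (2 * \<beta> - 1)) * indicator {0<..<a} t \<partial>lborel))"
  proof -
    have "1 - (norm (z + t *\<^sub>R (- u)))\<^sup>2 = ?n\<^sup>2 * ((a - t) * (t + b))" for t
      using chord[of "- t"] by (simp add: mult.commute add.commute)
    then show ?thesis using half[OF chord ab] half[of "- u" a b] ab by (simp add: distrib_left)
  qed
  then show ?thesis using nn_integral_chord_two_sided[OF \<beta> ab] by simp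
qed

lemma chord_integral_boundary_outward:
  fixes z u :: "'a::euclidean_space"
  assumes z: "norm z = 1" and u: "z \<bullet> u \<ge> 0"
  shows "chord_integral \<beta> z u = 0"
proof -
  have "ball_weight \<beta> (z + t *\<^sub>R u) = 0" if "t > 0" for t
  proof -
    have "(norm (z + t *\<^sub>R u))\<^sup>2 \<ge> 1" unfolding norm_add_scaleR_sq using z u that by simp
    then show ?thesis by (simp add: ball_weight_def max_def)
  qed
  then have "ennreal (ball_weight \<beta> (z + t *\<^sub>R u) * t powr (2 * \<beta> - 1)) * indicator {0<..} t = 0" for t
    by (cases "t > 0") simp_all
  then have "chord_integral \<beta> z u = (\<integral>\<^sup>+(t::real). 0 \<partial>lborel)"
    unfolding chord_integral_def by (intro nn_integral_cong)
  then show ?thesis by simp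
qed

text \<open>A chord starting on the sphere has one end at t = 0, so 1 - |z + t u|^2 factors as |u|^2
  (b - t) t.\<close>

lemma ball_weight_boundary_chord:
  fixes z u :: "'a::euclidean_space"
  assumes z: "norm z = 1" and u: "z \<bullet> u < 0" and t: "t > 0"
  defines "b \<equiv> - 2 * (z \<bullet> u) / (norm u)\<^sup>2"
  shows "ball_weight \<beta> (z + t *\<^sub>R u) * t powr (2 * \<beta> - 1) * indicator {0<..} t
    = norm u powr (- 2 * \<beta>) * ((b - t) powr (- \<beta>) * t powr (\<beta> - 1)) * indicator {0<..<b} t"
proof -
  let ?n = "norm u"
  have n: "?n > 0" using u by auto
  have ch: "1 - (norm (z + t *\<^sub>R u))\<^sup>2 = ?n\<^sup>2 * ((b - t) * t)"
    unfolding norm_add_scaleR_sq b_def using z n by (simp add: field_simps power2_eq_square)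
  show ?thesis
  proof (cases "t < b")
    case True
    have "?n\<^sup>2 = ?n powr 2" using n by simp
    then have n2: "(?n\<^sup>2) powr (- \<beta>) = ?n powr (- 2 * \<beta>)" by (simp only: powr_powr) simp
    have "ball_weight \<beta> (z + t *\<^sub>R u) = (?n\<^sup>2 * ((b - t) * t)) powr (- \<beta>)"
      unfolding ball_weight_def ch using True t by (simp add: max_def not_less)
    also have "\<dots> = ?n powr (- 2 * \<beta>) * ((b - t) powr (- \<beta>) * t powr (- \<beta>))"
      using True t by (simp add: powr_mult n2)
    finally have "ball_weight \<beta> (z + t *\<^sub>R u) * t powr (2 * \<beta> - 1) = ?n powr (- 2 * \<beta>) * ((b - t) powr (- \<beta>) * (t powr (- \<beta>) * t powr (2 * \<beta> - 1)))"
      by simp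
    also have "t powr (- \<beta>) * t powr (2 * \<beta> - 1) = t powr (\<beta> - 1)" by (simp add: powr_add[symmetric])
    finally show ?thesis using True t by simp
  next
    case False
    then have "(b - t) * t \<le> 0" using t by (intro mult_nonpos_nonneg) auto
    then have "1 - (norm (z + t *\<^sub>R u))\<^sup>2 \<le> 0" unfolding ch by (simp add: mult_nonneg_nonpos)
    then show ?thesis using False by (simp add: ball_weight_def max_def)
  qed
qed

lemma chord_integral_boundary_inward:
  fixes z u :: "'a::euclidean_space"
  assumes \<beta>: "0 < \<beta>" "\<beta> < 1" and z: "norm z = 1" and u: "z \<bullet> u < 0"
  shows "chord_integral \<beta> z u = ennreal (norm u powr (- 2 * \<beta>)) * chord_const \<beta>"
proof -
  define b where "b = - 2 * (z \<bullet> u) / (norm u)\<^sup>2"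
  have "(norm u)\<^sup>2 > 0" using u by auto
  then have b: "b > 0" using u by (simp add: b_def divide_neg_pos)
  have "ennreal (ball_weight \<beta> (z + t *\<^sub>R u) * t powr (2 * \<beta> - 1)) * indicator {0<..} t
      = ennreal (norm u powr (- 2 * \<beta>)) * (ennreal ((b - t) powr (- \<beta>) * t powr (\<beta> - 1)) * indicator {0<..<b} t)" for t
    using ball_weight_boundary_chord[OF z u, of t \<beta>]
    by (cases "t > 0") (auto simp: b_def indicator_def ennreal_mult[symmetric] split: if_splits)
  then show ?thesis unfolding chord_integral_def
    using nn_integral_chord_one_sided[OF \<beta> b] by (simp add: nn_integral_cmult)
qed

text \<open>The rays are paired because only the sum over opposite directions is independent of
  \<open>z\<close>. The pairing contributes the factor 2, the shell the factor ln 2.\<close>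

lemma ball_potential_polar:
  fixes z :: "'a::euclidean_space" and s :: real
  defines "\<beta> \<equiv> (real DIM('a) - s) / 2"
  shows "ennreal (2 * ln 2) * ball_potential s z
    = (\<integral>\<^sup>+u. ennreal (norm u powr (- s)) * (chord_integral \<beta> z u + chord_integral \<beta> z (- u)) * indicator shell u \<partial>lborel)"
proof -
  have one: "ennreal (ln 2) * ball_potential s z = (\<integral>\<^sup>+u. ennreal (norm u powr (- s)) * chord_integral \<beta> z u * indicator shell u \<partial>lborel)"
  proof -
    have "ball_potential s z = (\<integral>\<^sup>+y. ennreal (ball_weight \<beta> (z + y) * norm y powr (- s)) \<partial>lborel)"
      unfolding ball_potential_def \<beta>_def[symmetric]
      by (subst nn_integral_lborel_translate[symmetric, of _ z]) auto
    then have "ennreal (ln 2) * ball_potential s z = (\<integral>\<^sup>+u. (\<integral>\<^sup>+t. ennreal (ball_weight \<beta> (z + t *\<^sub>R u) * norm (t *\<^sub>R u) powr (- s)) * ennreal (t ^ (DIM('a) - 1)) * indicator {0<..} t \<partial>lborel) * indicator shell u \<partial>lborel)"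
      by (simp only:) (rule nn_integral_polar, measurable)
    also have "\<dots> = (\<integral>\<^sup>+u. ennreal (norm u powr (- s)) * chord_integral \<beta> z u * indicator shell u \<partial>lborel)"
    proof (intro nn_integral_cong)
      fix u :: 'a
      have "ennreal (ball_weight \<beta> (z + t *\<^sub>R u) * norm (t *\<^sub>R u) powr (- s)) * ennreal (t ^ (DIM('a) - 1)) * indicator {0<..} t
        = ennreal (norm u powr (- s)) * (ennreal (ball_weight \<beta> (z + t *\<^sub>R u) * t powr (2 * \<beta> - 1)) * indicator {0<..} t)" for t
      proof (cases "t > 0")
        case True
        have "t powr (- s) * t ^ (DIM('a) - 1) = t powr (2 * \<beta> - 1)"
        proof -
          have e: "2 * \<beta> - 1 = - s + real (DIM('a) - 1)" by (simp add: \<beta>_def of_nat_diff Suc_leI)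
          show ?thesis unfolding e powr_add powr_realpow[OF True] ..
        qed
        then have "(ball_weight \<beta> (z + t *\<^sub>R u) * norm (t *\<^sub>R u) powr (- s)) * t ^ (DIM('a) - 1) = norm u powr (- s) * (ball_weight \<beta> (z + t *\<^sub>R u) * t powr (2 * \<beta> - 1))"
          using True by (simp add: powr_mult mult_ac)
        then show ?thesis using True by (simp add: ennreal_mult[symmetric] del: norm_scaleR)
      qed simp
      then show "(\<integral>\<^sup>+t. ennreal (ball_weight \<beta> (z + t *\<^sub>R u) * norm (t *\<^sub>R u) powr (- s)) * ennreal (t ^ (DIM('a) - 1)) * indicator {0<..} t \<partial>lborel) * indicator shell u
         = ennreal (norm u powr (- s)) * chord_integral \<beta> z u * indicator shell u"
        unfolding chord_integral_def by (simp only:) (subst nn_integral_cmult, measurable)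
    qed
    finally show ?thesis .
  qed
  have "(\<integral>\<^sup>+u. ennreal (norm u powr (- s)) * chord_integral \<beta> z u * indicator shell u \<partial>lborel)
    = (\<integral>\<^sup>+u. ennreal (norm (- u) powr (- s)) * chord_integral \<beta> z (- u) * indicator shell (- u) \<partial>lborel)"
    by (rule nn_integral_lborel_uminus[symmetric]) measurable
  also have "\<dots> = (\<integral>\<^sup>+u. ennreal (norm u powr (- s)) * chord_integral \<beta> z (- u) * indicator shell u \<partial>lborel)"
    by (intro nn_integral_cong) (simp add: shell_def indicator_def)
  finally have two: "ennreal (ln 2) * ball_potential s z = (\<integral>\<^sup>+u. ennreal (norm u powr (- s)) * chord_integral \<beta> z (- u) * indicator shell u \<partial>lborel)"
    using one by simp
  have "ennreal (2 * ln 2) * ball_potential s z = ennreal (ln 2) * ball_potential s z + ennreal (ln 2) * ball_potential s z"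
    by (simp add: distrib_right[symmetric] ennreal_plus[symmetric] del: ennreal_plus)
  also have "\<dots> = (\<integral>\<^sup>+u. ennreal (norm u powr (- s)) * chord_integral \<beta> z u * indicator shell u \<partial>lborel)
     + (\<integral>\<^sup>+u. ennreal (norm u powr (- s)) * chord_integral \<beta> z (- u) * indicator shell u \<partial>lborel)"
    using one two by simp
  also have "\<dots> = (\<integral>\<^sup>+u. ennreal (norm u powr (- s)) * (chord_integral \<beta> z u + chord_integral \<beta> z (- u)) * indicator shell u \<partial>lborel)"
    by (subst nn_integral_add[symmetric]) (auto simp: algebra_simps)
  finally show ?thesis .
qed

text \<open>2 ln 2 times the value of the potential on the closed ball, with the chord integrals
  already evaluated.\<close>

definition equilibrium_const :: "'a::euclidean_space itself \<Rightarrow> real \<Rightarrow> ennreal" where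
  "equilibrium_const _ s = (\<integral>\<^sup>+(u::'a). ennreal (norm u powr (- s)) * (ennreal (norm u powr (- 2 * ((real DIM('a) - s) / 2))) * chord_const ((real DIM('a) - s) / 2)) * indicator shell u \<partial>lborel)"

context
  fixes s :: real
  assumes s: "0 < s" "s < DIM('a::euclidean_space)" "DIM('a) - s < 2"
begin

lemma equilibrium_const_finite: "equilibrium_const TYPE('a) s < \<infinity>"
proof -
  let ?\<beta> = "(real DIM('a) - s) / 2"
  have \<beta>: "0 < ?\<beta>" "?\<beta> < 1" using s by auto
  have "equilibrium_const TYPE('a) s \<le> (\<integral>\<^sup>+(u::'a). chord_const ?\<beta> * indicator shell u \<partial>lborel)"
    unfolding equilibrium_const_def
  proof (intro nn_integral_indicator_mono)
    fix u :: 'a assume "u \<in> shell"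
    then have u: "norm u \<ge> 1" by (simp add: shell_def)
    have "norm u powr (- s) \<le> 1" "norm u powr (- 2 * ?\<beta>) \<le> 1"
      using powr_mono2'[of "- s" 1 "norm u"] powr_mono2'[of "- 2 * ?\<beta>" 1 "norm u"] s u by auto
    then have le: "ennreal (norm u powr (- s)) \<le> 1" "ennreal (norm u powr (- 2 * ?\<beta>)) \<le> 1" by (auto simp: ennreal_le_1)
    show "ennreal (norm u powr (- s)) * (ennreal (norm u powr (- 2 * ?\<beta>)) * chord_const ?\<beta>) \<le> chord_const ?\<beta>"
      using mult_mono[OF le(1) mult_mono[OF le(2) order_refl[of "chord_const ?\<beta>"]]] by simp
  qed
  also have "\<dots> = chord_const ?\<beta> * emeasure lborel (shell :: 'a set)"
    by (subst nn_integral_cmult_indicator) auto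
  also have "\<dots> < \<infinity>"
    using chord_const_finite[OF \<beta>] emeasure_shell_finite[where 'a='a] by (simp add: ennreal_mult_less_top)
  finally show ?thesis .
qed

lemma ball_potential_interior:
  fixes z :: 'a
  assumes "norm z < 1"
  shows "ennreal (2 * ln 2) * ball_potential s z = equilibrium_const TYPE('a) s"
  unfolding ball_potential_polar equilibrium_const_def
proof (intro nn_integral_cong)
  fix u :: 'a
  show "ennreal (norm u powr - s) * (chord_integral ((real DIM('a) - s) / 2) z u + chord_integral ((real DIM('a) - s) / 2) z (- u)) * indicator shell u
     = ennreal (norm u powr (- s)) * (ennreal (norm u powr (- 2 * ((real DIM('a) - s) / 2))) * chord_const ((real DIM('a) - s) / 2)) * indicator shell u"
  proof (cases "u \<in> shell")
    case True
    then have "u \<noteq> 0" by (auto simp: shell_def)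
    then show ?thesis using chord_integral_interior[of "(real DIM('a) - s) / 2" z u] assms s by simp
  qed simp
qed

text \<open>Apart from the null set of tangential directions, exactly one of u and - u points
  inwards, and its one-sided chord integral equals that of a full chord through an interior
  point.\<close>

lemma ball_potential_boundary:
  fixes z :: 'a
  assumes z: "norm z = 1"
  shows "ennreal (2 * ln 2) * ball_potential s z = equilibrium_const TYPE('a) s"
  unfolding ball_potential_polar equilibrium_const_def
proof (intro nn_integral_cong_AE)
  have "negligible {u. z \<bullet> u = 0}" using z by (intro negligible_hyperplane) auto
  moreover have "{u. z \<bullet> u = 0} \<in> sets borel" by (intro borel_closed closed_hyperplane)
  ultimately have "{u. z \<bullet> u = 0} \<in> null_sets lborel"
    by (simp add: negligible_iff_null_sets null_sets_completion_iff)
  then have "AE u in lborel. z \<bullet> u \<noteq> 0" by (rule AE_I') auto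
  then show "AE u in lborel. ennreal (norm u powr - s) * (chord_integral ((real DIM('a) - s) / 2) z u + chord_integral ((real DIM('a) - s) / 2) z (- u)) * indicator shell u
     = ennreal (norm u powr (- s)) * (ennreal (norm u powr (- 2 * ((real DIM('a) - s) / 2))) * chord_const ((real DIM('a) - s) / 2)) * indicator shell u"
  proof eventually_elim
    case (elim u)
    have \<beta>: "0 < (real DIM('a) - s) / 2" "(real DIM('a) - s) / 2 < 1" using s by auto
    have "chord_integral ((real DIM('a) - s) / 2) z u + chord_integral ((real DIM('a) - s) / 2) z (- u)
      = ennreal (norm u powr (- 2 * ((real DIM('a) - s) / 2))) * chord_const ((real DIM('a) - s) / 2)"
    proof (cases "z \<bullet> u < 0")
      case True
      then show ?thesis
        using chord_integral_boundary_inward[OF \<beta> z True] chord_integral_boundary_outward[OF z, of "- u"] by simp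
    next
      case False
      then show ?thesis
        using elim chord_integral_boundary_inward[OF \<beta> z, of "- u"] chord_integral_boundary_outward[OF z, of u] by simp
    qed
    then show ?case by simp
  qed
qed

end

section \<open>Kelvin transform and balayage onto the ball\<close>

text \<open>In polar coordinates the inversion fixes the direction \<open>u\<close> and acts on its
  ray as t \<mapsto> c / t, so a one-dimensional substitution produces the Jacobian.\<close>

lemma nn_integral_inversion_origin:
  fixes f :: "'a::euclidean_space \<Rightarrow> real" and \<kappa> :: real
  assumes f[measurable]: "f \<in> borel_measurable borel" and f0: "\<And>y. f y \<ge> 0" and l: "\<kappa> > 0"
  shows "(\<integral>\<^sup>+y. ennreal (f y) \<partial>lborel)
    = (\<integral>\<^sup>+y. ennreal (f ((\<kappa> / (norm y)\<^sup>2) *\<^sub>R y) * (\<kappa> / (norm y)\<^sup>2) ^ DIM('a)) \<partial>lborel)" (is "?A = ?B")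
proof -
  let ?d = "DIM('a)"
  have "ennreal (ln 2) * ?A = (\<integral>\<^sup>+u. (\<integral>\<^sup>+t. ennreal (f (t *\<^sub>R u)) * ennreal (t ^ (?d - 1)) * indicator {0<..} t \<partial>lborel) * indicator shell u \<partial>lborel)"
    by (rule nn_integral_polar) measurable
  also have "\<dots> = (\<integral>\<^sup>+u. (\<integral>\<^sup>+t. ennreal (f ((\<kappa> / (norm (t *\<^sub>R u))\<^sup>2) *\<^sub>R (t *\<^sub>R u)) * (\<kappa> / (norm (t *\<^sub>R u))\<^sup>2) ^ ?d) * ennreal (t ^ (?d - 1)) * indicator {0<..} t \<partial>lborel) * indicator shell u \<partial>lborel)"
  proof (rule nn_integral_cong)
    fix u :: 'a
    show "(\<integral>\<^sup>+t. ennreal (f (t *\<^sub>R u)) * ennreal (t ^ (?d - 1)) * indicator {0<..} t \<partial>lborel) * indicator shell u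
      = (\<integral>\<^sup>+t. ennreal (f ((\<kappa> / (norm (t *\<^sub>R u))\<^sup>2) *\<^sub>R (t *\<^sub>R u)) * (\<kappa> / (norm (t *\<^sub>R u))\<^sup>2) ^ ?d) * ennreal (t ^ (?d - 1)) * indicator {0<..} t \<partial>lborel) * indicator shell u"
    proof (cases "u \<in> shell")
      case True
      then have n: "norm u > 0" by (auto simp: shell_def)
      define c where "c = \<kappa> / (norm u)\<^sup>2"
      have c: "c > 0" using n l by (simp add: c_def)
      define g :: "real \<Rightarrow> real" where "g t = c / t" for t
      define g' :: "real \<Rightarrow> real" where "g' t = - c / t\<^sup>2" for t
      define F where "F t = f (t *\<^sub>R u) * t ^ (?d - 1)" for t
      have img: "g ` {0<..} = {0<..}"
      proof (intro equalityI subsetI)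
        fix t :: real assume "t \<in> {0<..}"
        then have "c / t \<in> {0<..}" "t = g (c / t)" using c by (auto simp: g_def)
        then show "t \<in> g ` {0<..}" by blast
      qed (use c in \<open>auto simp: g_def\<close>)
      have "(\<integral>\<^sup>+t. ennreal (F t) * indicator {0<..} t \<partial>lborel) = (\<integral>\<^sup>+t. ennreal (\<bar>g' t\<bar> * F (g t)) * indicator {0<..} t \<partial>lborel)"
      proof (rule nn_integral_change_of_variables_real[OF _ img])
        show "(g has_real_derivative g' x) (at x)" if "x \<in> {0<..}" for x
          unfolding g_def g'_def using that by (auto intro!: derivative_eq_intros simp: power2_eq_square)
        show "inj_on g {0<..}" using c by (auto simp: inj_on_def g_def)
        show "(\<lambda>x. \<bar>g' x\<bar> * F (g x) * indicat_real {0<..} x) \<in> borel_measurable borel"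
          unfolding g_def g'_def F_def by measurable
        show "F \<in> borel_measurable borel" unfolding F_def by measurable
      qed (auto simp: F_def f0)
      also have "(\<integral>\<^sup>+t. ennreal (F t) * indicator {0<..} t \<partial>lborel) = (\<integral>\<^sup>+t. ennreal (f (t *\<^sub>R u)) * ennreal (t ^ (?d - 1)) * indicator {0<..} t \<partial>lborel)"
      proof (rule nn_integral_cong)
        fix t :: real
        show "ennreal (F t) * indicator {0<..} t = ennreal (f (t *\<^sub>R u)) * ennreal (t ^ (?d - 1)) * indicator {0<..} t"
          by (cases "t > 0") (simp_all add: F_def f0 ennreal_mult)
      qed
      also have "(\<integral>\<^sup>+t. ennreal (\<bar>g' t\<bar> * F (g t)) * indicator {0<..} t \<partial>lborel)
         = (\<integral>\<^sup>+t. ennreal (f ((\<kappa> / (norm (t *\<^sub>R u))\<^sup>2) *\<^sub>R (t *\<^sub>R u)) * (\<kappa> / (norm (t *\<^sub>R u))\<^sup>2) ^ ?d) * ennreal (t ^ (?d - 1)) * indicator {0<..} t \<partial>lborel)"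
      proof (rule nn_integral_cong)
        fix t :: real
        show "ennreal (\<bar>g' t\<bar> * F (g t)) * indicator {0<..} t = ennreal (f ((\<kappa> / (norm (t *\<^sub>R u))\<^sup>2) *\<^sub>R (t *\<^sub>R u)) * (\<kappa> / (norm (t *\<^sub>R u))\<^sup>2) ^ ?d) * ennreal (t ^ (?d - 1)) * indicator {0<..} t"
        proof (cases "t > 0")
          case True
          have e1: "\<kappa> / (norm (t *\<^sub>R u))\<^sup>2 = c / t\<^sup>2" by (simp add: c_def power_mult_distrib)
          have e2: "(c / t\<^sup>2) *\<^sub>R (t *\<^sub>R u) = (c / t) *\<^sub>R u" using True by (simp add: power2_eq_square)
          have e3: "(c / t\<^sup>2) ^ ?d * t ^ (?d - 1) = (c / t\<^sup>2) * (c / t) ^ (?d - 1)"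
          proof -
            have "(c / t\<^sup>2) ^ ?d = (c / t\<^sup>2) * (c / t\<^sup>2) ^ (?d - 1)"
              using power_minus_mult[OF DIM_positive[where 'a='a], of "c / t\<^sup>2"] by (simp add: mult.commute)
            moreover have "(c / t\<^sup>2) ^ (?d - 1) * t ^ (?d - 1) = (c / t) ^ (?d - 1)"
              unfolding power_mult_distrib[symmetric] using True by (simp add: power2_eq_square)
            ultimately show ?thesis by simp
          qed
          have "f ((c / t) *\<^sub>R u) * (c / t\<^sup>2) ^ ?d * t ^ (?d - 1) = (c / t\<^sup>2) * (f ((c / t) *\<^sub>R u) * (c / t) ^ (?d - 1))"
            unfolding mult.assoc e3 by (simp only: mult_ac)
          also have "\<dots> = \<bar>g' t\<bar> * F (g t)" using c by (simp add: g'_def g_def F_def)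
          finally show ?thesis unfolding e1 e2 using True f0 c by (simp add: ennreal_mult[symmetric])
        qed simp
      qed
      finally show ?thesis by simp
    qed simp
  qed
  also have "\<dots> = ennreal (ln 2) * ?B"
    by (rule nn_integral_polar[symmetric]) measurable
  finally show ?thesis by (simp add: ennreal_mult_cancel_left)
qed

definition inversion :: "'a::euclidean_space \<Rightarrow> real \<Rightarrow> 'a \<Rightarrow> 'a" where
  "inversion P \<kappa> x = P + (\<kappa> / (norm (x - P))\<^sup>2) *\<^sub>R (x - P)"

lemma inversion_measurable [measurable]: "inversion P \<kappa> \<in> borel_measurable borel"
  unfolding inversion_def by measurable

lemma nn_integral_inversion:
  fixes f :: "'a::euclidean_space \<Rightarrow> real" and \<kappa> :: real
  assumes f[measurable]: "f \<in> borel_measurable borel" and f0: "\<And>y. f y \<ge> 0" and l: "\<kappa> > 0"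
  shows "(\<integral>\<^sup>+y. ennreal (f y) \<partial>lborel)
    = (\<integral>\<^sup>+y. ennreal (f (inversion P \<kappa> y) * (\<kappa> / (norm (y - P))\<^sup>2) ^ DIM('a)) \<partial>lborel)"
proof -
  have "(\<integral>\<^sup>+y. ennreal (f y) \<partial>lborel) = (\<integral>\<^sup>+y. ennreal (f (P + y)) \<partial>lborel)"
    by (rule nn_integral_lborel_translate[symmetric]) measurable
  also have "\<dots> = (\<integral>\<^sup>+y. ennreal (f (P + (\<kappa> / (norm y)\<^sup>2) *\<^sub>R y) * (\<kappa> / (norm y)\<^sup>2) ^ DIM('a)) \<partial>lborel)"
    by (rule nn_integral_inversion_origin) (use f0 l in auto)
  also have "\<dots> = (\<integral>\<^sup>+y. ennreal (f (inversion P \<kappa> (P + y)) * (\<kappa> / (norm (P + y - P))\<^sup>2) ^ DIM('a)) \<partial>lborel)"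
    by (simp add: inversion_def)
  also have "\<dots> = (\<integral>\<^sup>+y. ennreal (f (inversion P \<kappa> y) * (\<kappa> / (norm (y - P))\<^sup>2) ^ DIM('a)) \<partial>lborel)"
    by (rule nn_integral_lborel_translate) measurable
  finally show ?thesis .
qed

lemma inversion_dist_center:
  assumes "x \<noteq> P" "\<kappa> > 0"
  shows "norm (inversion P \<kappa> x - P) = \<kappa> / norm (x - P)"
  using assms by (simp add: inversion_def power2_eq_square)

lemma inversion_involutive:
  assumes "x \<noteq> P" "\<kappa> > 0"
  shows "inversion P \<kappa> (inversion P \<kappa> x) = x"
proof -
  let ?n = "norm (x - P)"
  have n: "?n > 0" using assms by simp
  have "inversion P \<kappa> (inversion P \<kappa> x) = P + (\<kappa> / (\<kappa> / ?n)\<^sup>2 * (\<kappa> / ?n\<^sup>2)) *\<^sub>R (x - P)"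
    unfolding inversion_def[of P \<kappa> "inversion P \<kappa> x"] inversion_dist_center[OF assms] by (simp add: inversion_def)
  also have "\<kappa> / (\<kappa> / ?n)\<^sup>2 * (\<kappa> / ?n\<^sup>2) = 1" using n assms(2) by (simp add: power2_eq_square)
  finally show ?thesis by simp
qed

lemma inversion_dist:
  fixes x z P :: "'a::euclidean_space"
  assumes "x \<noteq> P" "z \<noteq> P" "\<kappa> > 0"
  shows "norm (inversion P \<kappa> x - inversion P \<kappa> z) = \<kappa> * norm (x - z) / (norm (x - P) * norm (z - P))"
proof (rule power2_eq_imp_eq)
  define a where "a = x - P"
  define b where "b = z - P"
  have ab: "a \<bullet> a > 0" "b \<bullet> b > 0" using assms by (auto simp: a_def b_def)
  have "inversion P \<kappa> x - inversion P \<kappa> z = (\<kappa> / (a \<bullet> a)) *\<^sub>R a - (\<kappa> / (b \<bullet> b)) *\<^sub>R b"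
    by (simp add: inversion_def a_def b_def power2_norm_eq_inner)
  moreover have "(norm (A *\<^sub>R a - B *\<^sub>R b))\<^sup>2 = A\<^sup>2 * (a \<bullet> a) - 2 * A * B * (a \<bullet> b) + B\<^sup>2 * (b \<bullet> b)" for A B
    unfolding power2_norm_eq_inner by (simp add: inner_diff inner_commute algebra_simps) (simp add: power2_eq_square)
  ultimately have "(norm (inversion P \<kappa> x - inversion P \<kappa> z))\<^sup>2 = (\<kappa> / (a \<bullet> a))\<^sup>2 * (a \<bullet> a) - 2 * (\<kappa> / (a \<bullet> a)) * (\<kappa> / (b \<bullet> b)) * (a \<bullet> b) + (\<kappa> / (b \<bullet> b))\<^sup>2 * (b \<bullet> b)"
    by simp
  also have "\<dots> = \<kappa>\<^sup>2 * (a \<bullet> a - 2 * (a \<bullet> b) + b \<bullet> b) / ((a \<bullet> a) * (b \<bullet> b))"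
  proof -
    have "(\<kappa> / A)\<^sup>2 * A - 2 * (\<kappa> / A) * (\<kappa> / B) * c + (\<kappa> / B)\<^sup>2 * B = \<kappa>\<^sup>2 * (A - 2 * c + B) / (A * B)"
      if "A > 0" "B > 0" for A B c :: real
      using that by (simp add: field_simps power2_eq_square)
    then show ?thesis using ab by blast
  qed
  also have "a \<bullet> a - 2 * (a \<bullet> b) + b \<bullet> b = (norm (x - z))\<^sup>2"
  proof -
    have "x - z = a - b" by (simp add: a_def b_def)
    then show ?thesis by (simp add: power2_norm_eq_inner inner_diff inner_commute)
  qed
  finally show "(norm (inversion P \<kappa> x - inversion P \<kappa> z))\<^sup>2 = (\<kappa> * norm (x - z) / (norm (x - P) * norm (z - P)))\<^sup>2"
    by (simp add: a_def b_def power_mult_distrib power_divide power2_norm_eq_inner)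
qed (use assms in auto)

text \<open>\<kappa> is the power of the point \<open>P\<close> with respect to the unit sphere, so
  the inversion maps sphere and ball to themselves; the identity gives the exact conformal
  factor.\<close>

lemma inversion_norm:
  fixes x P :: "'a::euclidean_space"
  assumes "x \<noteq> P"
  defines "\<kappa> \<equiv> (norm P)\<^sup>2 - 1"
  shows "1 - (norm (inversion P \<kappa> x))\<^sup>2 = (1 - (norm x)\<^sup>2) * (\<kappa> / (norm (x - P))\<^sup>2)"
proof -
  define a where "a = x - P"
  define n where "n = a \<bullet> a"
  have n: "n > 0" using assms by (simp add: n_def a_def)
  have x: "x = P + a" by (simp add: a_def)
  have "(norm (inversion P \<kappa> x))\<^sup>2 = P \<bullet> P + 2 * (\<kappa> / n) * (P \<bullet> a) + (\<kappa> / n)\<^sup>2 * n"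
    unfolding inversion_def a_def[symmetric] power2_norm_eq_inner n_def[symmetric]
    by (simp add: inner_add inner_commute power2_eq_square n_def)
  moreover have "(norm x)\<^sup>2 = P \<bullet> P + 2 * (P \<bullet> a) + n"
    unfolding x power2_norm_eq_inner by (simp add: inner_add inner_commute n_def)
  moreover have "P \<bullet> P = \<kappa> + 1" by (simp add: \<kappa>_def power2_norm_eq_inner)
  moreover have "(norm (x - P))\<^sup>2 = n" by (simp add: n_def a_def power2_norm_eq_inner)
  ultimately show ?thesis using n by (simp add: field_simps power2_eq_square)
qed

lemma ball_weight_inversion:
  fixes x P :: "'a::euclidean_space"
  assumes "x \<noteq> P" "norm P > 1"
  defines "\<kappa> \<equiv> (norm P)\<^sup>2 - 1"
  shows "ball_weight \<beta> (inversion P \<kappa> x) = (\<kappa> / (norm (x - P))\<^sup>2) powr (- \<beta>) * ball_weight \<beta> x"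
proof -
  define c where "c = \<kappa> / (norm (x - P))\<^sup>2"
  have "\<kappa> > 0" using assms by (simp add: \<kappa>_def)
  then have c: "c > 0" using assms by (simp add: c_def)
  have "max 0 (1 - (norm (inversion P \<kappa> x))\<^sup>2) = c * max 0 (1 - (norm x)\<^sup>2)"
    unfolding inversion_norm[OF assms(1), folded \<kappa>_def] c_def[symmetric] using c
    by (auto simp: max_def mult.commute mult_le_0_iff zero_le_mult_iff)
  then show ?thesis using c by (simp add: ball_weight_def c_def[symmetric] powr_mult)
qed

text \<open>Kelvin transform at an exterior point: \<open>ball_weight \<beta> y * norm (y - P) powr (- DIM('a))\<close> is, up to a constant, the balayage
  of the unit mass at \<open>P\<close> onto the ball.\<close>

context
  fixes s :: real and P :: "'a::euclidean_space"
  assumes s: "0 < s" "s < real DIM('a)" and P: "norm P > 1"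
begin

text \<open>Count powers of |x - P|: 2 \<beta> from the weight, d from the distance to
  \<open>P\<close>, and - 2 d from the Jacobian, in total - s. The swept density thus turns into the
  equilibrium density times the kernel with pole \<open>P\<close>.\<close>

lemma kelvin_weight:
  assumes x: "x \<noteq> P"
  defines "\<kappa> \<equiv> (norm P)\<^sup>2 - 1" and "\<beta> \<equiv> (real DIM('a) - s) / 2"
  shows "ball_weight \<beta> (inversion P \<kappa> x) * norm (inversion P \<kappa> x - P) powr (- real DIM('a)) * (\<kappa> / (norm (x - P))\<^sup>2) ^ DIM('a)
     = \<kappa> powr (- \<beta>) * (ball_weight \<beta> x * norm (x - P) powr (- s))"
proof -
  let ?d = "real DIM('a)"
  have l: "\<kappa> > 0" using P by (simp add: \<kappa>_def)
  define n where "n = norm (x - P)"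
  have n: "n > 0" using x by (auto simp: n_def)
  have e1: "\<kappa> / n\<^sup>2 = \<kappa> * n powr (- 2)" using n by (simp add: powr_minus divide_inverse)
  have e2: "norm (inversion P \<kappa> x - P) = \<kappa> * n powr (- 1)"
    unfolding inversion_dist_center[OF x l] n_def[symmetric] using n by (simp add: powr_minus divide_inverse)
  have "(\<kappa> / n\<^sup>2) ^ DIM('a) = (\<kappa> * n powr (- 2)) powr ?d"
    unfolding e1 using n l by (simp add: powr_realpow)
  then have "ball_weight \<beta> (inversion P \<kappa> x) * norm (inversion P \<kappa> x - P) powr (- ?d) * (\<kappa> / (norm (x - P))\<^sup>2) ^ DIM('a)
     = ((\<kappa> * n powr (- 2)) powr (- \<beta>) * ball_weight \<beta> x) * (\<kappa> * n powr (- 1)) powr (- ?d) * (\<kappa> * n powr (- 2)) powr ?d"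
    unfolding ball_weight_inversion[OF x P, folded \<kappa>_def] e2 n_def[symmetric] e1[symmetric] by simp
  also have "\<dots> = \<kappa> powr (- \<beta>) * (ball_weight \<beta> x * ((\<kappa> powr (- ?d) * \<kappa> powr ?d) * (n powr ((- 2) * (- \<beta>)) * n powr ((- 1) * (- ?d)) * n powr ((- 2) * ?d))))"
    using n l by (simp only: powr_mult powr_powr powr_ge_zero norm_ge_zero less_imp_le mult_ac)
  also have "\<kappa> powr (- ?d) * \<kappa> powr ?d = 1" using l by (simp add: powr_add[symmetric])
  also have "n powr ((- 2) * (- \<beta>)) * n powr ((- 1) * (- ?d)) * n powr ((- 2) * ?d) = n powr (- s)"
  proof -
    have "(- 2) * (- \<beta>) + (- 1) * (- ?d) + (- 2) * ?d = - s" by (simp add: \<beta>_def field_simps)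
    then show ?thesis unfolding powr_add[symmetric] by simp
  qed
  finally show ?thesis by (simp add: n_def)
qed

text \<open>The inverted kernel brings the factors |x - P|^s and |z - P|^(-s). The first cancels the
  kernel in \<open>kelvin_weight\<close>, leaving the equilibrium potential at the inverted
  point.\<close>

lemma kelvin_potential:
  assumes z: "norm z \<le> 1"
  shows "(\<integral>\<^sup>+y. ennreal (ball_weight ((real DIM('a) - s) / 2) y * norm (y - P) powr (- real DIM('a)) * norm (y - z) powr (- s)) \<partial>lborel)
    = ennreal (((norm P)\<^sup>2 - 1) powr (- ((real DIM('a) - s) / 2)) * norm (z - P) powr (- s)) * ball_potential s (inversion P ((norm P)\<^sup>2 - 1) z)"
proof -
  let ?d = "real DIM('a)"
  define \<beta> where "\<beta> = (?d - s) / 2"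
  define \<kappa> where "\<kappa> = (norm P)\<^sup>2 - 1"
  have l: "\<kappa> > 0" using P by (simp add: \<kappa>_def)
  have zP: "z \<noteq> P" using z P by auto
  define z' where "z' = inversion P \<kappa> z"
  have m: "norm (z' - P) = \<kappa> / norm (z - P)" unfolding z'_def by (rule inversion_dist_center[OF zP l])
  have mpos: "norm (z' - P) > 0" unfolding m using zP l by simp
  have z'P: "z' \<noteq> P" using mpos by auto
  have zz': "inversion P \<kappa> z' = z" unfolding z'_def by (rule inversion_involutive[OF zP l])
  have pt: "ball_weight \<beta> (inversion P \<kappa> x) * norm (inversion P \<kappa> x - P) powr (- ?d) * norm (inversion P \<kappa> x - z) powr (- s) * (\<kappa> / (norm (x - P))\<^sup>2) ^ DIM('a)
     = \<kappa> powr (- \<beta>) * norm (z - P) powr (- s) * (ball_weight \<beta> x * norm (x - z') powr (- s))" if x: "x \<noteq> P" for x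
  proof -
    define n where "n = norm (x - P)"
    define r where "r = norm (x - z')"
    define k where "k = norm (z - P)"
    have n: "n > 0" and k: "k > 0" using x zP by (auto simp: n_def k_def)
    have "norm (inversion P \<kappa> x - z) = \<kappa> * r / (n * (\<kappa> / k))"
      using inversion_dist[OF x z'P l] unfolding zz' m n_def r_def k_def .
    then have "norm (inversion P \<kappa> x - z) = n powr (- 1) * (k * r)" using n k l by (simp add: powr_minus field_simps)
    then have "norm (inversion P \<kappa> x - z) powr (- s) = n powr ((- 1) * (- s)) * (k powr (- s) * r powr (- s))"
      by (simp only: powr_mult powr_powr)
    then have "norm (inversion P \<kappa> x - z) powr (- s) = n powr s * (k powr (- s) * r powr (- s))" by simp
    moreover have "n powr (- s) * n powr s = 1" using n by (simp add: powr_add[symmetric])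
    moreover have "a * b * e * d = g * k' * (w * r')" if "e = n1 * (k' * r')" "n0 * n1 = 1" "a * b * d = g * (w * n0)"
      for a b d e g k' w r' n0 n1 :: real
    proof -
      have "a * b * e * d = (a * b * d) * e" by simp
      also have "\<dots> = g * k' * (w * r') * (n0 * n1)" unfolding that(1,3) by (simp only: mult_ac)
      finally show ?thesis using that(2) by simp
    qed
    ultimately show ?thesis
      using kelvin_weight[OF x, folded \<beta>_def \<kappa>_def] unfolding n_def r_def k_def by blast
  qed
  have "(\<integral>\<^sup>+y. ennreal (ball_weight \<beta> y * norm (y - P) powr (- ?d) * norm (y - z) powr (- s)) \<partial>lborel)
    = (\<integral>\<^sup>+x. ennreal (ball_weight \<beta> (inversion P \<kappa> x) * norm (inversion P \<kappa> x - P) powr (- ?d) * norm (inversion P \<kappa> x - z) powr (- s) * (\<kappa> / (norm (x - P))\<^sup>2) ^ DIM('a)) \<partial>lborel)"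
    by (rule nn_integral_inversion[OF _ _ l]) auto
  also have "\<dots> = (\<integral>\<^sup>+x. ennreal (\<kappa> powr (- \<beta>) * norm (z - P) powr (- s)) * ennreal (ball_weight \<beta> x * norm (x - z') powr (- s)) \<partial>lborel)"
  proof (rule nn_integral_cong_AE)
    have "AE x in lborel. x \<noteq> P" by (rule AE_lborel_singleton)
    then show "AE x in lborel. ennreal (ball_weight \<beta> (inversion P \<kappa> x) * norm (inversion P \<kappa> x - P) powr (- ?d) * norm (inversion P \<kappa> x - z) powr (- s) * (\<kappa> / (norm (x - P))\<^sup>2) ^ DIM('a))
      = ennreal (\<kappa> powr (- \<beta>) * norm (z - P) powr (- s)) * ennreal (ball_weight \<beta> x * norm (x - z') powr (- s))"
      by eventually_elim (simp add: pt ennreal_mult)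
  qed
  also have "\<dots> = ennreal (\<kappa> powr (- \<beta>) * norm (z - P) powr (- s)) * ball_potential s z'"
    unfolding ball_potential_def \<beta>_def[symmetric] by (rule nn_integral_cmult) measurable
  finally show ?thesis unfolding \<beta>_def[symmetric] \<kappa>_def[symmetric] z'_def .
qed

text \<open>Reduces the mass of the balayage to the equilibrium potential at the exterior point
  \<open>P\<close>, so that the missing mass becomes the drop of that potential outside the
  ball.\<close>

lemma kelvin_mass:
  "(\<integral>\<^sup>+y. ennreal (ball_weight ((real DIM('a) - s) / 2) y * norm (y - P) powr (- real DIM('a))) \<partial>lborel)
    = ennreal (((norm P)\<^sup>2 - 1) powr (- ((real DIM('a) - s) / 2))) * ball_potential s P"
proof -
  let ?d = "real DIM('a)"
  define \<beta> where "\<beta> = (?d - s) / 2"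
  define \<kappa> where "\<kappa> = (norm P)\<^sup>2 - 1"
  have l: "\<kappa> > 0" using P by (simp add: \<kappa>_def)
  note pt = kelvin_weight[folded \<beta>_def \<kappa>_def]
  have "(\<integral>\<^sup>+y. ennreal (ball_weight \<beta> y * norm (y - P) powr (- ?d)) \<partial>lborel)
    = (\<integral>\<^sup>+x. ennreal (ball_weight \<beta> (inversion P \<kappa> x) * norm (inversion P \<kappa> x - P) powr (- ?d) * (\<kappa> / (norm (x - P))\<^sup>2) ^ DIM('a)) \<partial>lborel)"
    by (rule nn_integral_inversion[OF _ _ l]) auto
  also have "\<dots> = (\<integral>\<^sup>+x. ennreal (\<kappa> powr (- \<beta>)) * ennreal (ball_weight \<beta> x * norm (x - P) powr (- s)) \<partial>lborel)"
  proof (rule nn_integral_cong_AE)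
    have "AE x in lborel. x \<noteq> P" by (rule AE_lborel_singleton)
    then show "AE x in lborel. ennreal (ball_weight \<beta> (inversion P \<kappa> x) * norm (inversion P \<kappa> x - P) powr (- ?d) * (\<kappa> / (norm (x - P))\<^sup>2) ^ DIM('a))
      = ennreal (\<kappa> powr (- \<beta>)) * ennreal (ball_weight \<beta> x * norm (x - P) powr (- s))"
      by eventually_elim (simp add: pt ennreal_mult)
  qed
  also have "\<dots> = ennreal (\<kappa> powr (- \<beta>)) * ball_potential s P"
    unfolding ball_potential_def \<beta>_def[symmetric] by (rule nn_integral_cmult) measurable
  finally show ?thesis unfolding \<beta>_def[symmetric] \<kappa>_def[symmetric] .
qed

end

text \<open>Averaging over unit translations along \<open>p\<close> replaces an integration in the direction orthogonal to a hyperplane.\<close>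

lemma nn_integral_hyperplane_singularity_le:
  assumes \<beta>: "0 < \<beta>" "\<beta> < (1::real)"
  obtains K where "K \<ge> 0"
    "\<And>p::'a::euclidean_space. norm p = 1 \<Longrightarrow> (\<integral>\<^sup>+u. ennreal (\<bar>p \<bullet> u\<bar> powr (- \<beta>)) * indicator shell u \<partial>lborel) \<le> ennreal K"
proof -
  let ?J = "\<integral>\<^sup>+(x::real). ennreal (norm x powr (- \<beta>)) * indicator {x. norm x < 1} x \<partial>lborel"
  have "?J < \<infinity>" by (rule nn_integral_norm_powr_near_0) (use \<beta> in auto)
  then obtain j where j: "j \<ge> 0" "?J = ennreal j" by (cases ?J) auto
  have line: "(\<integral>\<^sup>+v. ennreal (\<bar>c + v\<bar> powr (- \<beta>)) * indicator {0..1} v \<partial>lborel) \<le> ennreal (j + 1)" for c :: real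
  proof -
    have "(\<integral>\<^sup>+v. ennreal (\<bar>c + v\<bar> powr (- \<beta>)) * indicator {0..1} v \<partial>lborel)
      \<le> (\<integral>\<^sup>+v. ennreal (norm (c + v) powr (- \<beta>)) * indicator {x. norm x < 1} (c + v) + indicator {0..1} v \<partial>lborel)"
    proof (intro nn_integral_mono)
      fix v :: real
      show "ennreal (\<bar>c + v\<bar> powr (- \<beta>)) * indicator {0..1} v \<le> ennreal (norm (c + v) powr (- \<beta>)) * indicator {x. norm x < 1} (c + v) + indicator {0..1} v"
      proof (cases "\<bar>c + v\<bar> < 1")
        case False
        then have "\<bar>c + v\<bar> powr (- \<beta>) \<le> 1" using powr_mono2'[of "- \<beta>" 1 "\<bar>c + v\<bar>"] \<beta> by simp
        then show ?thesis using False by (simp add: indicator_def ennreal_le_1)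
      qed (simp add: indicator_def add_increasing2)
    qed
    also have "\<dots> = (\<integral>\<^sup>+v. ennreal (norm (c + v) powr (- \<beta>)) * indicator {x. norm x < 1} (c + v) \<partial>lborel) + emeasure lborel {0..1::real}"
      by (subst nn_integral_add) auto
    also have "(\<integral>\<^sup>+v. ennreal (norm (c + v) powr (- \<beta>)) * indicator {x. norm x < 1} (c + v) \<partial>lborel) = ?J"
      by (rule nn_integral_lborel_translate) measurable
    also have "?J + emeasure lborel {0..1::real} = ennreal (j + 1)" using j by (simp add: ennreal_plus)
    finally show ?thesis .
  qed
  have [measurable]: "cball (0::'a) 3 \<in> sets borel" "{0..1::real} \<in> sets borel" by auto
  obtain V where V: "V \<ge> 0" "emeasure lborel (cball (0::'a) 3) = ennreal V"
    using emeasure_lborel_cball_finite[of "0::'a" 3] by (cases "emeasure lborel (cball (0::'a) 3)") auto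
  have "(\<integral>\<^sup>+u. ennreal (\<bar>p \<bullet> u\<bar> powr (- \<beta>)) * indicator shell u \<partial>lborel) \<le> ennreal (V * (j + 1))"
    if p: "norm p = 1" for p :: 'a
  proof -
    let ?I = "\<integral>\<^sup>+u. ennreal (\<bar>p \<bullet> u\<bar> powr (- \<beta>)) * indicator shell u \<partial>lborel"
    have tr: "?I \<le> (\<integral>\<^sup>+u. ennreal (\<bar>p \<bullet> u + v\<bar> powr (- \<beta>)) * indicator (cball 0 3) u \<partial>lborel)" if v: "v \<in> {0..1}" for v
    proof -
      have "?I = (\<integral>\<^sup>+u. ennreal (\<bar>p \<bullet> (v *\<^sub>R p + u)\<bar> powr (- \<beta>)) * indicator shell (v *\<^sub>R p + u) \<partial>lborel)"
        by (rule nn_integral_lborel_translate[symmetric]) measurable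
      also have "\<dots> \<le> (\<integral>\<^sup>+u. ennreal (\<bar>p \<bullet> u + v\<bar> powr (- \<beta>)) * indicator (cball 0 3) u \<partial>lborel)"
      proof (intro nn_integral_mono)
        fix u :: 'a
        have "p \<bullet> (v *\<^sub>R p + u) = p \<bullet> u + v" using p by (simp add: inner_add_right norm_eq_1)
        moreover have "u \<in> cball 0 3" if "v *\<^sub>R p + u \<in> shell"
          using that v p norm_triangle_ineq4[of "v *\<^sub>R p + u" "v *\<^sub>R p"] by (simp add: shell_def)
        ultimately show "ennreal (\<bar>p \<bullet> (v *\<^sub>R p + u)\<bar> powr (- \<beta>)) * indicator shell (v *\<^sub>R p + u)
           \<le> ennreal (\<bar>p \<bullet> u + v\<bar> powr (- \<beta>)) * indicator (cball 0 3) u"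
          by (simp add: indicator_def del: mem_cball)
      qed
      finally show ?thesis .
    qed
    have "?I = (\<integral>\<^sup>+v. ?I * indicator {0..1::real} v \<partial>lborel)"
      by (subst nn_integral_cmult_indicator) auto
    also have "\<dots> \<le> (\<integral>\<^sup>+v. (\<integral>\<^sup>+u. ennreal (\<bar>p \<bullet> u + v\<bar> powr (- \<beta>)) * indicator (cball 0 3) u \<partial>lborel) * indicator {0..1} v \<partial>lborel)"
      by (intro nn_integral_indicator_mono tr)
    also have "\<dots> = (\<integral>\<^sup>+v. (\<integral>\<^sup>+u. ennreal (\<bar>p \<bullet> u + v\<bar> powr (- \<beta>)) * indicator (cball 0 3) u * indicator {0..1} v \<partial>lborel) \<partial>lborel)"
      by (intro nn_integral_cong nn_integral_multc[symmetric]) auto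
    also have "\<dots> = (\<integral>\<^sup>+u. (\<integral>\<^sup>+v. ennreal (\<bar>p \<bullet> u + v\<bar> powr (- \<beta>)) * indicator (cball 0 3) u * indicator {0..1} v \<partial>lborel) \<partial>lborel)"
      by (rule lborel_pair.Fubini') measurable
    also have "\<dots> = (\<integral>\<^sup>+u. (\<integral>\<^sup>+v. ennreal (\<bar>p \<bullet> u + v\<bar> powr (- \<beta>)) * indicator {0..1} v \<partial>lborel) * indicator (cball 0 3) u \<partial>lborel)"
      by (intro nn_integral_cong) (simp add: indicator_def)
    also have "\<dots> \<le> (\<integral>\<^sup>+(u::'a). ennreal (j + 1) * indicator (cball 0 3) u \<partial>lborel)"
      by (intro nn_integral_indicator_mono line)
    also have "\<dots> = ennreal (V * (j + 1))"
      using V j by (subst nn_integral_cmult_indicator) (auto simp: ennreal_mult mult.commute)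
    finally show ?thesis .
  qed
  then show ?thesis using that[of "V * (j + 1)"] V j by simp
qed

text \<open>The expansion (1 + \<delta>/n)^(-s) \<ge> 1 - s \<delta>/n is useful for large
  \<open>n\<close>; for small \<open>n\<close> positivity of the kernel is better, hence the
  minimum.\<close>

lemma kernel_shift_defect:
  fixes s :: real
  assumes "s > 0" "\<delta> > 0" "n > 0" "0 < m" "m \<le> n + \<delta>"
  shows "n powr (- s) \<le> m powr (- s) + n powr (- s) * min 1 (s * \<delta> / n)"
proof -
  have "n + \<delta> = n * (1 + \<delta> / n)" using assms by (simp add: field_simps)
  then have "(n + \<delta>) powr (- s) = n powr (- s) * (1 + \<delta> / n) powr (- s)" using assms by (simp add: powr_mult)
  moreover have "(1 + \<delta> / n) powr (- s) \<ge> 1 - min 1 (s * \<delta> / n)"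
    using powr_one_plus_ge[of "\<delta> / n" s] assms by (auto simp: min_def)
  ultimately have "n powr (- s) * (1 - min 1 (s * \<delta> / n)) \<le> (n + \<delta>) powr (- s)"
    by (simp add: mult_left_mono)
  also have "\<dots> \<le> m powr (- s)" using assms by (intro powr_mono2') auto
  finally show ?thesis by (simp add: algebra_simps)
qed

text \<open>Bounds the drop of the potential when the point leaves the sphere by \<delta>. Along an
  inward chord of parameter length b the loss is O((\<delta> / b)^\<beta>), and b \<ge> |p \<bullet>
  u| / 2. The resulting singularity |p \<bullet> u|^(-\<beta>) at tangential directions is
  integrable since \<beta> < 1.\<close>

lemma ball_potential_exterior_ge:
  fixes s :: real
  assumes s: "0 < s" "s < real DIM('a::euclidean_space)" "real DIM('a) - s < 2"
  obtains K where "K \<ge> 0" "\<And>(p::'a) \<delta>. norm p = 1 \<Longrightarrow> 0 < \<delta> \<Longrightarrow>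
    ball_potential s p \<le> ball_potential s ((1 + \<delta>) *\<^sub>R p) + ennreal (K * \<delta> powr ((real DIM('a) - s) / 2))"
proof -
  let ?d = "real DIM('a)"
  define \<beta> where "\<beta> = (?d - s) / 2"
  have \<beta>: "0 < \<beta>" "\<beta> < 1" using s by (auto simp: \<beta>_def)
  obtain Kc where Kc: "Kc \<ge> 0" "\<And>b x. b > 0 \<Longrightarrow> x > 0 \<Longrightarrow>
    (\<integral>\<^sup>+t. ennreal ((b - t) powr (- \<beta>) * t powr (\<beta> - 1) * min 1 (x / t)) * indicator {0<..<b} t \<partial>lborel) \<le> ennreal (Kc * (x / b) powr \<beta>)"
    by (rule nn_integral_chord_truncated_le[OF \<beta>]) (rule that)
  obtain Kh where Kh: "Kh \<ge> 0"
    "\<And>p::'a. norm p = 1 \<Longrightarrow> (\<integral>\<^sup>+u. ennreal (\<bar>p \<bullet> u\<bar> powr (- \<beta>)) * indicator shell u \<partial>lborel) \<le> ennreal Kh"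
    by (rule nn_integral_hyperplane_singularity_le[OF \<beta>, where 'a='a]) (rule that)
  define K where "K = Kc * (2 * s) powr \<beta> * Kh / ln 2"
  have "ball_potential s p \<le> ball_potential s ((1 + \<delta>) *\<^sub>R p) + ennreal (K * \<delta> powr \<beta>)"
    if p: "norm p = 1" and \<delta>: "0 < \<delta>" for p :: 'a and \<delta>
  proof -
    define P where "P = (1 + \<delta>) *\<^sub>R p"
    have nP: "norm P > 1" using p \<delta> by (simp add: P_def)
    let ?R = "\<lambda>y. norm (y - p) powr (- s) * min 1 (s * \<delta> / norm (y - p))"
    have pt: "ball_weight \<beta> y * norm (y - p) powr (- s) \<le> ball_weight \<beta> y * norm (y - P) powr (- s) + ball_weight \<beta> y * ?R y" if "y \<noteq> p" for y
    proof (cases "norm y < 1")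
      case True
      have "norm (y - P) \<le> norm (y - p) + norm (\<delta> *\<^sub>R p)"
        using norm_triangle_ineq4[of "y - p" "\<delta> *\<^sub>R p"] by (simp add: P_def algebra_simps)
      then have "norm (y - P) \<le> norm (y - p) + \<delta>" using p \<delta> by simp
      moreover have "y \<noteq> P" using True nP by auto
      ultimately have "norm (y - p) powr (- s) \<le> norm (y - P) powr (- s) + ?R y"
        using that s \<delta> by (intro kernel_shift_defect) auto
      then have "ball_weight \<beta> y * norm (y - p) powr (- s) \<le> ball_weight \<beta> y * (norm (y - P) powr (- s) + ?R y)"
        by (rule mult_left_mono) simp
      then show ?thesis by (simp add: distrib_left)
    qed (simp add: ball_weight_outside)
    have "ball_potential s p \<le> (\<integral>\<^sup>+y. ennreal (ball_weight \<beta> y * norm (y - P) powr (- s)) + ennreal (ball_weight \<beta> y * ?R y) \<partial>lborel)"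
      unfolding ball_potential_def \<beta>_def[symmetric]
    proof (rule nn_integral_mono_AE)
      have "AE y in lborel. y \<noteq> p" by (rule AE_lborel_singleton)
      then show "AE y in lborel. ennreal (ball_weight \<beta> y * norm (y - p) powr (- s)) \<le> ennreal (ball_weight \<beta> y * norm (y - P) powr (- s)) + ennreal (ball_weight \<beta> y * ?R y)"
      proof eventually_elim
        case (elim y)
        have "ball_weight \<beta> y * ?R y \<ge> 0" using s \<delta> by simp
        then show ?case using pt[OF elim] by (simp add: ennreal_plus[symmetric] ennreal_leI del: ennreal_plus)
      qed
    qed
    also have "\<dots> = ball_potential s P + (\<integral>\<^sup>+y. ennreal (ball_weight \<beta> y * ?R y) \<partial>lborel)"
      unfolding ball_potential_def \<beta>_def[symmetric] by (rule nn_integral_add) measurable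
    also have "(\<integral>\<^sup>+y. ennreal (ball_weight \<beta> y * ?R y) \<partial>lborel) \<le> ennreal (K * \<delta> powr \<beta>)"
    proof -
      let ?V = "\<integral>\<^sup>+y. ennreal (ball_weight \<beta> y * ?R y) \<partial>lborel"
      let ?G = "\<lambda>y. norm y powr (- s) * min 1 (s * \<delta> / norm y)"
      have "?V = (\<integral>\<^sup>+y. ennreal (ball_weight \<beta> (p + y) * ?G y) \<partial>lborel)"
        by (subst nn_integral_lborel_translate[symmetric, of _ p]) auto
      then have "ennreal (ln 2) * ?V = (\<integral>\<^sup>+u. (\<integral>\<^sup>+t. ennreal (ball_weight \<beta> (p + t *\<^sub>R u) * ?G (t *\<^sub>R u)) * ennreal (t ^ (DIM('a) - 1)) * indicator {0<..} t \<partial>lborel) * indicator shell u \<partial>lborel)"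
        by (simp only:) (rule nn_integral_polar, measurable)
      also have "\<dots> \<le> (\<integral>\<^sup>+u. ennreal (Kc * (2 * s * \<delta>) powr \<beta>) * ennreal (\<bar>p \<bullet> u\<bar> powr (- \<beta>)) * indicator shell u \<partial>lborel)"
      proof (intro nn_integral_indicator_mono)
        fix u :: 'a assume "u \<in> shell"
        then have u: "norm u \<ge> 1" "norm u \<le> 2" by (auto simp: shell_def)
        let ?L = "\<lambda>t. ennreal (ball_weight \<beta> (p + t *\<^sub>R u) * ?G (t *\<^sub>R u)) * ennreal (t ^ (DIM('a) - 1)) * indicator {0<..} t"
        show "(\<integral>\<^sup>+t. ?L t \<partial>lborel) \<le> ennreal (Kc * (2 * s * \<delta>) powr \<beta>) * ennreal (\<bar>p \<bullet> u\<bar> powr (- \<beta>))"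
        proof (cases "p \<bullet> u < 0")
          case True
          define b where "b = - 2 * (p \<bullet> u) / (norm u)\<^sup>2"
          have n2: "(norm u)\<^sup>2 > 0" "(norm u)\<^sup>2 \<le> 4" using u power_mono[of "norm u" 2 2] by auto
          have b: "b > 0" using True n2 by (simp add: b_def divide_neg_pos)
          \<comment> \<open>The chord is short only for nearly tangential \<open>u\<close>; the
            constant comes from |u|^2 \<le> 4 on the shell.\<close>
          have bge: "b \<ge> \<bar>p \<bullet> u\<bar> / 2"
            unfolding b_def using True n2 by (simp add: field_simps)
          have "?L t \<le> ennreal ((b - t) powr (- \<beta>) * t powr (\<beta> - 1) * min 1 (s * \<delta> / t)) * indicator {0<..<b} t" for t
          proof (cases "t > 0")
            case t: True
            have tp: "t powr (- s) * t ^ (DIM('a) - 1) = t powr (2 * \<beta> - 1)"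
            proof -
              have e: "2 * \<beta> - 1 = - s + real (DIM('a) - 1)" by (simp add: \<beta>_def of_nat_diff Suc_leI)
              show ?thesis unfolding e powr_add powr_realpow[OF t] ..
            qed
            have nu: "norm u powr (- s) \<le> 1" "norm u powr (- 2 * \<beta>) \<le> 1"
              using powr_mono2'[of "- s" 1 "norm u"] powr_mono2'[of "- 2 * \<beta>" 1 "norm u"] s u \<beta> by auto
            have mn: "min 1 (s * \<delta> / norm (t *\<^sub>R u)) \<le> min 1 (s * \<delta> / t)"
            proof -
              have "t * 1 \<le> t * norm u" using t u by (intro mult_left_mono) auto
              moreover have "0 < t * norm u * t" using t u by (intro mult_pos_pos) auto
              ultimately have "s * \<delta> / norm (t *\<^sub>R u) \<le> s * \<delta> / t" using t s \<delta> by (intro divide_left_mono) auto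
              then show ?thesis by simp
            qed
            have "ball_weight \<beta> (p + t *\<^sub>R u) * ?G (t *\<^sub>R u) * t ^ (DIM('a) - 1)
               = norm u powr (- s) * min 1 (s * \<delta> / norm (t *\<^sub>R u)) * (ball_weight \<beta> (p + t *\<^sub>R u) * (t powr (- s) * t ^ (DIM('a) - 1)))"
              using t by (simp add: powr_mult mult_ac)
            also have "\<dots> = norm u powr (- s) * min 1 (s * \<delta> / norm (t *\<^sub>R u)) * (ball_weight \<beta> (p + t *\<^sub>R u) * t powr (2 * \<beta> - 1) * indicator {0<..} t)"
              unfolding tp using t by simp
            also have "\<dots> = norm u powr (- s) * min 1 (s * \<delta> / norm (t *\<^sub>R u)) * (norm u powr (- 2 * \<beta>) * ((b - t) powr (- \<beta>) * t powr (\<beta> - 1)) * indicator {0<..<b} t)"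
              unfolding ball_weight_boundary_chord[OF p True t, folded b_def] ..
            also have "\<dots> \<le> 1 * min 1 (s * \<delta> / t) * (1 * ((b - t) powr (- \<beta>) * t powr (\<beta> - 1)) * indicator {0<..<b} t)"
              using nu mn s \<delta> t by (intro mult_mono order_refl) auto
            also have "\<dots> = (b - t) powr (- \<beta>) * t powr (\<beta> - 1) * min 1 (s * \<delta> / t) * indicator {0<..<b} t"
              by (simp only: mult_ac mult_1)
            finally have le: "ball_weight \<beta> (p + t *\<^sub>R u) * ?G (t *\<^sub>R u) * t ^ (DIM('a) - 1) \<le> (b - t) powr (- \<beta>) * t powr (\<beta> - 1) * min 1 (s * \<delta> / t) * indicator {0<..<b} t" .
            have "?G (t *\<^sub>R u) \<ge> 0" using s \<delta> by simp
            then have "?L t = ennreal (ball_weight \<beta> (p + t *\<^sub>R u) * ?G (t *\<^sub>R u) * t ^ (DIM('a) - 1))"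
              using t by (simp add: ennreal_mult[symmetric] del: norm_scaleR)
            also have "\<dots> \<le> ennreal ((b - t) powr (- \<beta>) * t powr (\<beta> - 1) * min 1 (s * \<delta> / t) * indicator {0<..<b} t)"
              by (rule ennreal_leI[OF le])
            finally show ?thesis using t by (cases "t < b") simp_all
          qed simp
          then have "(\<integral>\<^sup>+t. ?L t \<partial>lborel) \<le> (\<integral>\<^sup>+t. ennreal ((b - t) powr (- \<beta>) * t powr (\<beta> - 1) * min 1 (s * \<delta> / t)) * indicator {0<..<b} t \<partial>lborel)"
            by (intro nn_integral_mono)
          also have "\<dots> \<le> ennreal (Kc * (s * \<delta> / b) powr \<beta>)" using b s \<delta> by (intro Kc) auto
          also have "\<dots> \<le> ennreal (Kc * (2 * s * \<delta> * \<bar>p \<bullet> u\<bar> powr (- 1)) powr \<beta>)"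
          proof (intro ennreal_leI mult_left_mono powr_mono2)
            show "s * \<delta> / b \<le> 2 * s * \<delta> * \<bar>p \<bullet> u\<bar> powr (- 1)"
            proof -
              have "s * \<delta> / b \<le> s * \<delta> / (\<bar>p \<bullet> u\<bar> / 2)" using bge b True s \<delta> by (intro divide_left_mono mult_pos_pos) auto
              then show ?thesis using True by (simp add: powr_minus field_simps)
            qed
          qed (use b s \<delta> \<beta> Kc in auto)
          also have "(2 * s * \<delta> * \<bar>p \<bullet> u\<bar> powr (- 1)) powr \<beta> = (2 * s * \<delta>) powr \<beta> * \<bar>p \<bullet> u\<bar> powr (- \<beta>)"
          proof -
            have "(\<bar>p \<bullet> u\<bar> powr (- 1)) powr \<beta> = \<bar>p \<bullet> u\<bar> powr (- \<beta>)" unfolding powr_powr by simp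
            then show ?thesis using s \<delta> by (subst powr_mult) auto
          qed
          finally show ?thesis using Kc(1) by (simp add: ennreal_mult[symmetric] mult.assoc)
        next
          case False
          have "ball_weight \<beta> (p + t *\<^sub>R u) = 0" if "t > 0" for t
          proof -
            have "(norm (p + t *\<^sub>R u))\<^sup>2 \<ge> 1" unfolding norm_add_scaleR_sq using p False that by simp
            then show ?thesis by (simp add: ball_weight_def max_def)
          qed
          then have "?L t = 0" for t by (cases "t > 0") auto
          then have "(\<integral>\<^sup>+t. ?L t \<partial>lborel) = (\<integral>\<^sup>+(t::real). 0 \<partial>lborel)" by (intro nn_integral_cong)
          then show ?thesis by simp
        qed
      qed
      also have "\<dots> = ennreal (Kc * (2 * s * \<delta>) powr \<beta>) * (\<integral>\<^sup>+u. ennreal (\<bar>p \<bullet> u\<bar> powr (- \<beta>)) * indicator shell u \<partial>lborel)"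
        by (subst nn_integral_cmult[symmetric]) (auto simp: mult.assoc)
      also have "\<dots> \<le> ennreal (Kc * (2 * s * \<delta>) powr \<beta>) * ennreal Kh"
        using Kh(2)[OF p] by (intro mult_left_mono) auto
      also have "\<dots> = ennreal (ln 2) * ennreal (K * \<delta> powr \<beta>)"
        using Kc Kh s \<delta> by (simp add: ennreal_mult[symmetric] K_def powr_mult mult_ac)
      finally show ?thesis by (subst (asm) ennreal_mult_le_mult_iff) auto
    qed
    finally show ?thesis by (simp add: P_def add_left_mono)
  qed
  moreover have "K \<ge> 0" using Kc Kh by (simp add: K_def)
  ultimately show ?thesis using that unfolding \<beta>_def by blast
qed

section \<open>Boundary points of the ball\<close>

lemma norm_exterior_ge:
  fixes z p :: "'a::real_inner"
  assumes "norm z \<le> 1" "norm p = 1" "t \<ge> 0"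
  shows "norm (z - p) \<le> norm (z - (1 + t) *\<^sub>R p)"
proof (rule power2_le_imp_le)
  have "z \<bullet> p \<le> 1" using norm_cauchy_schwarz[of z p] assms by simp
  then have "t * (z \<bullet> p) \<le> t * 1" using assms by (intro mult_left_mono)
  moreover have "(norm (z - (1 + t) *\<^sub>R p))\<^sup>2 = (norm (z - p))\<^sup>2 + t * t + 2 * t - 2 * (t * (z \<bullet> p))"
    using assms unfolding power2_norm_eq_inner
    by (simp add: inner_diff inner_commute norm_eq_1 algebra_simps)
  ultimately show "(norm (z - p))\<^sup>2 \<le> (norm (z - (1 + t) *\<^sub>R p))\<^sup>2"
    using assms by simp
qed simp

lemma separated_on_sphere:
  assumes s: "0 < s" "real DIM('a::euclidean_space) - 2 < s" "s < real DIM('a)"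
  shows "optimal_configurations_separated s (cball (0 :: 'a) 1) (frontier (cball 0 1)) ((s + real DIM('a)) / 2)"
proof -
  let ?d = "real DIM('a)"
  define \<beta> where "\<beta> = (?d - s) / 2"
  have \<beta>: "0 < \<beta>" "\<beta> < 1" using s by (auto simp: \<beta>_def)
  \<comment> \<open>With D = (s + d)/2 the exponent D - s of the error is \<beta>, the rate at which
    the equilibrium potential drops outside the ball.\<close>
  have e: "(s + ?d) / 2 - s = \<beta>" by (simp add: \<beta>_def field_simps)
  have s3: "?d - s < 2" using s by simp
  obtain K where K: "K \<ge> 0" "\<And>(p::'a) \<delta>. norm p = 1 \<Longrightarrow> 0 < \<delta> \<Longrightarrow>
    ball_potential s p \<le> ball_potential s ((1 + \<delta>) *\<^sub>R p) + ennreal (K * \<delta> powr \<beta>)"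
    by (rule ball_potential_exterior_ge[OF s(1,3) s3, folded \<beta>_def]) (rule that)
  \<comment> \<open>The constant value of the equilibrium potential on the closed ball. It must be
    finite and positive, as the balayage is normalised by it.\<close>
  obtain W where W: "W > 0" and Weq: "\<And>z::'a. norm z \<le> 1 \<Longrightarrow> ball_potential s z = ennreal W"
  proof -
    have eq: "ennreal (2 * ln 2) * ball_potential s z = equilibrium_const TYPE('a) s" if "norm z \<le> 1" for z :: 'a
      using that ball_potential_interior[OF s(1,3) s3, of z] ball_potential_boundary[OF s(1,3) s3, of z] by (cases "norm z < 1") auto
    then have "ennreal (2 * ln 2) * ball_potential s (0::'a) < \<infinity>" using equilibrium_const_finite[OF s(1,3) s3] by simp
    then have fin: "ball_potential s (0::'a) < \<infinity>" by (auto simp: ennreal_mult_less_top)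
    have pos: "ball_potential s (0::'a) \<noteq> 0"
    proof
      assume "ball_potential s (0::'a) = 0"
      then have "AE y in lborel. ennreal (ball_weight \<beta> (y::'a) * norm (y - 0) powr (- s)) = 0"
        unfolding ball_potential_def \<beta>_def by (subst (asm) nn_integral_0_iff_AE) auto
      moreover have "AE y in lborel. y \<noteq> (0::'a)" by (rule AE_lborel_singleton)
      ultimately have "AE y in lborel. (y::'a) \<notin> ball 0 1"
      proof eventually_elim
        case (elim y)
        show ?case
        proof
          assume "y \<in> ball 0 1"
          then have "1 - (norm y)\<^sup>2 > 0" by (simp add: abs_square_less_1)
          then have "ball_weight \<beta> y > 0" by (simp add: ball_weight_def)
          then have "ball_weight \<beta> y * norm (y - 0) powr (- s) > 0" using elim by simp
          with elim show False by (simp add: ennreal_eq_0_iff not_le)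
        qed
      qed
      then have "emeasure lborel (ball (0::'a) 1) = 0"
        by (subst (asm) AE_iff_measurable[where N = "ball 0 1"]) auto
      then show False using content_ball_pos[of 1 "0::'a"] by (simp add: measure_def)
    qed
    obtain W where W: "W > 0" "ball_potential s (0::'a) = ennreal W"
      using fin pos by (cases "ball_potential s (0::'a)") (auto simp: ennreal_eq_0_iff not_le)
    have "ball_potential s z = ennreal W" if "norm z \<le> 1" for z :: 'a
    proof -
      have "ennreal (2 * ln 2) * ball_potential s z = ennreal (2 * ln 2) * ball_potential s (0::'a)"
        using eq[OF that] eq[of 0] by simp
      then show ?thesis using W by (simp add: ennreal_mult_cancel_left)
    qed
    with W show ?thesis using that by blast
  qed
  have inf: "infinite (cball (0::'a) 1)"
    using uncountable_cball[of 1 "0::'a"] countable_finite by auto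
  show ?thesis
  proof (rule optimal_configurations_separatedI[where K = "K / W" and D = "(s + ?d) / 2", OF s(1) _ _ inf, unfolded e])
    fix p :: 'a and t :: real assume "p \<in> frontier (cball 0 1)" and t: "0 < t" "t \<le> 1"
    then have p: "norm p = 1" by simp
    define P where "P = (1 + t) *\<^sub>R p"
    have P: "norm P > 1" using p t by (simp add: P_def)
    define \<kappa> where "\<kappa> = (norm P)\<^sup>2 - 1"
    have k: "\<kappa> > 0" using P by (simp add: \<kappa>_def)
    \<comment> \<open>With this factor the potential on the ball is exactly |z - P|^(-s), that of a
      unit mass at \<open>P\<close>.\<close>
    define c where "c = \<kappa> powr \<beta> / W"
    have c: "c > 0" using k W by (simp add: c_def)
    define b where "b y = c * (ball_weight \<beta> y * norm (y - P) powr (- ?d))" for y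
    have [measurable]: "b \<in> borel_measurable borel" unfolding b_def by measurable
    define \<sigma> where "\<sigma> = density lborel (\<lambda>y. ennreal (b y))"
    have AE: "AE y in \<sigma>. y \<in> cball 0 1"
    proof -
      have "y \<in> cball 0 1" if "0 < b y" for y
        using that ball_weight_outside[of y \<beta>] by (cases "norm y \<ge> 1") (auto simp: b_def)
      then show ?thesis unfolding \<sigma>_def by (subst AE_density) auto
    qed
    have cm: "c * (\<kappa> powr (- \<beta>)) = 1 / W" using k by (simp add: c_def powr_minus)
    have em: "emeasure \<sigma> UNIV = ennreal (1 / W) * ball_potential s P"
    proof -
      have "emeasure \<sigma> UNIV = (\<integral>\<^sup>+y. ennreal (b y) \<partial>lborel)" unfolding \<sigma>_def by (simp add: emeasure_density)
      also have "\<dots> = (\<integral>\<^sup>+y. ennreal c * ennreal (ball_weight \<beta> y * norm (y - P) powr (- ?d)) \<partial>lborel)"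
        using c by (simp add: b_def ennreal_mult)
      also have "\<dots> = ennreal c * (ennreal (\<kappa> powr (- \<beta>)) * ball_potential s P)"
        unfolding \<kappa>_def \<beta>_def kelvin_mass[OF s(1,3) P, symmetric] by (rule nn_integral_cmult) measurable
      finally show ?thesis using c by (simp add: mult.assoc[symmetric] ennreal_mult[symmetric] cm)
    qed
    \<comment> \<open>This makes the potential at \<open>P\<close> finite, hence the mass a real
      number; the lower bound for the mass comes from \<open>K\<close>.\<close>
    have "ball_potential s P \<le> ball_potential s p"
      unfolding ball_potential_def \<beta>_def[symmetric]
    proof (rule nn_integral_mono_AE)
      have "AE y in lborel. y \<noteq> p" by (rule AE_lborel_singleton)
      then show "AE y in lborel. ennreal (ball_weight \<beta> y * norm (y - P) powr (- s)) \<le> ennreal (ball_weight \<beta> y * norm (y - p) powr (- s))"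
      proof eventually_elim
        case (elim y)
        show ?case
        proof (cases "norm y < 1")
          case True
          then show ?thesis using elim s p t norm_exterior_ge[of y p t]
            by (intro ennreal_leI mult_left_mono powr_mono2') (auto simp: P_def)
        qed (simp add: ball_weight_outside)
      qed
    qed
    also have "\<dots> = ennreal W" using p by (intro Weq) simp
    finally have "ball_potential s P < \<infinity>" by (rule le_less_trans) simp
    then obtain v where v: "v \<ge> 0" "ball_potential s P = ennreal v" by (cases "ball_potential s P") auto
    have "ennreal W \<le> ennreal v + ennreal (K * t powr \<beta>)"
      using K(2)[OF p t(1)] Weq[of p] p by (simp add: P_def[symmetric] v)
    then have "W \<le> v + K * t powr \<beta>"
      using v K(1) by (simp add: ennreal_plus[symmetric] del: ennreal_plus)
    then have "W / W \<le> (v + K * t powr \<beta>) / W" using W by (intro divide_right_mono) auto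
    then have mass: "1 - K / W * t powr \<beta> \<le> 1 / W * v" using W by (simp add: add_divide_distrib)
    let ?U = "\<lambda>z. \<integral>\<^sup>+y. riesz_kernel s y z \<partial>\<sigma>"
    have pot: "?U z \<le> ennreal (norm (z - P) powr (- s))" if z: "z \<in> cball 0 1" for z
    proof -
      have zP: "z \<noteq> P" using z P by auto
      have "?U z = (\<integral>\<^sup>+y. ennreal (b y) * riesz_kernel s y z \<partial>lborel)"
        unfolding \<sigma>_def by (rule nn_integral_density) measurable
      also have "\<dots> = (\<integral>\<^sup>+y. ennreal c * ennreal (ball_weight \<beta> y * norm (y - P) powr (- ?d) * norm (y - z) powr (- s)) \<partial>lborel)"
      proof (rule nn_integral_cong_AE)
        have "AE y in lborel. y \<noteq> z" by (rule AE_lborel_singleton)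
        then show "AE y in lborel. ennreal (b y) * riesz_kernel s y z = ennreal c * ennreal (ball_weight \<beta> y * norm (y - P) powr (- ?d) * norm (y - z) powr (- s))"
          by eventually_elim (use c in \<open>simp add: b_def riesz_kernel_def ennreal_mult mult.assoc\<close>)
      qed
      also have "\<dots> = ennreal c * (ennreal (\<kappa> powr (- \<beta>) * norm (z - P) powr (- s)) * ball_potential s (inversion P \<kappa> z))"
        unfolding \<kappa>_def \<beta>_def using z by (subst kelvin_potential[OF s(1,3) P, symmetric]) (auto intro: nn_integral_cmult)
      \<comment> \<open>The inversion preserves the closed ball, so the equilibrium potential takes
        its constant value at the image of \<open>z\<close>.\<close>
      also have "ball_potential s (inversion P \<kappa> z) = ennreal W"
      proof (rule Weq)
        have "(1 - (norm z)\<^sup>2) * (\<kappa> / (norm (z - P))\<^sup>2) \<ge> 0" using z k by (intro mult_nonneg_nonneg) (auto simp: abs_square_le_1)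
        then have "(norm (inversion P \<kappa> z))\<^sup>2 \<le> 1" using inversion_norm[OF zP] by (simp add: \<kappa>_def)
        then show "norm (inversion P \<kappa> z) \<le> 1" by (simp add: abs_square_le_1)
      qed
      also have "ennreal c * (ennreal (\<kappa> powr (- \<beta>) * norm (z - P) powr (- s)) * ennreal W) = ennreal ((c * \<kappa> powr (- \<beta>)) * W * norm (z - P) powr (- s))"
        using c W by (simp add: ennreal_mult[symmetric] mult_ac)
      finally show ?thesis unfolding cm using W by simp
    qed
    \<comment> \<open>Both bounds follow from |z - P|^(-s): \<open>P\<close> is no closer to
      \<open>z\<close> than \<open>p\<close>, and its distance from every point of the ball is at
      least \<open>t\<close>.\<close>
    have "?U z \<le> ennreal (norm (z - p) powr (- s) * (1 + K / W * t powr \<beta>)) \<and>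
          ?U z \<le> ennreal (t powr (- s))" if z: "z \<in> cball 0 1" "z \<noteq> p" for z
    proof
      have "norm (z - P) powr (- s) \<le> norm (z - p) powr (- s)"
        using z s norm_exterior_ge[of z p t] p t by (intro powr_mono2') (auto simp: P_def)
      also have "\<dots> \<le> norm (z - p) powr (- s) * (1 + K / W * t powr \<beta>)"
        using K W by (simp add: distrib_left)
      finally show "?U z \<le> ennreal (norm (z - p) powr (- s) * (1 + K / W * t powr \<beta>))"
        using pot[OF z(1)] by (meson ennreal_leI order_trans)
      have "norm P - norm z \<le> norm (z - P)" by (metis norm_minus_commute norm_triangle_ineq2)
      then have "t \<le> norm (z - P)" using z p t by (simp add: P_def)
      then have "norm (z - P) powr (- s) \<le> t powr (- s)" using t s by (intro powr_mono2') auto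
      then show "?U z \<le> ennreal (t powr (- s))"
        using pot[OF z(1)] by (meson ennreal_leI order_trans)
    qed
    moreover have "emeasure \<sigma> UNIV = ennreal (1 / W * v)" using em v W by (simp add: ennreal_mult[symmetric])
    ultimately show "\<exists>\<sigma>. test_measure s (cball 0 1) p t (K / W * t powr \<beta>) \<sigma>"
      unfolding test_measure_def using AE mass by (intro exI[of _ \<sigma>]) (auto simp: \<sigma>_def)
  qed (use s K W in \<open>auto simp: field_simps\<close>)
qed

theorem mainTheorem2:
  fixes l :: nat and s :: real
  assumes "l \<ge> 1" and "s > 0"
    and "CARD('n::finite) = l" and "CARD('m::finite) = l + 1"
  shows
    "(\<forall>A :: (real ^ 'm) set.
        compact A \<and> smooth_submanifold l A \<and> ahlfors_regular l A \<and>
        real l - 1 \<le> s \<and> s < real l \<longrightarrow>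
        optimal_configurations_separated s A A (real l)) \<and>
     (\<forall>(A :: (real ^ 'n) set) \<epsilon>.
        compact A \<and> real l - 2 < s \<and> s < real l \<and> \<epsilon> > 0 \<longrightarrow>
        optimal_configurations_separated s A {x \<in> A. infdist x (frontier A) \<ge> \<epsilon>} (real l)) \<and>
     (\<forall>\<epsilon>. real l - 2 < s \<and> s < real l \<and> 0 < \<epsilon> \<and> \<epsilon> < 1 \<longrightarrow>
        optimal_configurations_separated s (cball (0 :: real ^ 'n) 1) {x. norm x \<le> 1 - \<epsilon>} (real l)) \<and>
     (real l - 2 < s \<and> s < real l \<longrightarrow>
        optimal_configurations_separated s (cball (0 :: real ^ 'n) 1)
          (frontier (cball (0 :: real ^ 'n) 1)) ((s + real l) / 2))"
proof (intro conjI allI impI)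
  have dim: "DIM(real ^ 'n) = l" using assms(3) by simp
  show "optimal_configurations_separated s A A (real l)"
    if "compact A \<and> smooth_submanifold l A \<and> ahlfors_regular l A \<and> real l - 1 \<le> s \<and> s < real l"
    for A :: "(real ^ 'm) set"
    \<comment> \<open>\<open>real ^ 'n\<close>, of dimension l, is the model of the tangent spaces
      of the manifold in \<open>real ^ 'm\<close>. Here s \<ge> l - 1 gives l - s \<le> 1 <
      2.\<close>
    using separated_on_smooth_submanifold[where 'b = "real ^ 'n", of A s, unfolded dim] that assms(2) by auto
  show "optimal_configurations_separated s A {x \<in> A. infdist x (frontier A) \<ge> \<epsilon>} (real l)"
    if "compact A \<and> real l - 2 < s \<and> s < real l \<and> \<epsilon> > 0" for A :: "(real ^ 'n) set" and \<epsilon>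
    using separated_in_interior[of A s \<epsilon>, unfolded dim] that assms(2) by auto
  show "optimal_configurations_separated s (cball (0 :: real ^ 'n) 1) {x. norm x \<le> 1 - \<epsilon>} (real l)"
    if "real l - 2 < s \<and> s < real l \<and> 0 < \<epsilon> \<and> \<epsilon> < 1" for \<epsilon>
    using separated_in_ball_interior[where 'a = "real ^ 'n", of s \<epsilon>, unfolded dim] that assms(2) by auto
  show "optimal_configurations_separated s (cball (0 :: real ^ 'n) 1)
          (frontier (cball (0 :: real ^ 'n) 1)) ((s + real l) / 2)"
    if "real l - 2 < s \<and> s < real l"
    using separated_on_sphere[where 'a = "real ^ 'n", of s, unfolded dim] that assms(2) by auto
qed

end
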